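(* Let $S$ be a real submanifold of class $\mathcal{C}^1$ embedded in a complex manifold $X$. If $S$ has only isolated complex points, then there exist an open neighborhood $U$ of $S$ in $X$ and a strongly plurisubharmonic function $\rho\colon U\to\mathbb{R}$.
   Context: Let $J$ denote the almost complex structure operator on the real tangent bundle $TX$ induced by the complex structure of $X$, so $J$ is a real endomorphism of $TX$ with $J^2=-\mathrm{Id}$. A real submanifold $S\subset X$ of class $\mathcal{C}^1$ is totally real at a point $p\in S$ if $T_pS\cap J(T_pS)=\{0\}$. A point $p\in S$ at which $S$ is not totally real is called a complex point of $S$. For a $\mathcal{C}^2$ function $\rho\colon U\to\mathbb{R}$ on an open subset $U$ of a complex manifold of complex dimension $n$, its Levi form is given in any local holomorphic coordinates $z=(z_1,\ldots,z_n)$ by $$\mathcal{L}_\rho(z;v)=\sum_{j,k=1}^n \frac{\partial^2\rho(z)}{\partial z_j\,\partial\bar z_k}\,v_j\overline{v}_k,\qquad v\in\mathbb{C}^n.$$ The function $\rho$ is strongly plurisubharmonic if $\mathcal{L}_\rho>0$, i.e. $\mathcal{L}_\rho(z;v)>0$ at every point and for every $v\neq 0$. *)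

theory Defs
  imports "HOL-Analysis.Analysis"
begin

section \<open>Maps of class C1 and C2 between normed spaces\<close>

definition C1_on :: "('a::real_normed_vector \<Rightarrow> 'b::real_normed_vector) \<Rightarrow> 'a set \<Rightarrow> bool" where
  "C1_on f W \<longleftrightarrow> (\<exists>f' :: 'a \<Rightarrow> 'a \<Rightarrow>\<^sub>L 'b.
     (\<forall>x\<in>W. (f has_derivative blinfun_apply (f' x)) (at x)) \<and> continuous_on W f')"

definition C2_on :: "('a::real_normed_vector \<Rightarrow> 'b::real_normed_vector) \<Rightarrow> 'a set \<Rightarrow> bool" where
  "C2_on f W \<longleftrightarrow> (\<exists>f' :: 'a \<Rightarrow> 'a \<Rightarrow>\<^sub>L 'b.
     (\<forall>x\<in>W. (f has_derivative blinfun_apply (f' x)) (at x)) \<and> C1_on f' W)"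

definition C1_diffeomorphism_on ::
    "('a::real_normed_vector \<Rightarrow> 'b::real_normed_vector) \<Rightarrow> 'a set \<Rightarrow> bool" where
  "C1_diffeomorphism_on \<Phi> W \<longleftrightarrow>
     open W \<and> inj_on \<Phi> W \<and> C1_on \<Phi> W \<and> open (\<Phi> ` W) \<and> C1_on (inv_into W \<Phi>) (\<Phi> ` W)"


section \<open>Complex manifolds\<close>

text \<open>Complex scaling on \<^typ>\<open>complex ^ 'n\<close> is \<^term>\<open>(*s)\<close>; the derivative taken here is a priori
  only real linear.\<close>

definition holomorphic_map_on :: "(complex ^ 'n \<Rightarrow> complex ^ 'm) \<Rightarrow> (complex ^ 'n) set \<Rightarrow> bool" where
  "holomorphic_map_on f W \<longleftrightarrow>
     (\<forall>z\<in>W. \<exists>D. (f has_derivative D) (at z) \<and> (\<forall>c v. D (c *s v) = c *s D v))"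

type_synonym ('a, 'n) chart = "'a set \<times> ('a \<Rightarrow> complex ^ 'n)"

text \<open>A chart is a pair \<open>(U, \<phi>)\<close>. The values of \<open>\<phi>\<close> outside \<open>U\<close> are irrelevant.\<close>

definition topological_chart :: "'a topology \<Rightarrow> ('a, 'n::finite) chart \<Rightarrow> bool" where
  "topological_chart X = (\<lambda>(U, \<phi>). openin X U \<and> open (\<phi> ` U) \<and>
     homeomorphic_map (subtopology X U) (top_of_set (\<phi> ` U)) \<phi>)"

definition transition :: "('a, 'n) chart \<Rightarrow> ('a, 'n) chart \<Rightarrow> complex ^ 'n \<Rightarrow> complex ^ 'n" where
  "transition = (\<lambda>(U, \<phi>) (V, \<psi>). \<psi> \<circ> inv_into U \<phi>)"

definition holomorphically_compatible ::
    "('a, 'n::finite) chart \<Rightarrow> ('a, 'n) chart \<Rightarrow> bool" where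
  "holomorphically_compatible c d \<longleftrightarrow>
     holomorphic_map_on (transition c d) (snd c ` (fst c \<inter> fst d)) \<and>
     holomorphic_map_on (transition d c) (snd d ` (fst c \<inter> fst d))"

text \<open>The atlas \<open>A\<close> is required to be maximal, so that its members are precisely the local
  holomorphic coordinate systems of the manifold.\<close>

definition complex_manifold :: "'a topology \<Rightarrow> ('a, 'n::finite) chart set \<Rightarrow> bool" where
  "complex_manifold X A \<longleftrightarrow>
     Hausdorff_space X \<and> second_countable X \<and>
     (\<forall>c\<in>A. topological_chart X c) \<and>
     topspace X = (\<Union>c\<in>A. fst c) \<and>
     (\<forall>c\<in>A. \<forall>d\<in>A. holomorphically_compatible c d) \<and>
     (\<forall>c. topological_chart X c \<and> (\<forall>d\<in>A. holomorphically_compatible c d) \<longrightarrow> c \<in> A)"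


section \<open>The real tangent bundle and its almost complex structure\<close>

text \<open>A tangent vector at \<open>p\<close> is encoded by its coordinate vectors in all charts around \<open>p\<close>, which
  are related by the derivatives of the transition maps; it is zero by convention at charts
  not containing \<open>p\<close>. The zero vector is thus the zero function.\<close>

definition tangent_space :: "('a, 'n::finite) chart set \<Rightarrow> 'a \<Rightarrow> (('a, 'n) chart \<Rightarrow> complex ^ 'n) set"
  where
  "tangent_space A p = {v.
     (\<forall>c. \<not> (c \<in> A \<and> p \<in> fst c) \<longrightarrow> v c = 0) \<and>
     (\<forall>c\<in>A. \<forall>d\<in>A. p \<in> fst c \<and> p \<in> fst d \<longrightarrow>
        v d = frechet_derivative (transition c d) (at (snd c p)) (v c))}"

definition J_op :: "(('a, 'n::finite) chart \<Rightarrow> complex ^ 'n) \<Rightarrow> ('a, 'n) chart \<Rightarrow> complex ^ 'n" where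
  "J_op v = (\<lambda>c. \<i> *s v c)"


section \<open>Real submanifolds of class C1 and their complex points\<close>

text \<open>Locally flat subsets of a normed space. The dimension of the subspace \<open>L\<close> is
  arbitrary and may depend on the point. No closedness is required.\<close>

definition C1_submanifold_flat :: "'e::real_normed_vector set \<Rightarrow> bool" where
  "C1_submanifold_flat M \<longleftrightarrow>
     (\<forall>x\<in>M. \<exists>W (\<Phi> :: 'e \<Rightarrow> 'e) L. x \<in> W \<and> C1_diffeomorphism_on \<Phi> W \<and> subspace L \<and>
        \<Phi> ` (W \<inter> M) = \<Phi> ` W \<inter> L)"

definition C1_submanifold :: "'a topology \<Rightarrow> ('a, 'n::finite) chart set \<Rightarrow> 'a set \<Rightarrow> bool" where
  "C1_submanifold X A S \<longleftrightarrow> S \<subseteq> topspace X \<and>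
     (\<forall>p\<in>S. \<exists>(U, \<phi>)\<in>A. p \<in> U \<and> C1_submanifold_flat (\<phi> ` (U \<inter> S)))"

definition velocities :: "'e::real_normed_vector set \<Rightarrow> 'e \<Rightarrow> 'e set" where
  "velocities M x = {v. \<exists>\<gamma> \<epsilon>. 0 < \<epsilon> \<and> \<gamma> C1_differentiable_on {-\<epsilon><..<\<epsilon>} \<and>
     \<gamma> ` {-\<epsilon><..<\<epsilon>} \<subseteq> M \<and> \<gamma> 0 = x \<and> (\<gamma> has_vector_derivative v) (at 0)}"

definition submanifold_tangent_space ::
    "('a, 'n::finite) chart set \<Rightarrow> 'a set \<Rightarrow> 'a \<Rightarrow> (('a, 'n) chart \<Rightarrow> complex ^ 'n) set" where
  "submanifold_tangent_space A S p = {v \<in> tangent_space A p.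
     \<forall>(U, \<phi>)\<in>A. p \<in> U \<longrightarrow> v (U, \<phi>) \<in> velocities (\<phi> ` (U \<inter> S)) (\<phi> p)}"

definition totally_real_at :: "('a, 'n::finite) chart set \<Rightarrow> 'a set \<Rightarrow> 'a \<Rightarrow> bool" where
  "totally_real_at A S p \<longleftrightarrow>
     submanifold_tangent_space A S p \<inter> J_op ` submanifold_tangent_space A S p = {\<lambda>_. 0}"

definition complex_points :: "('a, 'n::finite) chart set \<Rightarrow> 'a set \<Rightarrow> 'a set" where
  "complex_points A S = {p \<in> S. \<not> totally_real_at A S p}"

definition only_isolated_complex_points ::
    "'a topology \<Rightarrow> ('a, 'n::finite) chart set \<Rightarrow> 'a set \<Rightarrow> bool" where
  "only_isolated_complex_points X A S \<longleftrightarrow>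
     (\<forall>p\<in>complex_points A S. \<exists>V. openin X V \<and> V \<inter> complex_points A S = {p})"


section \<open>Strongly plurisubharmonic functions\<close>

text \<open>The Wirtinger operators \<open>\<partial>/\<partial>z\<^sub>j = (\<partial>/\<partial>x\<^sub>j - \<i> \<partial>/\<partial>y\<^sub>j)/2\<close> and
  \<open>\<partial>/\<partial>\<bar>z\<^sub>j = (\<partial>/\<partial>x\<^sub>j + \<i> \<partial>/\<partial>y\<^sub>j)/2\<close>, where \<open>z\<^sub>j = x\<^sub>j + \<i> y\<^sub>j\<close>.\<close>

definition d_z :: "'n::finite \<Rightarrow> (complex ^ 'n \<Rightarrow> complex) \<Rightarrow> complex ^ 'n \<Rightarrow> complex" where
  "d_z j f z = (frechet_derivative f (at z) (axis j 1)
     - \<i> * frechet_derivative f (at z) (axis j \<i>)) / 2"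

definition d_zbar :: "'n::finite \<Rightarrow> (complex ^ 'n \<Rightarrow> complex) \<Rightarrow> complex ^ 'n \<Rightarrow> complex" where
  "d_zbar j f z = (frechet_derivative f (at z) (axis j 1)
     + \<i> * frechet_derivative f (at z) (axis j \<i>)) / 2"

text \<open>For a real-valued function of class C2 the sum below is a Hermitian form in \<open>v\<close>, hence real;
  taking the real part only serves to obtain the type \<^typ>\<open>real\<close>.\<close>

definition levi_form :: "(complex ^ 'n::finite \<Rightarrow> real) \<Rightarrow> complex ^ 'n \<Rightarrow> complex ^ 'n \<Rightarrow> real" where
  "levi_form g z v =
     Re (\<Sum>j\<in>UNIV. \<Sum>k\<in>UNIV.
       d_z j (d_zbar k (\<lambda>w. complex_of_real (g w))) z * v $ j * cnj (v $ k))"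

definition strongly_plurisubharmonic_on ::
    "('a, 'n::finite) chart set \<Rightarrow> 'a set \<Rightarrow> ('a \<Rightarrow> real) \<Rightarrow> bool" where
  "strongly_plurisubharmonic_on A U \<rho> \<longleftrightarrow>
     (\<forall>(V, \<phi>)\<in>A. C2_on (\<rho> \<circ> inv_into V \<phi>) (\<phi> ` (V \<inter> U)) \<and>
        (\<forall>z\<in>\<phi> ` (V \<inter> U). \<forall>v. v \<noteq> 0 \<longrightarrow> 0 < levi_form (\<rho> \<circ> inv_into V \<phi>) z v))"

end

theory Submission
  imports Defs "HOL-Complex_Analysis.Cauchy_Integral_Formula"
begin

text \<open>Near a point \<open>p\<close> of \<open>S\<close> write \<open>S\<close> in a chart as the zero set of a map \<open>w\<close> of class C1 with
  \<open>ker dw = TS\<close>. The function \<open>|w|^2\<close> would have Levi form \<open>(|dw v|^2 + |dw iv|^2)/2 \<ge> 0\<close> along \<open>S\<close>, positive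
  at totally real points, but it is only C1; there are functions \<open>f\<close> of class C2 that are as small as
  desired along \<open>S\<close> and whose Hessian there is bounded below by that of \<open>|w|^2/2\<close> up to an
  arbitrarily small error. Adding a function that is \<open>1 + |z - p|^2\<close> near \<open>p\<close> and negative away from \<open>p\<close>
  to a large multiple of such an \<open>f\<close>, and composing with \<open>max 0 s ^ 3\<close>, one gets a compactly supported C2
  function whose Levi form is nonnegative at all points of \<open>S\<close> and positive at the points of \<open>S\<close> near \<open>p\<close>,
  even if \<open>p\<close> is an isolated complex point. Consequently no partition of unity is needed: a
  locally finite sum of such functions has positive Levi form along \<open>S\<close>, hence near \<open>S\<close>.\<close>

section \<open>Calculus of functions of class C1 and C2\<close>

text \<open>Regularity is the obstacle: \<open>S\<close> and hence its defining map \<open>w\<close>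
  are only C1, so the squared norm of \<open>w\<close> has no Hessian to speak of. But the Hessian
  expected along the zero set involves only first derivatives of \<open>w\<close>; replacing
  \<open>w\<close> by its first order Taylor polynomials on a fine lattice produces C2 functions
  with nearly that Hessian.

  Near a complex point \<open>p\<close> the order of choices matters. At \<open>p\<close> itself
  \<open>|z - p|^2\<close> must supply positivity, but cutting it off costs a fixed negative amount
  on an annulus around \<open>p\<close>. As \<open>p\<close> is isolated, a small annulus contains
  no complex points, and a factor \<open>A\<close> depending only on the annulus makes good the
  loss. Afterwards \<open>f\<close> is chosen with \<open>A f \<le> 1/2\<close> along
  \<open>S\<close>, which is possible because the lower bound for the Hessian of \<open>f\<close>
  does not deteriorate as \<open>f\<close> gets small. The cutoff then takes place where the
  function is negative and is erased by \<open>max 0 s ^ 3\<close>.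

  Two gaps are left by the definitions: \<open>S\<close> may fail to be closed in \<open>X\<close>,
  so the sum is formed on an open set in which it is closed; and coordinate changes come without
  continuity of their derivatives, which Cauchy's formula provides.\<close>

lemma C1_onI:
  fixes f :: "'a::euclidean_space \<Rightarrow> 'b::real_normed_vector"
  assumes "\<And>x. x \<in> W \<Longrightarrow> (f has_derivative f' x) (at x)"
    and "\<And>v. continuous_on W (\<lambda>x. f' x v)"
  shows "C1_on f W"
proof -
  have bl: "bounded_linear (f' x)" if "x \<in> W" for x
    using assms(1)[OF that] by (rule has_derivative_bounded_linear)
  have "continuous_on W (\<lambda>x. Blinfun (f' x))"
  proof (rule continuous_on_blinfun_componentwise)
    fix i :: 'a
    show "continuous_on W (\<lambda>x. blinfun_apply (Blinfun (f' x)) i)"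
      using assms(2)[of i] by (rule continuous_on_eq) (simp add: bounded_linear_Blinfun_apply bl)
  qed
  then show ?thesis
    unfolding C1_on_def using assms(1) bl
    by (intro exI[of _ "\<lambda>x. Blinfun (f' x)"]) (simp add: bounded_linear_Blinfun_apply)
qed

text \<open>In finite dimension the operator valued derivative is a fixed linear combination of its
  values on basis vectors, so its regularity can be tested one direction at a time.\<close>

lemma C2_onI:
  fixes f :: "'a::euclidean_space \<Rightarrow> 'b::real_normed_vector"
  assumes f: "\<And>x. x \<in> W \<Longrightarrow> (f has_derivative f' x) (at x)"
    and C1: "\<And>v. C1_on (\<lambda>x. f' x v) W" and W: "open W"
  shows "C2_on f W"
proof -
  define F where "F x = (\<Sum>b\<in>Basis. blinfun_scaleR_left (f' x b) o\<^sub>L blinfun_inner_left b)" for x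
  have F: "blinfun_apply (F x) = f' x" if "x \<in> W" for x
  proof
    fix v
    interpret bounded_linear "f' x" using f[OF that] by (rule has_derivative_bounded_linear)
    have "f' x v = f' x (\<Sum>b\<in>Basis. (v \<bullet> b) *\<^sub>R b)" by (simp add: euclidean_representation)
    then show "blinfun_apply (F x) v = f' x v"
      unfolding F_def by (simp add: blinfun.sum_left sum scaleR)
  qed
  have "\<forall>v. \<exists>g. (\<forall>x\<in>W. ((\<lambda>x. f' x v) has_derivative blinfun_apply (g x)) (at x)) \<and> continuous_on W g"
    using C1 unfolding C1_on_def by blast
  then obtain g where g: "\<And>v x. x \<in> W \<Longrightarrow> ((\<lambda>x. f' x v) has_derivative blinfun_apply (g v x)) (at x)"
    "\<And>v. continuous_on W (g v)"
    by metis
  have "C1_on F W"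
  proof (rule C1_onI)
    fix x assume x: "x \<in> W"
    show "(F has_derivative (\<lambda>h. \<Sum>b\<in>Basis. blinfun_scaleR_left (g b x h) o\<^sub>L blinfun_inner_left b)) (at x)"
      unfolding F_def
      by (intro has_derivative_sum bounded_linear.has_derivative[OF
            bounded_linear_compose[OF bounded_bilinear.bounded_linear_left[OF
              bounded_bilinear_blinfun_compose] bounded_linear_blinfun_scaleR_left]] g x)
  next
    fix v
    show "continuous_on W (\<lambda>x. \<Sum>b\<in>Basis. blinfun_scaleR_left (g b x v) o\<^sub>L blinfun_inner_left b)"
      by (intro continuous_intros g bounded_linear.continuous_on[OF bounded_linear_blinfun_scaleR_left])
  qed
  moreover have "\<forall>x\<in>W. (f has_derivative blinfun_apply (F x)) (at x)" using f F by simp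
  ultimately show ?thesis unfolding C2_on_def by blast
qed

lemma C1_on_subset: "C1_on f W \<Longrightarrow> V \<subseteq> W \<Longrightarrow> C1_on f V"
  unfolding C1_on_def by (meson continuous_on_subset subsetD)

lemma C2_on_subset: "C2_on f W \<Longrightarrow> V \<subseteq> W \<Longrightarrow> C2_on f V"
  unfolding C2_on_def by (meson C1_on_subset subsetD)

lemma C1_on_continuous: "C1_on f W \<Longrightarrow> continuous_on W f"
  unfolding C1_on_def by (blast intro: continuous_at_imp_continuous_on has_derivative_continuous)

lemma C2_on_imp_C1_on: "C2_on f W \<Longrightarrow> C1_on f W"
  unfolding C2_on_def C1_on_def[of f] using C1_on_continuous by blast

lemma has_derivative_cong_open:
  assumes "open W" "\<forall>y\<in>W. f y = g y"
  shows "\<forall>x\<in>W. (f has_derivative D x) (at x) \<longrightarrow> (g has_derivative D x) (at x)"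
proof (intro ballI impI)
  fix x assume "x \<in> W" "(f has_derivative D x) (at x)"
  then show "(g has_derivative D x) (at x)"
    using has_derivative_transform_within_open[of f "D x" x UNIV W g] assms by simp
qed

lemma C1_on_cong:
  assumes "open W" "\<And>x. x \<in> W \<Longrightarrow> f x = g x" "C1_on f W"
  shows "C1_on g W"
proof -
  obtain f' where f': "\<forall>x\<in>W. (f has_derivative blinfun_apply (f' x)) (at x)" "continuous_on W f'"
    using assms(3) unfolding C1_on_def by blast
  then have "\<forall>x\<in>W. (g has_derivative blinfun_apply (f' x)) (at x)"
    using has_derivative_cong_open[OF assms(1), of f g "\<lambda>x. blinfun_apply (f' x)"] assms(2) by blast
  with f' show ?thesis unfolding C1_on_def by blast
qed

lemma C2_on_cong:
  assumes "open W" "\<And>x. x \<in> W \<Longrightarrow> f x = g x" "C2_on f W"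
  shows "C2_on g W"
proof -
  obtain f' where f': "\<forall>x\<in>W. (f has_derivative blinfun_apply (f' x)) (at x)" "C1_on f' W"
    using assms(3) unfolding C2_on_def by blast
  then have "\<forall>x\<in>W. (g has_derivative blinfun_apply (f' x)) (at x)"
    using has_derivative_cong_open[OF assms(1), of f g "\<lambda>x. blinfun_apply (f' x)"] assms(2) by blast
  with f' show ?thesis unfolding C2_on_def by blast
qed

text \<open>Derivatives obtained on different neighbourhoods agree by uniqueness, so
  \<open>frechet_derivative\<close> is a global witness for all of them.\<close>

lemma C1_on_local:
  fixes f :: "'a::euclidean_space \<Rightarrow> 'b::real_normed_vector"
  assumes "\<And>x. x \<in> W \<Longrightarrow> \<exists>V. open V \<and> x \<in> V \<and> C1_on f V"
  shows "C1_on f W"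
proof (rule C1_onI)
  fix x assume "x \<in> W"
  then obtain V where "open V" "x \<in> V" "C1_on f V" using assms by blast
  then show "(f has_derivative frechet_derivative f (at x)) (at x)"
    unfolding frechet_derivative_works[symmetric] C1_on_def differentiable_def by blast
next
  fix v
  show "continuous_on W (\<lambda>x. frechet_derivative f (at x) v)"
  proof (rule continuous_at_imp_continuous_on, rule ballI)
    fix x assume "x \<in> W"
    then obtain V where V: "open V" "x \<in> V" "C1_on f V" using assms by blast
    then obtain f' where f': "\<And>x. x \<in> V \<Longrightarrow> (f has_derivative blinfun_apply (f' x)) (at x)"
      "continuous_on V f'" unfolding C1_on_def by blast
    have "continuous_on V (\<lambda>x. f' x v)" by (intro continuous_intros f')
    then have "continuous_on V (\<lambda>x. frechet_derivative f (at x) v)"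
      by (rule continuous_on_eq) (simp add: frechet_derivative_at[OF f'(1), symmetric])
    then show "isCont (\<lambda>x. frechet_derivative f (at x) v) x"
      using V continuous_on_eq_continuous_at by blast
  qed
qed

lemma C2_on_local:
  fixes f :: "'a::euclidean_space \<Rightarrow> 'b::real_normed_vector"
  assumes loc: "\<And>x. x \<in> W \<Longrightarrow> \<exists>V. open V \<and> x \<in> V \<and> C2_on f V" and W: "open W"
  shows "C2_on f W"
proof (rule C2_onI[OF _ _ W])
  fix x assume "x \<in> W"
  then obtain V where "open V" "x \<in> V" "C2_on f V" using loc by blast
  then show "(f has_derivative frechet_derivative f (at x)) (at x)"
    unfolding frechet_derivative_works[symmetric] C2_on_def differentiable_def by blast
next
  fix v
  show "C1_on (\<lambda>x. frechet_derivative f (at x) v) W"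
  proof (rule C1_on_local)
    fix x assume "x \<in> W"
    then obtain V where V: "open V" "x \<in> V" "C2_on f V" using loc by blast
    then obtain f' where f': "\<And>x. x \<in> V \<Longrightarrow> (f has_derivative blinfun_apply (f' x)) (at x)"
      "C1_on f' V" unfolding C2_on_def by blast
    obtain f'' where f'': "\<And>x. x \<in> V \<Longrightarrow> (f' has_derivative blinfun_apply (f'' x)) (at x)"
      "continuous_on V f''" using f'(2) unfolding C1_on_def by blast
    have "C1_on (\<lambda>x. f' x v) V"
      by (rule C1_onI[of _ _ "\<lambda>x u. f'' x u v"])
        (auto intro!: derivative_eq_intros continuous_intros f'')
    then have "C1_on (\<lambda>x. frechet_derivative f (at x) v) V"
      by (rule C1_on_cong[OF V(1), rotated])
        (simp add: frechet_derivative_at[OF f'(1), symmetric])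
    with V show "\<exists>V. open V \<and> x \<in> V \<and> C1_on (\<lambda>x. frechet_derivative f (at x) v) V" by blast
  qed
qed

lemma C1_on_bilinear:
  fixes f :: "'d::euclidean_space \<Rightarrow> 'a::real_normed_vector"
    and g :: "'d \<Rightarrow> 'b::real_normed_vector"
    and prod :: "'a \<Rightarrow> 'b \<Rightarrow> 'c::real_normed_vector"
  assumes "bounded_bilinear prod" "C1_on f W" "C1_on g W"
  shows "C1_on (\<lambda>x. prod (f x) (g x)) W"
proof -
  obtain f' g' where
    d: "\<And>x. x \<in> W \<Longrightarrow> (f has_derivative blinfun_apply (f' x)) (at x)"
       "\<And>x. x \<in> W \<Longrightarrow> (g has_derivative blinfun_apply (g' x)) (at x)"
    and c: "continuous_on W f'" "continuous_on W g'"
    using assms unfolding C1_on_def by blast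
  show ?thesis
  proof (rule C1_onI)
    fix x assume "x \<in> W"
    with d show "((\<lambda>x. prod (f x) (g x)) has_derivative
        (\<lambda>h. prod (f x) (g' x h) + prod (f' x h) (g x))) (at x)"
      by (intro bounded_bilinear.FDERIV[OF assms(1)]) auto
  next
    fix v
    show "continuous_on W (\<lambda>x. prod (f x) (g' x v) + prod (f' x v) (g x))"
      by (intro continuous_intros c bounded_bilinear.continuous_on[OF assms(1)]
          C1_on_continuous assms)
  qed
qed

lemma C1_on_const [simp]: "C1_on (\<lambda>x. c) W"
  unfolding C1_on_def by (intro exI[of _ "\<lambda>_. 0"]) (auto simp: zero_blinfun.rep_eq)

lemma C1_on_add:
  assumes "C1_on f W" "C1_on g W"
  shows "C1_on (\<lambda>x. f x + g x) W"
proof -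
  obtain f' g' where
    "\<And>x. x \<in> W \<Longrightarrow> (f has_derivative blinfun_apply (f' x)) (at x)"
    "\<And>x. x \<in> W \<Longrightarrow> (g has_derivative blinfun_apply (g' x)) (at x)"
    "continuous_on W f'" "continuous_on W g'"
    using assms unfolding C1_on_def by blast
  then show ?thesis unfolding C1_on_def
    by (intro exI[of _ "\<lambda>x. f' x + g' x"])
      (auto intro!: derivative_eq_intros continuous_intros simp: blinfun.add_left fun_eq_iff)
qed

lemma C1_on_compose:
  assumes g: "C1_on g V" and f: "C1_on f W" and sub: "f ` W \<subseteq> V"
  shows "C1_on (\<lambda>x. g (f x)) W"
proof -
  obtain f' where f': "\<And>x. x \<in> W \<Longrightarrow> (f has_derivative blinfun_apply (f' x)) (at x)"
    "continuous_on W f'" using f unfolding C1_on_def by blast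
  obtain g' where g': "\<And>x. x \<in> V \<Longrightarrow> (g has_derivative blinfun_apply (g' x)) (at x)"
    "continuous_on V g'" using g unfolding C1_on_def by blast
  have "((\<lambda>x. g (f x)) has_derivative blinfun_apply (g' (f x) o\<^sub>L f' x)) (at x)" if "x \<in> W" for x
    using has_derivative_compose[OF f'(1)[OF that] g'(1)] that sub
    by (auto simp: blinfun_compose.rep_eq o_def)
  moreover have "continuous_on W (\<lambda>x. g' (f x) o\<^sub>L f' x)"
    by (intro continuous_intros f' continuous_on_compose2[OF g'(2) C1_on_continuous[OF f]] sub)
  ultimately show ?thesis unfolding C1_on_def
    by (intro exI[of _ "\<lambda>x. g' (f x) o\<^sub>L f' x"]) simp
qed

lemma C2_on_const [simp]: "C2_on (\<lambda>x. c) W"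
  unfolding C2_on_def by (intro exI[of _ "\<lambda>_. 0"]) (auto simp: zero_blinfun.rep_eq)

lemma C2_on_linear: "bounded_linear f \<Longrightarrow> C2_on f W"
  unfolding C2_on_def
  by (intro exI[of _ "\<lambda>_. Blinfun f"])
    (auto simp: bounded_linear_Blinfun_apply bounded_linear_imp_has_derivative)

lemma C2_on_add:
  assumes "C2_on f W" "C2_on g W"
  shows "C2_on (\<lambda>x. f x + g x) W"
proof -
  obtain f' g' where
    "\<And>x. x \<in> W \<Longrightarrow> (f has_derivative blinfun_apply (f' x)) (at x)"
    "\<And>x. x \<in> W \<Longrightarrow> (g has_derivative blinfun_apply (g' x)) (at x)"
    "C1_on f' W" "C1_on g' W"
    using assms unfolding C2_on_def by blast
  then show ?thesis unfolding C2_on_def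
    by (intro exI[of _ "\<lambda>x. f' x + g' x"])
      (auto intro!: derivative_eq_intros C1_on_add simp: blinfun.add_left fun_eq_iff)
qed

lemma C2_on_sum:
  "(\<And>i. i \<in> I \<Longrightarrow> C2_on (f i) W) \<Longrightarrow> C2_on (\<lambda>x. \<Sum>i\<in>I. f i x) W"
  by (induction I rule: infinite_finite_induct) (auto intro: C2_on_add)

lemma C1_on_blinfun_apply:
  fixes F :: "'d::euclidean_space \<Rightarrow> 'a::real_normed_vector \<Rightarrow>\<^sub>L 'b::real_normed_vector"
  shows "C1_on F W \<Longrightarrow> C1_on g W \<Longrightarrow> C1_on (\<lambda>x. blinfun_apply (F x) (g x)) W"
  by (rule C1_on_bilinear[OF bounded_bilinear_blinfun_apply])

lemma C2_on_bilinear: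
  fixes f :: "'d::euclidean_space \<Rightarrow> 'a::real_normed_vector"
    and g :: "'d \<Rightarrow> 'b::real_normed_vector"
    and prod :: "'a \<Rightarrow> 'b \<Rightarrow> 'c::real_normed_vector"
  assumes "bounded_bilinear prod" "C2_on f W" "C2_on g W" "open W"
  shows "C2_on (\<lambda>x. prod (f x) (g x)) W"
proof -
  obtain f' g' where
    d: "\<And>x. x \<in> W \<Longrightarrow> (f has_derivative blinfun_apply (f' x)) (at x)"
       "\<And>x. x \<in> W \<Longrightarrow> (g has_derivative blinfun_apply (g' x)) (at x)"
    and c: "C1_on f' W" "C1_on g' W"
    using assms unfolding C2_on_def by blast
  show ?thesis
  proof (rule C2_onI[OF _ _ \<open>open W\<close>])
    fix x assume "x \<in> W"
    with d show "((\<lambda>x. prod (f x) (g x)) has_derivative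
        (\<lambda>h. prod (f x) (g' x h) + prod (f' x h) (g x))) (at x)"
      by (intro bounded_bilinear.FDERIV[OF assms(1)]) auto
  next
    fix v
    show "C1_on (\<lambda>x. prod (f x) (g' x v) + prod (f' x v) (g x)) W"
      by (intro C1_on_add C1_on_bilinear[OF assms(1)] C1_on_blinfun_apply c C1_on_const
          C2_on_imp_C1_on assms)
  qed
qed

lemma C2_on_mult:
  fixes f g :: "'d::euclidean_space \<Rightarrow> real"
  shows "C2_on f W \<Longrightarrow> C2_on g W \<Longrightarrow> open W \<Longrightarrow> C2_on (\<lambda>x. f x * g x) W"
  by (rule C2_on_bilinear[OF bounded_bilinear_mult])

lemma C2_on_diff:
  fixes f g :: "'d::euclidean_space \<Rightarrow> real"
  assumes "C2_on f W" "C2_on g W" "open W" shows "C2_on (\<lambda>x. f x - g x) W"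
  using C2_on_add[OF assms(1) C2_on_mult[OF C2_on_const[of "-1"] assms(2,3)]] by simp

lemma C2_on_compose:
  fixes f :: "'a::euclidean_space \<Rightarrow> 'b::real_normed_vector"
    and g :: "'b \<Rightarrow> 'c::real_normed_vector"
  assumes g: "C2_on g V" and f: "C2_on f W" and sub: "f ` W \<subseteq> V" and W: "open W"
  shows "C2_on (\<lambda>x. g (f x)) W"
proof -
  obtain f' where f': "\<And>x. x \<in> W \<Longrightarrow> (f has_derivative blinfun_apply (f' x)) (at x)"
    "C1_on f' W" using f unfolding C2_on_def by blast
  obtain g' where g': "\<And>x. x \<in> V \<Longrightarrow> (g has_derivative blinfun_apply (g' x)) (at x)"
    "C1_on g' V" using g unfolding C2_on_def by blast
  show ?thesis
  proof (rule C2_onI[OF _ _ W])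
    fix x assume "x \<in> W"
    then show "((\<lambda>x. g (f x)) has_derivative (\<lambda>v. g' (f x) (f' x v))) (at x)"
      using has_derivative_compose[OF f'(1) g'(1)] sub by auto
  next
    fix v
    show "C1_on (\<lambda>x. g' (f x) (f' x v)) W"
      by (intro C1_on_blinfun_apply C1_on_compose[OF g'(2) C2_on_imp_C1_on[OF f] sub] f' C1_on_const)
  qed
qed

text \<open>The derivative in direction \<open>v\<close> is taken first. Symmetry in \<open>u\<close> and \<open>v\<close> is never needed.\<close>

definition hess :: "('a::real_normed_vector \<Rightarrow> 'b::real_normed_vector) \<Rightarrow> 'a \<Rightarrow> 'a \<Rightarrow> 'a \<Rightarrow> 'b" where
  "hess g x u v = frechet_derivative (\<lambda>y. frechet_derivative g (at y) v) (at x) u"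

lemma hess_eqI:
  assumes "open W" "x \<in> W" "\<And>y. y \<in> W \<Longrightarrow> (g has_derivative G y) (at y)"
    and "((\<lambda>y. G y v) has_derivative H) (at x)"
  shows "hess g x u v = H u"
proof -
  have "((\<lambda>y. frechet_derivative g (at y) v) has_derivative H) (at x)"
    by (rule has_derivative_transform_within_open[OF assms(4,1,2)])
      (simp add: frechet_derivative_at[OF assms(3), symmetric])
  then show ?thesis unfolding hess_def by (simp add: frechet_derivative_at[symmetric])
qed

text \<open>Both derivatives are kept as operator valued maps. The second derivative then is an
  iterated application \<open>g'' x u v\<close>, to which linearity, norm bounds and continuity
  apply directly; \<open>hess\<close> by itself offers none of these.\<close>

definition C2_derivs :: "('a::real_normed_vector \<Rightarrow> 'b::real_normed_vector) \<Rightarrow> ('a \<Rightarrow> 'a \<Rightarrow>\<^sub>L 'b)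
    \<Rightarrow> ('a \<Rightarrow> 'a \<Rightarrow>\<^sub>L 'a \<Rightarrow>\<^sub>L 'b) \<Rightarrow> 'a set \<Rightarrow> bool" where
  "C2_derivs g g' g'' W \<longleftrightarrow> open W \<and>
     (\<forall>x\<in>W. (g has_derivative blinfun_apply (g' x)) (at x)) \<and>
     (\<forall>x\<in>W. (g' has_derivative blinfun_apply (g'' x)) (at x)) \<and> continuous_on W g''"

lemma C2_on_iff_derivs: "open W \<Longrightarrow> C2_on g W \<longleftrightarrow> (\<exists>g' g''. C2_derivs g g' g'' W)"
  unfolding C2_on_def C1_on_def C2_derivs_def by blast

lemma C2_derivsD:
  assumes "C2_derivs g g' g'' W"
  shows "x \<in> W \<Longrightarrow> (g has_derivative blinfun_apply (g' x)) (at x)"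
    and "x \<in> W \<Longrightarrow> (g' has_derivative blinfun_apply (g'' x)) (at x)"
    and "continuous_on W g'" and "continuous_on W g''"
    and "x \<in> W \<Longrightarrow> frechet_derivative g (at x) = g' x"
    and "x \<in> W \<Longrightarrow> hess g x u v = g'' x u v"
proof -
  show d: "(g has_derivative blinfun_apply (g' x)) (at x)" if "x \<in> W" for x
    using assms that unfolding C2_derivs_def by blast
  show d2: "(g' has_derivative blinfun_apply (g'' x)) (at x)" if "x \<in> W" for x
    using assms that unfolding C2_derivs_def by blast
  then show "continuous_on W g'"
    by (meson continuous_at_imp_continuous_on has_derivative_continuous)
  show "continuous_on W g''" using assms unfolding C2_derivs_def by blast
  show "frechet_derivative g (at x) = g' x" if "x \<in> W"
    using frechet_derivative_at[OF d[OF that]] by simp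
  show "hess g x u v = g'' x u v" if "x \<in> W"
  proof (rule hess_eqI[OF _ that d])
    show "open W" using assms unfolding C2_derivs_def by blast
    show "((\<lambda>y. g' y v) has_derivative (\<lambda>u. g'' x u v)) (at x)"
      by (auto intro!: derivative_eq_intros d2 that)
  qed
qed

lemma C2_derivs_apply:
  assumes "C2_derivs g g' g'' W" "x \<in> W"
  shows "((\<lambda>y. g' y v) has_derivative (\<lambda>u. g'' x u v)) (at x)"
  by (auto intro!: derivative_eq_intros C2_derivsD(2)[OF assms])

lemma hess_cong:
  assumes "open W" "x \<in> W" "C2_on f W" "\<And>y. y \<in> W \<Longrightarrow> f y = g y"
  shows "hess g x u v = hess f x u v"
proof -
  obtain f' f'' where f: "C2_derivs f f' f'' W"
    using assms C2_on_iff_derivs by blast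
  have "C2_derivs g f' f'' W"
    using f has_derivative_cong_open[OF assms(1), of f g "\<lambda>x. blinfun_apply (f' x)"] assms(4)
    unfolding C2_derivs_def by blast
  then show ?thesis using C2_derivsD(6)[OF f] C2_derivsD(6)[of g f' f'' W] assms(2) by simp
qed

lemma hess_add:
  assumes "C2_on f W" "C2_on g W" "open W" "x \<in> W"
  shows "hess (\<lambda>x. f x + g x) x u v = hess f x u v + hess g x u v"
proof -
  obtain f' f'' where f_derivs: "C2_derivs f f' f'' W"
    using assms C2_on_iff_derivs by blast
  note f = C2_derivsD[OF f_derivs]
  obtain g' g'' where g_derivs: "C2_derivs g g' g'' W"
    using assms C2_on_iff_derivs by blast
  note g = C2_derivsD[OF g_derivs]
  have "hess (\<lambda>x. f x + g x) x u v = f'' x u v + g'' x u v"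
    by (rule hess_eqI[OF assms(3,4) has_derivative_add[OF f(1) g(1)]
          has_derivative_add[OF C2_derivs_apply[OF f_derivs assms(4)] C2_derivs_apply[OF g_derivs assms(4)]]])
  then show ?thesis using f(6) g(6) assms(4) by simp
qed

lemma hess_const: "hess (\<lambda>x. c) x u v = 0"
  by (rule hess_eqI[of UNIV _ _ "\<lambda>_ _. 0"]) auto

lemma hess_sum:
  assumes "open W" "x \<in> W" "\<And>i. i \<in> I \<Longrightarrow> C2_on (f i) W"
  shows "hess (\<lambda>x. \<Sum>i\<in>I. f i x) x u v = (\<Sum>i\<in>I. hess (f i) x u v)"
  using assms(3)
proof (induction I rule: infinite_finite_induct)
  case (insert i I)
  then show ?case
    by (simp add: hess_add[OF _ C2_on_sum assms(1,2)])
qed (auto simp: hess_const)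

lemma hess_mult:
  fixes f g :: "'a::real_normed_vector \<Rightarrow> real"
  assumes "C2_on f W" "C2_on g W" "open W" "x \<in> W"
  shows "hess (\<lambda>x. f x * g x) x v v = f x * hess g x v v
    + 2 * frechet_derivative f (at x) v * frechet_derivative g (at x) v + hess f x v v * g x"
proof -
  obtain f' f'' where f_derivs: "C2_derivs f f' f'' W"
    using assms C2_on_iff_derivs by blast
  note f = C2_derivsD[OF f_derivs]
  obtain g' g'' where g_derivs: "C2_derivs g g' g'' W"
    using assms C2_on_iff_derivs by blast
  note g = C2_derivsD[OF g_derivs]
  have "hess (\<lambda>x. f x * g x) x v v =
    (f x * g'' x v v + f' x v * g' x v) + (f' x v * g' x v + f'' x v v * g x)"
    by (rule hess_eqI[OF assms(3,4) has_derivative_mult[OF f(1) g(1)] has_derivative_add[OF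
          has_derivative_mult[OF f(1)[OF assms(4)] C2_derivs_apply[OF g_derivs assms(4)]]
          has_derivative_mult[OF C2_derivs_apply[OF f_derivs assms(4)] g(1)[OF assms(4)]]]])
  then show ?thesis using f(5,6) g(5,6) assms(4) by simp
qed

lemma hess_cmult:
  fixes g :: "'a::real_normed_vector \<Rightarrow> real"
  assumes "C2_on g W" "open W" "x \<in> W"
  shows "hess (\<lambda>x. c * g x) x v v = c * hess g x v v"
  using hess_mult[OF C2_on_const assms, of c] by (simp add: hess_const)

lemma hess_compose_real:
  fixes g :: "'a::real_normed_vector \<Rightarrow> real" and h h' :: "real \<Rightarrow> real"
  assumes "C2_on g W" "open W" "x \<in> W"
    and h: "\<And>s. (h has_real_derivative h' s) (at s)" "(h' has_real_derivative h'') (at (g x))"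
  shows "hess (\<lambda>x. h (g x)) x v v =
    h' (g x) * hess g x v v + h'' * (frechet_derivative g (at x) v)\<^sup>2"
proof -
  obtain g' g'' where g_derivs: "C2_derivs g g' g'' W"
    using assms C2_on_iff_derivs by blast
  note g = C2_derivsD[OF g_derivs]
  have 1: "((\<lambda>x. h (g x)) has_derivative (\<lambda>v. h' (g x) * g' x v)) (at x)" if "x \<in> W" for x
    using has_derivative_compose[OF g(1)[OF that], of h] h(1)
    by (auto simp: has_field_derivative_def)
  have 2: "((\<lambda>x. h' (g x)) has_derivative (\<lambda>v. h'' * g' x v)) (at x)"
    using has_derivative_compose[OF g(1)[OF assms(3)], of h'] h(2)
    by (auto simp: has_field_derivative_def)
  have "hess (\<lambda>x. h (g x)) x v v = h' (g x) * g'' x v v + (h'' * g' x v) * g' x v"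
    by (rule hess_eqI[OF assms(2,3) 1 has_derivative_mult[OF 2 C2_derivs_apply[OF g_derivs assms(3)]]])
  then show ?thesis using g(5,6) assms(3) by (simp add: power2_eq_square)
qed

lemma C2_on_real:
  assumes "\<And>s::real. (h has_real_derivative h' s) (at s)" "\<And>s. (h' has_real_derivative h'' s) (at s)"
    "continuous_on UNIV h''"
  shows "C2_on h W"
proof (rule C2_on_subset)
  show "C2_on h UNIV"
  proof (rule C2_onI)
    fix v
    show "C1_on (\<lambda>x. h' x * v) UNIV"
    proof (rule C1_onI)
      show "((\<lambda>x. h' x * v) has_derivative (\<lambda>u. h'' x * u * v)) (at x)" for x
        using assms(2)[of x] unfolding has_field_derivative_def by (auto intro!: derivative_eq_intros)
      show "continuous_on UNIV (\<lambda>x. h'' x * u * v)" for u by (intro continuous_intros assms)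
    qed
  qed (use assms in \<open>auto simp: has_field_derivative_def\<close>)
qed auto

text \<open>The exponent 3 makes this convex increasing function of class C2.\<close>

definition cubeplus :: "real \<Rightarrow> real" where "cubeplus s = (max 0 s) ^ 3"

lemma has_derivative_pos_part_power:
  assumes "n > 0"
  shows "((\<lambda>s. (max 0 s) ^ Suc n) has_real_derivative (real (Suc n) * (max 0 s) ^ n)) (at s)"
proof -
  consider "s < 0" | "s > 0" | "s = 0" by linarith
  then show ?thesis
  proof cases
    case 1
    have "((\<lambda>s. 0) has_real_derivative (real (Suc n) * (max 0 s) ^ n)) (at s)"
      using 1 assms by (auto intro!: derivative_eq_intros simp: max_def)
    then show ?thesis
      by (rule has_field_derivative_transform_within_open[of _ _ _ "{..<0}"]) (use 1 in auto)
  next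
    case 2
    have "((\<lambda>s. s ^ Suc n) has_real_derivative (real (Suc n) * (max 0 s) ^ n)) (at s)"
      using 2 DERIV_pow[of "Suc n" s] by (simp add: max_def)
    then show ?thesis
      by (rule has_field_derivative_transform_within_open[of _ _ _ "{0<..}"]) (use 2 in auto)
  next
    case 3
    \<comment> \<open>At the kink the difference quotient is at most \<open>|h| ^ n\<close> in
      absolute value, which tends to 0 because \<open>n > 0\<close>.\<close>
    have "(\<lambda>h::real. \<bar>h\<bar> ^ n) \<midarrow>0\<rightarrow> 0"
      using assms by (auto intro!: tendsto_eq_intros)
    then have "(\<lambda>h::real. (max 0 h) ^ Suc n / h) \<midarrow>0\<rightarrow> 0"
      by (rule Lim_null_comparison[rotated])
        (auto simp: max_def eventually_at_filter power_abs intro!: always_eventually)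
    then show ?thesis using 3 assms by (simp add: DERIV_def zero_power)
  qed
qed

lemma cubeplus_deriv: "(cubeplus has_real_derivative 3 * (max 0 s)\<^sup>2) (at s)"
  using has_derivative_pos_part_power[of 2 s] by (simp add: cubeplus_def[abs_def] numeral_3_eq_3)

lemma cubeplus_deriv2: "((\<lambda>s. 3 * (max 0 s)\<^sup>2) has_real_derivative 6 * max 0 s) (at s)"
  using DERIV_cmult[OF has_derivative_pos_part_power[of 1 s], of 3] by (simp add: numeral_2_eq_2)

lemma C2_on_cubeplus [simp]: "C2_on cubeplus W"
  by (rule C2_on_real[OF cubeplus_deriv cubeplus_deriv2]) (intro continuous_intros)

text \<open>The last term is nonnegative, and both coefficients vanish where
  \<open>g x \<le> 0\<close>. Composition therefore keeps a nonnegative Levi form nonnegative and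
  erases everything that happens where \<open>g\<close> is negative.\<close>

lemma hess_cubeplus:
  fixes g :: "'a::real_normed_vector \<Rightarrow> real"
  assumes "C2_on g W" "open W" "x \<in> W"
  shows "hess (\<lambda>x. cubeplus (g x)) x v v =
    3 * (max 0 (g x))\<^sup>2 * hess g x v v + 6 * max 0 (g x) * (frechet_derivative g (at x) v)\<^sup>2"
  by (rule hess_compose_real[OF assms cubeplus_deriv cubeplus_deriv2])

lemma C2_on_cubeplus_comp:
  fixes g :: "'a::euclidean_space \<Rightarrow> real"
  shows "C2_on g W \<Longrightarrow> open W \<Longrightarrow> C2_on (\<lambda>x. cubeplus (g x)) W"
  using C2_on_compose[OF C2_on_cubeplus[of UNIV]] by auto

section \<open>The Levi form and holomorphic maps\<close>

lemma complex_vec_decomp: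
  fixes v :: "complex ^ 'n::finite"
  shows "v = (\<Sum>j\<in>UNIV. Re (v $ j) *\<^sub>R axis j 1 + Im (v $ j) *\<^sub>R axis j \<i>)"
proof (rule vec_eq_iff[THEN iffD2], rule allI)
  fix i
  have "(\<Sum>j\<in>UNIV. Re (v $ j) *\<^sub>R axis j 1 + Im (v $ j) *\<^sub>R axis j \<i>) $ i
    = (\<Sum>j\<in>UNIV. if j = i then v $ i else 0)"
    unfolding sum_component by (rule sum.cong) (auto simp: axis_def complex_eq_iff)
  then show "v $ i = (\<Sum>j\<in>UNIV. Re (v $ j) *\<^sub>R axis j 1 + Im (v $ j) *\<^sub>R axis j \<i>) $ i" by simp
qed

lemma bilinear_complex_vec:
  fixes B :: "complex ^ 'n::finite \<Rightarrow> complex ^ 'n \<Rightarrow> real"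
  assumes "bounded_bilinear B"
  shows "B v w = (\<Sum>j\<in>UNIV. \<Sum>k\<in>UNIV.
      Re (v $ j) * Re (w $ k) * B (axis j 1) (axis k 1) + Re (v $ j) * Im (w $ k) * B (axis j 1) (axis k \<i>)
    + Im (v $ j) * Re (w $ k) * B (axis j \<i>) (axis k 1) + Im (v $ j) * Im (w $ k) * B (axis j \<i>) (axis k \<i>))"
proof -
  interpret bounded_bilinear B by fact
  have "B v w = B (\<Sum>j\<in>UNIV. Re (v $ j) *\<^sub>R axis j 1 + Im (v $ j) *\<^sub>R axis j \<i>)
      (\<Sum>j\<in>UNIV. Re (w $ j) *\<^sub>R axis j 1 + Im (w $ j) *\<^sub>R axis j \<i>)"
    using complex_vec_decomp[of v] complex_vec_decomp[of w] by simp
  also have "\<dots> = (\<Sum>j\<in>UNIV. \<Sum>k\<in>UNIV. B (Re (v $ j) *\<^sub>R axis j 1 + Im (v $ j) *\<^sub>R axis j \<i>)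
      (Re (w $ k) *\<^sub>R axis k 1 + Im (w $ k) *\<^sub>R axis k \<i>))"
    by (subst sum_left, subst sum_right) simp
  also have "\<dots> = (\<Sum>j\<in>UNIV. \<Sum>k\<in>UNIV.
      Re (v $ j) * Re (w $ k) * B (axis j 1) (axis k 1) + Re (v $ j) * Im (w $ k) * B (axis j 1) (axis k \<i>)
    + Im (v $ j) * Re (w $ k) * B (axis j \<i>) (axis k 1) + Im (v $ j) * Im (w $ k) * B (axis j \<i>) (axis k \<i>))"
    by (intro sum.cong refl) (simp only: add_left add_right scaleR_left scaleR_right real_scaleR_def, simp add: algebra_simps)
  finally show ?thesis .
qed

text \<open>Averaging the real Hessian over the directions \<open>v\<close> and
  \<open>\<i> *s v\<close> retains exactly its part invariant under the complex structure, and this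
  is what the mixed Wirtinger derivatives measure. All later estimates are carried out on real
  Hessians.\<close>

lemma levi_form_eq_hess:
  fixes g :: "complex ^ 'n::finite \<Rightarrow> real"
  assumes g: "C2_on g W" and W: "open W" "z \<in> W"
  shows "levi_form g z v = (hess g z v v + hess g z (\<i> *s v) (\<i> *s v)) / 4"
proof -
  obtain g' g'' where D: "C2_derivs g g' g'' W"
    using g W C2_on_iff_derivs by blast
  note g' = C2_derivsD[OF D]
  define B where "B u w = g'' z u w" for u w
  have bB: "bounded_bilinear B"
    unfolding B_def
    by (intro bounded_bilinear.comp1[OF bounded_bilinear_blinfun_apply]) (rule blinfun.bounded_linear_right)
  have fd: "frechet_derivative (\<lambda>w. complex_of_real (g w)) (at w) = (\<lambda>v. of_real (g' w v))" if "w \<in> W" for w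
    by (rule frechet_derivative_at[symmetric]) (intro derivative_intros g'(1) that)
  have zb: "d_zbar k (\<lambda>w. complex_of_real (g w)) w =
      (of_real (g' w (axis k 1)) + \<i> * of_real (g' w (axis k \<i>))) / 2" if "w \<in> W" for w k
    unfolding d_zbar_def fd[OF that] ..
  have d: "((\<lambda>w. (of_real (g' w (axis k 1)) + \<i> * of_real (g' w (axis k \<i>))) / 2)
      has_derivative (\<lambda>u. (of_real (B u (axis k 1)) + \<i> * of_real (B u (axis k \<i>))) / 2 :: complex)) (at z)" for k
    unfolding B_def
    by (intro bounded_linear.has_derivative[OF bounded_linear_divide] has_derivative_add
        has_derivative_mult_right has_derivative_of_real C2_derivs_apply[OF D W(2)])
  have dz: "frechet_derivative (d_zbar k (\<lambda>w. complex_of_real (g w))) (at z) =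
      (\<lambda>u. (of_real (B u (axis k 1)) + \<i> * of_real (B u (axis k \<i>))) / 2)" for k
  proof (rule frechet_derivative_at[symmetric])
    show "(d_zbar k (\<lambda>w. complex_of_real (g w)) has_derivative
        (\<lambda>u. (of_real (B u (axis k 1)) + \<i> * of_real (B u (axis k \<i>))) / 2)) (at z)"
      by (rule has_derivative_transform_within_open[OF d W]) (simp add: zb)
  qed
  have "levi_form g z v = (\<Sum>j\<in>UNIV. \<Sum>k\<in>UNIV.
     Re (((of_real (B (axis j 1) (axis k 1)) + \<i> * of_real (B (axis j 1) (axis k \<i>))) / 2
       - \<i> * ((of_real (B (axis j \<i>) (axis k 1)) + \<i> * of_real (B (axis j \<i>) (axis k \<i>))) / 2)) / 2
       * v $ j * cnj (v $ k)))"
    unfolding levi_form_def d_z_def dz by (simp only: Re_sum)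
  also have "\<dots> = (B v v + B (\<i> *s v) (\<i> *s v)) / 4"
    unfolding bilinear_complex_vec[OF bB, of v v] bilinear_complex_vec[OF bB, of "\<i> *s v" "\<i> *s v"]
      sum.distrib[symmetric] sum_divide_distrib
    by (intro sum.cong refl) (simp add: field_simps)
  finally show ?thesis using g'(6)[OF W(2)] by (simp add: B_def)
qed

lemma i_smult_twice: "\<i> *s (\<i> *s v) = - (v :: complex ^ 'n)"
  by (simp add: vec_eq_iff)

lemma norm_i_smult: "norm (\<i> *s v) = norm (v :: complex ^ 'n::finite)"
  by (simp add: norm_vec_def norm_mult)

lemma bounded_linear_smult: "bounded_linear (\<lambda>v :: complex ^ 'n::finite. c *s v)"
proof (rule bounded_linear_intro[where K="cmod c"])
  show "norm (c *s x) \<le> norm x * cmod c" for x :: "complex ^ 'n"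
    by (simp add: norm_vec_def norm_mult L2_set_right_distrib[symmetric] mult.commute)
qed (simp_all add: vec_eq_iff algebra_simps)

section \<open>Cauchy's formula and the regularity of holomorphic maps\<close>

lemma C2_on_vec:
  fixes F :: "'a::euclidean_space \<Rightarrow> complex ^ 'm::finite"
  assumes "\<And>i. C2_on (\<lambda>x. F x $ i) W" "open W"
  shows "C2_on F W"
proof -
  have bl: "bounded_linear (\<lambda>c::complex. axis i c :: complex ^ 'm)" for i
  proof (rule bounded_linear_intro[where K=1])
    fix c :: complex
    have "(\<Sum>j\<in>UNIV. (norm ((axis i c :: complex ^ 'm) $ j))\<^sup>2) = (\<Sum>j\<in>UNIV. if j = i then (norm c)\<^sup>2 else 0)"
      by (rule sum.cong) (auto simp: axis_def)
    then show "norm (axis i c :: complex ^ 'm) \<le> norm c * 1"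
      by (simp add: norm_vec_def L2_set_def)
  qed (auto simp: vec_eq_iff axis_def)
  have "C2_on (\<lambda>x. \<Sum>i\<in>UNIV. axis i (F x $ i)) W"
    by (intro C2_on_sum C2_on_compose[OF C2_on_linear[OF bl, where W=UNIV] assms(1)]) (use assms in auto)
  moreover have "(\<Sum>i\<in>UNIV. axis i (F x $ i)) = F x" for x
    by (simp add: vec_eq_iff axis_def)
  ultimately show ?thesis by simp
qed

text \<open>No continuity of the derivative is assumed.\<close>

definition cdiff_on :: "(complex ^ 'n::finite \<Rightarrow> complex) \<Rightarrow> (complex ^ 'n \<Rightarrow> complex ^ 'n \<Rightarrow> complex)
    \<Rightarrow> (complex ^ 'n) set \<Rightarrow> bool" where
  "cdiff_on f f' W \<longleftrightarrow> open W \<and>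
     (\<forall>z\<in>W. (f has_derivative f' z) (at z) \<and> (\<forall>c v. f' z (c *s v) = c * f' z v))"

lemma cdiff_onD:
  assumes "cdiff_on f f' W"
  shows "open W" "z \<in> W \<Longrightarrow> (f has_derivative f' z) (at z)" "z \<in> W \<Longrightarrow> f' z (c *s v) = c * f' z v"
  using assms unfolding cdiff_on_def by auto

text \<open>On the complex line through \<open>z\<close> in direction \<open>v\<close> the function
  becomes a holomorphic function \<open>h\<close> of one variable with derivative
  \<open>f' z v\<close> at 0. Expressing this derivative through values of \<open>f\<close> alone
  lets \<open>f'\<close> inherit the regularity of \<open>f\<close>.\<close>

lemma cdiff_Cauchy:
  fixes v :: "complex ^ 'n::finite"
  assumes f: "cdiff_on f f' W" and r: "0 < r" and W: "\<And>c. norm c \<le> r \<Longrightarrow> z + c *s v \<in> W"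
  shows "f' z v = integral (cbox 0 1) (\<lambda>t. inverse (of_real r * exp (2 * of_real pi * \<i> * of_real t))
     * f (z + (of_real r * exp (2 * of_real pi * \<i> * of_real t)) *s v))"
proof -
  define h where "h c = f (z + c *s v)" for c
  define e where "e t = of_real r * exp (2 * of_real pi * \<i> * of_real t)" for t :: real
  have e0: "e t \<noteq> 0" for t unfolding e_def using r by simp
  have bl: "bounded_linear (\<lambda>c::complex. c *s v)"
    by (rule bounded_linear_intro[where K="norm v"])
      (simp_all add: vec_eq_iff algebra_simps norm_vec_def norm_mult L2_set_right_distrib[symmetric])
  have hd: "(h has_field_derivative f' (z + c *s v) v) (at c)" if "norm c \<le> r" for c
  proof -
    have "((\<lambda>c. z + c *s v) has_derivative (\<lambda>c. c *s v)) (at c)"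
      by (intro has_derivative_eq_rhs[OF has_derivative_add[OF has_derivative_const
            bounded_linear_imp_has_derivative[OF bl]]]) simp
    from has_derivative_compose[OF this cdiff_onD(2)[OF f W[OF that]]]
    show ?thesis unfolding has_field_derivative_def h_def
      by (rule has_derivative_eq_rhs) (simp add: cdiff_onD(3)[OF f W[OF that]] fun_eq_iff)
  qed
  have "continuous_on (cball 0 r) h"
    by (rule continuous_at_imp_continuous_on) (use DERIV_isCont[OF hd] in auto)
  moreover have "h holomorphic_on ball 0 r"
    unfolding holomorphic_on_def field_differentiable_def
    using hd by (metis has_field_derivative_at_within less_imp_le mem_ball_0)
  ultimately have "contour_integral (circlepath 0 r) (\<lambda>u. h u / (u - 0)^2) = (2 * pi * \<i>) * deriv h 0"
    by (rule Cauchy_contour_integral_circlepath_2) (use r in simp)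
  moreover have "deriv h 0 = f' z v"
    using DERIV_imp_deriv[OF hd[of 0]] r by simp
  \<comment> \<open>The velocity of the circle contributes a factor \<open>e t\<close>, which
    cancels one of the two in the denominator.\<close>
  moreover have "contour_integral (circlepath 0 r) (\<lambda>u. h u / (u - 0)^2) =
      integral {0..1} (\<lambda>t. (2 * pi * \<i>) * (inverse (e t) * h (e t)))"
    unfolding contour_integral_integral
  proof (rule integral_cong)
    fix t :: real assume "t \<in> {0..1}"
    have "circlepath 0 r t = e t" by (simp add: circlepath e_def)
    moreover have "vector_derivative (circlepath 0 r) (at t) = 2 * pi * \<i> * e t"
      by (simp add: vector_derivative_circlepath e_def)
    ultimately show "h (circlepath 0 r t) / (circlepath 0 r t - 0)\<^sup>2 * vector_derivative (circlepath 0 r) (at t)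
        = 2 * pi * \<i> * (inverse (e t) * h (e t))"
      using e0[of t] by (simp add: power2_eq_square field_simps)
  qed
  ultimately have "(2 * pi * \<i>) * f' z v = (2 * pi * \<i>) * integral {0..1} (\<lambda>t. inverse (e t) * h (e t))"
    by (simp add: integral_mult_right)
  then show ?thesis by (simp add: e_def h_def)
qed

lemma cdiff_continuous:
  fixes f :: "complex ^ 'n::finite \<Rightarrow> complex"
  assumes f: "cdiff_on f f' W"
  shows "continuous_on W f"
  using cdiff_onD(2)[OF f] by (meson continuous_at_imp_continuous_on has_derivative_continuous)

text \<open>One and the same circle \<open>e\<close> serves for all \<open>z\<close> in a ball, so
  that the formula can be differentiated in \<open>z\<close>.\<close>

lemma cdiff_local_Cauchy:
  fixes f :: "complex ^ 'n::finite \<Rightarrow> complex"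
  assumes f: "cdiff_on f f' W" and z0: "z0 \<in> W"
  obtains \<epsilon> e where "0 < \<epsilon>" "continuous_on UNIV e" "\<forall>t. e t \<noteq> 0"
    "\<forall>z\<in>ball z0 \<epsilon>. \<forall>t. z + e t *s v \<in> W" "ball z0 \<epsilon> \<subseteq> W"
    "\<forall>z\<in>ball z0 \<epsilon>. f' z v = integral (cbox 0 (1::real)) (\<lambda>t. inverse (e t) * f (z + e t *s v))"
proof -
  obtain \<epsilon> where \<epsilon>: "0 < \<epsilon>" "ball z0 (2 * \<epsilon>) \<subseteq> W"
    using cdiff_onD(1)[OF f] z0
    by (metis field_sum_of_halves half_gt_zero mult_2 open_contains_ball)
  \<comment> \<open>The added 1 keeps the denominator positive when \<open>v = 0\<close>. Circles of
    this radius around points of the ball of radius \<open>\<epsilon>\<close> stay in the ball of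
    radius \<open>2 * \<epsilon>\<close>.\<close>
  define r where "r = \<epsilon> / (norm v + 1)"
  have r: "0 < r" unfolding r_def using \<epsilon> by (simp add: add_nonneg_pos)
  define e where "e t = of_real r * exp (2 * of_real pi * \<i> * of_real t)" for t :: real
  have W: "z + c *s v \<in> W" if "z \<in> ball z0 \<epsilon>" "norm c \<le> r" for z c
  proof -
    have "norm (c *s v) = norm c * norm v"
      by (simp add: norm_vec_def norm_mult L2_set_right_distrib[symmetric])
    also have "\<dots> \<le> r * norm v" using that by (simp add: mult_right_mono)
    also have "\<dots> \<le> r * (norm v + 1)" using r by (simp add: distrib_left)
    also have "\<dots> = \<epsilon>" unfolding r_def by (simp add: add_nonneg_eq_0_iff)
    finally have "norm (c *s v) \<le> \<epsilon>" .
    then have "dist z0 (z + c *s v) < 2 * \<epsilon>"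
      using that(1) norm_triangle_ineq4[of "z0 - z" "c *s v"] by (simp add: dist_norm diff_diff_eq)
    then show ?thesis using \<epsilon> by auto
  qed
  show thesis
  proof (rule that[of \<epsilon> e])
    show "continuous_on UNIV e" unfolding e_def by (intro continuous_intros)
    show "\<forall>z\<in>ball z0 \<epsilon>. \<forall>t. z + e t *s v \<in> W"
      using r by (auto intro!: W simp: e_def norm_mult)
    show "\<forall>z\<in>ball z0 \<epsilon>. f' z v = integral (cbox 0 (1::real)) (\<lambda>t. inverse (e t) * f (z + e t *s v))"
      unfolding e_def using W by (blast intro: cdiff_Cauchy[OF f r])
    show "ball z0 \<epsilon> \<subseteq> W" using \<epsilon> by auto
  qed (use \<epsilon> r e_def in auto)
qed

lemma continuous_on_smult:
  fixes v :: "complex ^ 'n::finite"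
  shows "continuous_on S g \<Longrightarrow> continuous_on S (\<lambda>x. g x *s v)"
  by (simp add: vector_scalar_mult_def continuous_intros)

text \<open>The integrand in Cauchy's formula is jointly continuous in \<open>z\<close> and
  \<open>t\<close> because \<open>f\<close> is continuous, hence so is the integral in
  \<open>z\<close>.\<close>

lemma cdiff_deriv_continuous:
  fixes f :: "complex ^ 'n::finite \<Rightarrow> complex"
  assumes f: "cdiff_on f f' W"
  shows "continuous_on W (\<lambda>z. f' z v)"
proof (rule continuous_at_imp_continuous_on, rule ballI)
  fix z0 assume z0: "z0 \<in> W"
  obtain \<epsilon> e where e: "0 < \<epsilon>" "continuous_on UNIV e" "\<forall>t. e t \<noteq> 0"
    "\<forall>z\<in>ball z0 \<epsilon>. \<forall>t. z + e t *s v \<in> W" "ball z0 \<epsilon> \<subseteq> W"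
    "\<forall>z\<in>ball z0 \<epsilon>. f' z v = integral (cbox 0 (1::real)) (\<lambda>t. inverse (e t) * f (z + e t *s v))"
    using cdiff_local_Cauchy[OF f z0] by blast
  have ce: "continuous_on S (\<lambda>x. e (snd x))" for S :: "((complex ^ 'n) \<times> real) set"
    by (rule continuous_on_compose2[OF e(2)]) (auto intro: continuous_intros)
  have "continuous_on (ball z0 \<epsilon>) (\<lambda>z. integral (cbox 0 (1::real)) (\<lambda>t. inverse (e t) * f (z + e t *s v)))"
  proof (rule integral_continuous_on_param)
    show "continuous_on (ball z0 \<epsilon> \<times> cbox 0 (1::real)) (\<lambda>(z, t). inverse (e t) * f (z + e t *s v))"
      unfolding split_beta
      by (intro continuous_intros continuous_on_compose2[OF cdiff_continuous[OF f]] ce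
          continuous_on_smult) (use e in auto)
  qed
  then have "continuous_on (ball z0 \<epsilon>) (\<lambda>z. f' z v)"
    by (rule continuous_on_eq) (use e(6) in simp)
  then show "isCont (\<lambda>z. f' z v) z0"
    using e(1) by (simp add: continuous_on_eq_continuous_at)
qed

text \<open>Differentiate the Cauchy formula for the derivative in direction \<open>v\<close> under the integral sign.\<close>

lemma cdiff_deriv_cdiff:
  fixes f :: "complex ^ 'n::finite \<Rightarrow> complex"
  assumes f: "cdiff_on f f' W"
  obtains f'' where "cdiff_on (\<lambda>z. f' z v) f'' W"
proof -
  \<comment> \<open>The Leibniz rule requires a continuous derivative under the integral sign; this
    is where continuity of \<open>f'\<close> enters.\<close>
  have "C1_on f W"
    by (rule C1_onI[OF cdiff_onD(2)[OF f] cdiff_deriv_continuous[OF f]])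
  then obtain F where F: "\<forall>z\<in>W. (f has_derivative blinfun_apply (F z)) (at z)" "continuous_on W F"
    unfolding C1_on_def by blast
  have F': "blinfun_apply (F z) = f' z" if "z \<in> W" for z
    using has_derivative_unique[OF F(1)[rule_format, OF that] cdiff_onD(2)[OF f that]] .
  have "\<exists>D. ((\<lambda>z. f' z v) has_derivative D) (at z0) \<and> (\<forall>c w. D (c *s w) = c * D w)" if z0: "z0 \<in> W" for z0
  proof -
    obtain \<epsilon> e where e: "0 < \<epsilon>" "continuous_on UNIV e" "\<forall>t. e t \<noteq> 0"
      "\<forall>z\<in>ball z0 \<epsilon>. \<forall>t. z + e t *s v \<in> W" "ball z0 \<epsilon> \<subseteq> W"
      "\<forall>z\<in>ball z0 \<epsilon>. f' z v = integral (cbox 0 (1::real)) (\<lambda>t. inverse (e t) * f (z + e t *s v))"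
      using cdiff_local_Cauchy[OF f z0] by blast
    have ce: "continuous_on S (\<lambda>x. e (snd x))" for S :: "((complex ^ 'n) \<times> real) set"
      by (rule continuous_on_compose2[OF e(2)]) (auto intro: continuous_intros)
    have ce1: "continuous_on S e" for S using continuous_on_subset[OF e(2)] by blast
    define fx where "fx z t = blinfun_mult_right (inverse (e t)) o\<^sub>L F (z + e t *s v)" for z t
    have cfx: "continuous_on (ball z0 \<epsilon> \<times> cbox 0 (1::real)) (\<lambda>(z, t). fx z t)"
      unfolding split_beta fx_def
      by (intro continuous_intros continuous_on_compose2[OF F(2)] ce continuous_on_smult
          bounded_linear.continuous_on[OF bounded_linear_blinfun_mult_right]) (use e in auto)
    have "((\<lambda>z. integral (cbox 0 (1::real)) (\<lambda>t. inverse (e t) * f (z + e t *s v)))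
       has_derivative integral (cbox 0 1) (fx z0)) (at z0 within ball z0 \<epsilon>)"
    proof (rule leibniz_rule)
      fix z t assume z: "z \<in> ball z0 \<epsilon>" and "t \<in> cbox 0 (1::real)"
      have *: "((\<lambda>z. z + e t *s v) has_derivative (\<lambda>h. h)) (at z within ball z0 \<epsilon>)"
        by (auto intro!: derivative_eq_intros)
      have "((\<lambda>z. f (z + e t *s v)) has_derivative F (z + e t *s v)) (at z within ball z0 \<epsilon>)"
        by (rule has_derivative_compose[OF *]) (use F(1) e(4) z in auto)
      then show "((\<lambda>z. inverse (e t) * f (z + e t *s v)) has_derivative fx z t) (at z within ball z0 \<epsilon>)"
        unfolding fx_def by (auto intro!: derivative_eq_intros simp: blinfun_compose.rep_eq blinfun_mult_right.rep_eq)
    next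
      fix z assume "z \<in> ball z0 \<epsilon>"
      then show "(\<lambda>t. inverse (e t) * f (z + e t *s v)) integrable_on cbox 0 1"
        by (intro integrable_continuous continuous_intros continuous_on_compose2[OF cdiff_continuous[OF f]]
          ce1 continuous_on_smult) (use e in auto)
    qed (use cfx e in auto)
    then have "((\<lambda>z. integral (cbox 0 (1::real)) (\<lambda>t. inverse (e t) * f (z + e t *s v)))
       has_derivative integral (cbox 0 1) (fx z0)) (at z0)"
      using e(1) by (simp add: at_within_open[of z0 "ball z0 \<epsilon>"])
    then have d: "((\<lambda>z. f' z v) has_derivative integral (cbox 0 1) (fx z0)) (at z0)"
      by (rule has_derivative_transform_within_open[OF _ open_ball[of z0 \<epsilon>]]) (use e in auto)
    have int: "fx z0 integrable_on cbox 0 1"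
      by (rule integrable_continuous) (rule continuous_on_compose2[OF cfx, of _ "\<lambda>t. (z0, t)", simplified], use e(1) in \<open>auto intro!: continuous_intros\<close>)
    \<comment> \<open>Complex homogeneity survives integration, so the derivative in direction
      \<open>v\<close> is again complex differentiable.\<close>
    have "integral (cbox 0 1) (fx z0) (c *s w) = c * integral (cbox 0 1) (fx z0) w" for c w
    proof -
      have "fx z0 t (c *s w) = c * fx z0 t w" for t
        unfolding fx_def using e(1,4)
        by (simp add: blinfun_compose.rep_eq blinfun_mult_right.rep_eq F' cdiff_onD(3)[OF f])
      then show ?thesis unfolding blinfun_apply_integral[OF int] by (simp add: integral_mult_right)
    qed
    with d show ?thesis by blast
  qed
  then have "\<forall>z0\<in>W. \<exists>D. ((\<lambda>z. f' z v) has_derivative D) (at z0) \<and> (\<forall>c w. D (c *s w) = c * D w)"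
    by blast
  from bchoice[OF this] show thesis
    using that cdiff_onD(1)[OF f] unfolding cdiff_on_def by blast
qed

lemma cdiff_C2:
  fixes f :: "complex ^ 'n::finite \<Rightarrow> complex"
  assumes f: "cdiff_on f f' W"
  shows "C2_on f W"
proof (rule C2_onI[OF cdiff_onD(2)[OF f] _ cdiff_onD(1)[OF f]])
  fix v
  obtain f'' where "cdiff_on (\<lambda>z. f' z v) f'' W" using cdiff_deriv_cdiff[OF f] .
  then show "C1_on (\<lambda>z. f' z v) W"
    by (intro C1_onI[of W _ f'']) (auto intro: cdiff_onD(2) cdiff_deriv_continuous)
qed

lemma holomorphic_map_deriv:
  fixes F :: "complex ^ 'n::finite \<Rightarrow> complex ^ 'm::finite"
  assumes "holomorphic_map_on F W" "z \<in> W"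
  shows "(F has_derivative frechet_derivative F (at z)) (at z)"
    and "frechet_derivative F (at z) (c *s v) = c *s frechet_derivative F (at z) v"
proof -
  obtain D where D: "(F has_derivative D) (at z)" "\<forall>c v. D (c *s v) = c *s D v"
    using assms unfolding holomorphic_map_on_def by blast
  have "frechet_derivative F (at z) = D" using frechet_derivative_at[OF D(1)] by simp
  with D show "(F has_derivative frechet_derivative F (at z)) (at z)"
    "frechet_derivative F (at z) (c *s v) = c *s frechet_derivative F (at z) v" by auto
qed

lemma holomorphic_map_cdiff:
  fixes F :: "complex ^ 'n::finite \<Rightarrow> complex ^ 'm::finite"
  assumes "holomorphic_map_on F W" "open W"
  shows "cdiff_on (\<lambda>z. F z $ i) (\<lambda>z v. frechet_derivative F (at z) v $ i) W"
  unfolding cdiff_on_def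
  by (intro conjI ballI allI assms(2) bounded_linear.has_derivative[OF bounded_linear_vec_nth]
      holomorphic_map_deriv(1)[OF assms(1)]) (simp_all add: holomorphic_map_deriv(2)[OF assms(1)])

lemma holomorphic_map_C2:
  fixes F :: "complex ^ 'n::finite \<Rightarrow> complex ^ 'm::finite"
  assumes "holomorphic_map_on F W" "open W"
  shows "C2_on F W"
  by (rule C2_on_vec[OF cdiff_C2[OF holomorphic_map_cdiff[OF assms]] assms(2)])

text \<open>This is why the second derivative of a coordinate change does not contribute to the Levi form.\<close>

lemma holomorphic_map_hess:
  fixes F :: "complex ^ 'n::finite \<Rightarrow> complex ^ 'm::finite"
  assumes F: "holomorphic_map_on F W" "open W" and z: "z \<in> W" and D: "C2_derivs F F' F'' W"
  shows "F'' z (\<i> *s u) (\<i> *s w) = - F'' z u w"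
proof -
  note F'' = C2_derivs_apply[OF D z]
  have fd: "frechet_derivative F (at y) = F' y" if "y \<in> W" for y
    using C2_derivsD(5)[OF D that] .
  \<comment> \<open>The first slot is complex homogeneous because the components of
    \<open>F' y w\<close> are themselves complex differentiable in \<open>y\<close>.\<close>
  have 1: "F'' z (c *s u) w = c *s F'' z u w" for c u w
  proof (rule vec_eq_iff[THEN iffD2], rule allI)
    fix i
    obtain f'' where f'': "cdiff_on (\<lambda>z. frechet_derivative F (at z) w $ i) f'' W"
      using cdiff_deriv_cdiff[OF holomorphic_map_cdiff[OF F]] .
    have "((\<lambda>y. F' y w $ i) has_derivative (\<lambda>u. F'' z u w $ i)) (at z)"
      by (rule bounded_linear.has_derivative[OF bounded_linear_vec_nth F''])
    moreover have "((\<lambda>y. F' y w $ i) has_derivative f'' z) (at z)"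
      by (rule has_derivative_transform_within_open[OF cdiff_onD(2)[OF f'' z] F(2) z]) (simp add: fd)
    ultimately have "(\<lambda>u. F'' z u w $ i) = f'' z" by (rule has_derivative_unique)
    then show "F'' z (c *s u) w $ i = (c *s F'' z u w) $ i"
      using cdiff_onD(3)[OF f'' z, of c u] by (metis vector_smult_component)
  qed
  \<comment> \<open>For the second slot, the homogeneity of \<open>F' y\<close>, valid for all
    \<open>y\<close> in \<open>W\<close>, is differentiated in \<open>y\<close>. The two slots
    together produce the factor \<open>\<i> * \<i> = -1\<close>.\<close>
  have "(\<lambda>u. F'' z u (\<i> *s w)) = (\<lambda>u. \<i> *s F'' z u w)"
  proof (rule has_derivative_unique[OF F''])
    have "((\<lambda>y. \<i> *s F' y w) has_derivative (\<lambda>u. \<i> *s F'' z u w)) (at z)"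
      by (rule bounded_linear.has_derivative[OF bounded_linear_smult F''])
    then show "((\<lambda>y. F' y (\<i> *s w)) has_derivative (\<lambda>u. \<i> *s F'' z u w)) (at z)"
      by (rule has_derivative_transform_within_open[OF _ F(2) z])
        (simp add: fd[symmetric] holomorphic_map_deriv(2)[OF F(1)])
  qed
  then show ?thesis using 1[of \<i> u w] i_smult_twice by metis
qed

lemma hess_compose:
  fixes F :: "'a::euclidean_space \<Rightarrow> 'b::real_normed_vector"
    and g :: "'b \<Rightarrow> 'c::real_normed_vector"
  assumes F: "C2_derivs F F' F'' W" and g: "C2_derivs g g' g'' V" and sub: "F ` W \<subseteq> V" and z: "z \<in> W"
  shows "hess (\<lambda>x. g (F x)) z u w = g'' (F z) (F' z u) (F' z w) + g' (F z) (F'' z u w)"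
proof -
  have Fz: "F z \<in> V" using sub z by blast
  have "hess (\<lambda>x. g (F x)) z u w = g' (F z) (F'' z u w) + g'' (F z) (F' z u) (F' z w)"
  proof (rule hess_eqI)
    show "open W" using F unfolding C2_derivs_def by blast
    show "((\<lambda>x. g (F x)) has_derivative (\<lambda>v. g' (F y) (F' y v))) (at y)" if "y \<in> W" for y
      using has_derivative_compose[OF C2_derivsD(1)[OF F that] C2_derivsD(1)[OF g]] sub that by auto
    show "((\<lambda>y. g' (F y) (F' y w)) has_derivative
        (\<lambda>u. g' (F z) (F'' z u w) + g'' (F z) (F' z u) (F' z w))) (at z)"
      by (rule bounded_bilinear.FDERIV[OF bounded_bilinear_blinfun_apply
            has_derivative_compose[OF C2_derivsD(1)[OF F z] C2_derivsD(2)[OF g Fz]] C2_derivs_apply[OF F z]])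
  qed (rule z)
  then show ?thesis by simp
qed

text \<open>The term of the chain rule containing \<open>F''\<close> takes opposite values in the
  directions \<open>v\<close> and \<open>\<i> *s v\<close> and drops out of their sum. Hence the
  sign of the Levi form does not depend on the chart.\<close>

lemma levi_form_compose:
  fixes F :: "complex ^ 'n::finite \<Rightarrow> complex ^ 'm::finite"
  assumes F: "holomorphic_map_on F W" "open W" and g: "C2_on g V" "open V"
    and sub: "F ` W \<subseteq> V" and z: "z \<in> W"
  shows "levi_form (\<lambda>x. g (F x)) z v = levi_form g (F z) (frechet_derivative F (at z) v)"
proof -
  have Fz: "F z \<in> V" using sub z by blast
  have C2: "C2_on F W" by (rule holomorphic_map_C2[OF F])
  obtain F' F'' where F': "C2_derivs F F' F'' W" using C2 F(2) C2_on_iff_derivs by blast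
  obtain g' g'' where g': "C2_derivs g g' g'' V" using g C2_on_iff_derivs by blast
  note h = hess_compose[OF F' g' sub z]
  have fd: "frechet_derivative F (at z) = F' z" using C2_derivsD(5)[OF F' z] .
  have "F' z (\<i> *s v) = \<i> *s F' z v"
    using holomorphic_map_deriv(2)[OF F(1) z, of \<i> v] unfolding fd .
  moreover have "F'' z (\<i> *s v) (\<i> *s v) = - F'' z v v"
    by (rule holomorphic_map_hess[OF F z F'])
  ultimately have "hess (\<lambda>x. g (F x)) z v v + hess (\<lambda>x. g (F x)) z (\<i> *s v) (\<i> *s v)
      = hess g (F z) (F' z v) (F' z v) + hess g (F z) (\<i> *s F' z v) (\<i> *s F' z v)"
    unfolding h C2_derivsD(6)[OF g' Fz] by (simp add: blinfun.minus_right)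
  then show ?thesis
    unfolding levi_form_eq_hess[OF C2_on_compose[OF g(1) C2 sub F(2)] F(2) z]
      levi_form_eq_hess[OF g Fz] fd by simp
qed

section \<open>Approximate squares of a C1 map\<close>

definition lattice_points :: "real \<Rightarrow> 'a::euclidean_space set" where
  "lattice_points t = {q. \<forall>b\<in>Basis. \<exists>k::int. q \<bullet> b = t * of_int k}"

text \<open>Rounding the coordinates of \<open>q / t\<close> is injective on the lattice and maps
  the ball into a box of integer points. The bound involves neither \<open>t\<close> nor
  \<open>x\<close>, so refining the mesh does not increase the number of overlapping bumps.\<close>

lemma card_lattice_points_ball:
  fixes x :: "'a::euclidean_space"
  assumes t: "0 < t"
  shows "finite {q \<in> lattice_points t. norm (x - q) < real m * t} \<and>
    card {q \<in> lattice_points t. norm (x - q) < real m * t} \<le> (2 * m + 2) ^ DIM('a)"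
proof -
  define S where "S = {q \<in> lattice_points t. norm (x - q) < real m * t}"
  define K where "K b = {\<lfloor>(x \<bullet> b) / t\<rfloor> - int m .. \<lfloor>(x \<bullet> b) / t\<rfloor> + int m + 1}" for b :: 'a
  define h where "h q = (\<lambda>b\<in>Basis. \<lfloor>(q \<bullet> b) / t\<rfloor>)" for q :: 'a
  have inj: "inj_on h S"
  proof (rule inj_onI)
    fix q r assume q: "q \<in> S" and r: "r \<in> S" and eq: "h q = h r"
    show "q = r"
    proof (rule euclidean_eqI)
      fix b :: 'a assume b: "b \<in> Basis"
      obtain k l :: int where "q \<bullet> b = t * of_int k" "r \<bullet> b = t * of_int l"
        using q r b unfolding S_def lattice_points_def by blast
      moreover have "\<lfloor>(q \<bullet> b) / t\<rfloor> = \<lfloor>(r \<bullet> b) / t\<rfloor>"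
        using fun_cong[OF eq, of b] b by (simp add: h_def)
      ultimately show "q \<bullet> b = r \<bullet> b" using t by simp
    qed
  qed
  have sub: "h ` S \<subseteq> PiE Basis K"
  proof
    fix y assume "y \<in> h ` S"
    then obtain q where q: "q \<in> S" "y = h q" by blast
    have "\<lfloor>(q \<bullet> b) / t\<rfloor> \<in> K b" if b: "b \<in> Basis" for b
    proof -
      have "\<bar>(x - q) \<bullet> b\<bar> < real m * t"
        using Basis_le_norm[OF b, of "x - q"] q(1) unfolding S_def by simp
      then have "\<bar>((x - q) \<bullet> b) / t\<bar> < real m" using t by (simp add: field_simps)
      then have "\<bar>(x \<bullet> b) / t - (q \<bullet> b) / t\<bar> < real m"
        by (simp add: inner_diff_left diff_divide_distrib)
      then show ?thesis unfolding K_def atLeastAtMost_iff by linarith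
    qed
    then show "y \<in> PiE Basis K" unfolding q(2) h_def by simp
  qed
  have fin: "finite (PiE Basis K)" by (rule finite_PiE) (auto simp: K_def)
  have "card (PiE Basis K) = (2 * m + 2) ^ DIM('a)"
    by (simp add: card_PiE K_def nat_add_distrib nat_mult_distrib)
  then show ?thesis unfolding S_def[symmetric]
    using card_mono[OF fin sub] card_image[OF inj] finite_subset[OF sub fin] inj finite_image_iff by metis
qed

lemma lattice_points_near:
  fixes x :: "'a::euclidean_space"
  assumes t: "0 < t"
  obtains q where "q \<in> lattice_points t" "norm (x - q) \<le> real DIM('a) * t"
proof -
  define q where "q = (\<Sum>b\<in>Basis. (t * of_int \<lfloor>(x \<bullet> b) / t\<rfloor>) *\<^sub>R (b::'a))"
  have qb: "q \<bullet> b = t * of_int \<lfloor>(x \<bullet> b) / t\<rfloor>" if "b \<in> Basis" for b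
    unfolding q_def using that by simp
  have "norm (x - q) \<le> (\<Sum>b\<in>Basis. \<bar>(x - q) \<bullet> b\<bar>)" by (rule norm_le_l1)
  also have "\<dots> \<le> (\<Sum>b\<in>(Basis::'a set). t)"
  proof (rule sum_mono)
    fix b :: 'a assume b: "b \<in> Basis"
    have "(x - q) \<bullet> b = t * ((x \<bullet> b) / t - of_int \<lfloor>(x \<bullet> b) / t\<rfloor>)"
      using t by (simp add: inner_diff_left qb[OF b] right_diff_distrib)
    moreover have "\<bar>(x \<bullet> b) / t - of_int \<lfloor>(x \<bullet> b) / t\<rfloor>\<bar> \<le> 1" by linarith
    ultimately show "\<bar>(x - q) \<bullet> b\<bar> \<le> t" using t by (simp add: abs_mult mult_left_le)
  qed
  finally show thesis
    using that[of q] qb unfolding lattice_points_def by auto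
qed

lemma norm_square_affine:
  fixes L :: "'a::euclidean_space \<Rightarrow>\<^sub>L 'b::real_inner" and c :: 'b and q :: 'a
  defines "N \<equiv> \<lambda>x. (norm (c + L (x - q)))\<^sup>2"
  shows "C2_on N UNIV"
    and "frechet_derivative N (at x) v = 2 * ((c + L (x - q)) \<bullet> L v)"
    and "hess N x v v = 2 * (norm (L v))\<^sup>2"
proof -
  have N: "N = (\<lambda>x. (c + L (x - q)) \<bullet> (c + L (x - q)))"
    unfolding N_def by (simp add: power2_norm_eq_inner)
  have d: "(N has_derivative (\<lambda>v. 2 * ((c + L (x - q)) \<bullet> L v))) (at x)" for x
    unfolding N by (auto intro!: derivative_eq_intros simp: inner_commute)
  have d2: "((\<lambda>x. 2 * ((c + L (x - q)) \<bullet> L v)) has_derivative (\<lambda>u. 2 * (L u \<bullet> L v))) (at x)" for x v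
    by (auto intro!: derivative_eq_intros)
  show "C2_on N UNIV"
    by (rule C2_onI[OF d C1_onI[OF d2]]) auto
  show "frechet_derivative N (at x) v = 2 * ((c + L (x - q)) \<bullet> L v)"
    using frechet_derivative_at[OF d] by metis
  show "hess N x v v = 2 * (norm (L v))\<^sup>2"
    using hess_eqI[OF open_UNIV UNIV_I d d2] by (simp add: power2_norm_eq_inner)
qed

text \<open>Each derivative of the bump \<open>\<phi>\<close> costs a factor \<open>1/t\<close>, which is compensated by the affine map being
  of size \<open>\<omega> t\<close> at \<open>x\<close>; all error terms in the Hessian are therefore \<open>O(\<omega>)\<close>.\<close>

lemma bump_times_square:
  fixes L :: "'a::euclidean_space \<Rightarrow>\<^sub>L 'b::real_inner" and x q v :: 'a and c :: 'b
    and P t K \<omega> :: real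
  assumes t: "0 < t" and P: "1 \<le> P"
  defines "\<phi> \<equiv> \<lambda>x. cubeplus (P - (norm (x - q))\<^sup>2 / t\<^sup>2)"
  defines "T \<equiv> \<lambda>x. \<phi> x * (norm (c + L (x - q)))\<^sup>2"
  shows "C2_on T UNIV"
    and "P * t \<le> norm (x - q) \<Longrightarrow> T x = 0 \<and> hess T x v v = 0"
    and "norm (x - q) < P * t \<Longrightarrow> norm (c + L (x - q)) \<le> \<omega> * (P * t) \<Longrightarrow> 0 \<le> \<omega> \<Longrightarrow> \<omega> \<le> 1
      \<Longrightarrow> norm L \<le> K \<Longrightarrow>
      T x \<le> P ^ 5 * \<omega> * t\<^sup>2 \<and>
      2 * \<phi> x * (norm (L v))\<^sup>2 - (24 * P ^ 4 * K + 30 * P ^ 5) * \<omega> * (norm v)\<^sup>2 \<le> hess T x v v"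
proof -
  define A where "A x = P - (norm (x - q))\<^sup>2 / t\<^sup>2" for x
  define N where "N x = (norm (c + L (x - q)))\<^sup>2" for x
  define n where "n x = (norm (0 + id_blinfun (x - q)))\<^sup>2" for x :: 'a
  note n = norm_square_affine[where c=0 and L="id_blinfun :: 'a \<Rightarrow>\<^sub>L 'a" and q=q, folded n_def]
  note N = norm_square_affine[where c=c and L=L and q=q, folded N_def]
  have A_eq: "A = (\<lambda>x. P + (- 1 / t\<^sup>2) * n x)"
    unfolding A_def n_def by (simp add: fun_eq_iff)
  have CA0: "C2_on (\<lambda>x. (- 1 / t\<^sup>2) * n x) UNIV" by (rule C2_on_mult[OF C2_on_const n(1)]) simp
  have CA: "C2_on A UNIV" unfolding A_eq by (rule C2_on_add[OF C2_on_const CA0])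
  have hA: "hess A x v v = - 2 * (norm v)\<^sup>2 / t\<^sup>2" for x
    unfolding A_eq hess_add[OF C2_on_const CA0 open_UNIV UNIV_I]
      hess_cmult[OF n(1) open_UNIV UNIV_I] by (simp add: hess_const n(3))
  have dn: "(n has_derivative (\<lambda>v. 2 * ((x - q) \<bullet> v))) (at x)" for x
    unfolding n_def power2_norm_eq_inner by (auto intro!: derivative_eq_intros simp: inner_commute)
  have dA': "(A has_derivative (\<lambda>v. - 2 * ((x - q) \<bullet> v) / t\<^sup>2)) (at x)" for x
    unfolding A_eq by (rule has_derivative_eq_rhs[OF has_derivative_add[OF has_derivative_const
          has_derivative_mult_right[OF dn]]]) (simp add: fun_eq_iff)
  have dA: "frechet_derivative A (at x) v = - 2 * ((x - q) \<bullet> v) / t\<^sup>2" for x v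
    using frechet_derivative_at[OF dA'] by metis
  have phi: "\<phi> = (\<lambda>x. cubeplus (A x))" unfolding \<phi>_def A_def ..
  have Cphi: "C2_on \<phi> UNIV" unfolding phi by (rule C2_on_cubeplus_comp[OF CA]) simp
  have "((\<lambda>x. cubeplus (A x)) has_derivative (\<lambda>v. 3 * (max 0 (A x))\<^sup>2 * (- 2 * ((x - q) \<bullet> v) / t\<^sup>2))) (at x)" for x
    using has_derivative_compose[OF dA' cubeplus_deriv[unfolded has_field_derivative_def]] .
  from frechet_derivative_at[OF this, folded phi]
  have dphi: "frechet_derivative \<phi> (at x) v = 3 * (max 0 (A x))\<^sup>2 * (- 2 * ((x - q) \<bullet> v) / t\<^sup>2)" for x v
    by metis
  have hphi: "hess \<phi> x v v = 3 * (max 0 (A x))\<^sup>2 * (- 2 * (norm v)\<^sup>2 / t\<^sup>2)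
      + 6 * max 0 (A x) * (2 * ((x - q) \<bullet> v) / t\<^sup>2)\<^sup>2" for x
    unfolding phi hess_cubeplus[OF CA open_UNIV UNIV_I] hA dA by simp
  have T: "T = (\<lambda>x. \<phi> x * N x)" unfolding T_def N_def ..
  show "C2_on T UNIV" unfolding T by (rule C2_on_mult[OF Cphi N(1)]) simp
  have hT: "hess T x v v = \<phi> x * (2 * (norm (L v))\<^sup>2)
      + 2 * frechet_derivative \<phi> (at x) v * (2 * ((c + L (x - q)) \<bullet> L v)) + hess \<phi> x v v * N x"
    unfolding T hess_mult[OF Cphi N(1) open_UNIV UNIV_I] N ..
  define m where "m = max 0 (A x)"
  have phix: "\<phi> x = m ^ 3" unfolding phi cubeplus_def m_def ..
  show "T x = 0 \<and> hess T x v v = 0" if "P * t \<le> norm (x - q)"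
  proof -
    \<comment> \<open>The bump already vanishes at distance \<open>sqrt P * t\<close>; since
      \<open>P \<ge> 1\<close>, the larger radius \<open>P * t\<close> is allowed and avoids the
      root.\<close>
    have "P\<^sup>2 * t\<^sup>2 \<le> (norm (x - q))\<^sup>2"
      using power_mono[OF that, of 2] P t by (simp add: power_mult_distrib)
    then have "P\<^sup>2 \<le> (norm (x - q))\<^sup>2 / t\<^sup>2" using t by (simp add: pos_le_divide_eq)
    moreover have "P * 1 \<le> P * P" using P by (intro mult_left_mono) auto
    ultimately have "A x \<le> 0" unfolding A_def power2_eq_square[of P] by linarith
    then have "m = 0" unfolding m_def by simp
    then show ?thesis unfolding hT hphi dphi m_def[symmetric] using phix by (simp add: T)
  qed
  assume near: "norm (x - q) < P * t" and l: "norm (c + L (x - q)) \<le> \<omega> * (P * t)"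
    and w: "0 \<le> \<omega>" "\<omega> \<le> 1" and K: "norm L \<le> K"
  have m: "0 \<le> m" "m \<le> P" unfolding m_def A_def using P by auto
  have N_le: "0 \<le> N x" "N x \<le> \<omega>\<^sup>2 * P\<^sup>2 * t\<^sup>2"
    using power_mono[OF l, of 2] unfolding N_def by (auto simp: power_mult_distrib mult.assoc)
  \<comment> \<open>The squared Taylor polynomial is quadratic in \<open>\<omega>\<close>, its mixed
    term with the derivative of the bump only linear; reducing both to first order gives a single
    error bound.\<close>
  have w2: "\<omega>\<^sup>2 \<le> \<omega>" using w by (simp add: power2_eq_square mult_left_le)
  have N_le': "N x \<le> \<omega> * P\<^sup>2 * t\<^sup>2"
    using N_le(2) mult_right_mono[OF w2, of "P\<^sup>2 * t\<^sup>2"] by (simp add: mult.assoc)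
  have "T x \<le> P ^ 3 * (\<omega> * P\<^sup>2 * t\<^sup>2)"
    unfolding T phix by (intro mult_mono power_mono m N_le' N_le) (use P in auto)
  then have T_le: "T x \<le> P ^ 5 * \<omega> * t\<^sup>2" by (simp add: algebra_simps power_def)
  have s: "\<bar>(x - q) \<bullet> v\<bar> \<le> P * t * norm v"
    using Cauchy_Schwarz_ineq2[of "x - q" v] mult_right_mono[OF less_imp_le[OF near] norm_ge_zero[of v]] by linarith
  have s': "\<bar>2 * ((x - q) \<bullet> v) / t\<^sup>2\<bar> \<le> 2 * P * norm v / t"
    using s t by (simp add: field_simps power2_eq_square)
  have dphi_le: "\<bar>frechet_derivative \<phi> (at x) v\<bar> \<le> 3 * P\<^sup>2 * (2 * P * norm v / t)"
    unfolding dphi m_def[symmetric] abs_mult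
    by (intro mult_mono) (use s' m P t in \<open>auto intro: power_mono\<close>)
  have Lv: "norm (L v) \<le> K * norm v"
    using norm_blinfun[of L v] mult_right_mono[OF K norm_ge_zero[of v]] by linarith
  have K0: "0 \<le> K" using norm_ge_zero[of L] K by linarith
  have "\<bar>(c + L (x - q)) \<bullet> L v\<bar> \<le> norm (c + L (x - q)) * norm (L v)"
    by (rule Cauchy_Schwarz_ineq2)
  also have "\<dots> \<le> (\<omega> * (P * t)) * (K * norm v)"
    by (intro mult_mono l Lv) (use w P t in auto)
  finally have lL: "\<bar>(c + L (x - q)) \<bullet> L v\<bar> \<le> (\<omega> * (P * t)) * (K * norm v)" .
  have "\<bar>2 * frechet_derivative \<phi> (at x) v * (2 * ((c + L (x - q)) \<bullet> L v))\<bar>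
     \<le> (2 * (3 * P\<^sup>2 * (2 * P * norm v / t))) * (2 * ((\<omega> * (P * t)) * (K * norm v)))"
    unfolding abs_mult by (intro mult_mono dphi_le lL) (use P t in auto)
  also have "\<dots> = 24 * P ^ 4 * K * \<omega> * (norm v)\<^sup>2"
    using t by (simp add: field_simps power_def)
  finally have e1: "\<bar>2 * frechet_derivative \<phi> (at x) v * (2 * ((c + L (x - q)) \<bullet> L v))\<bar>
     \<le> 24 * P ^ 4 * K * \<omega> * (norm v)\<^sup>2" .
  have sq: "(2 * ((x - q) \<bullet> v) / t\<^sup>2)\<^sup>2 \<le> (2 * P * norm v / t)\<^sup>2"
    using power_mono[OF s' abs_ge_zero, of 2] unfolding power2_abs .
  have "\<bar>hess \<phi> x v v\<bar> \<le> 3 * P\<^sup>2 * (2 * (norm v)\<^sup>2 / t\<^sup>2) + 6 * P * (2 * P * norm v / t)\<^sup>2"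
  proof -
    have "\<bar>3 * m\<^sup>2 * (- 2 * (norm v)\<^sup>2 / t\<^sup>2)\<bar> \<le> 3 * P\<^sup>2 * (2 * (norm v)\<^sup>2 / t\<^sup>2)"
      unfolding abs_mult by (intro mult_mono) (use m P in \<open>auto intro: power_mono\<close>)
    moreover have "\<bar>6 * m * (2 * ((x - q) \<bullet> v) / t\<^sup>2)\<^sup>2\<bar> \<le> 6 * P * (2 * P * norm v / t)\<^sup>2"
      unfolding abs_mult by (intro mult_mono) (use m P sq in auto)
    ultimately show ?thesis unfolding hphi m_def[symmetric] by linarith
  qed
  also have "\<dots> = (6 * P\<^sup>2 + 24 * P ^ 3) * ((norm v)\<^sup>2 / t\<^sup>2)"
    by (simp add: power_divide power_def algebra_simps add_divide_distrib)
  also have "\<dots> \<le> (30 * P ^ 3) * ((norm v)\<^sup>2 / t\<^sup>2)"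
    using power_increasing[of 2 3 P] P by (intro mult_right_mono) auto
  finally have hphi_le: "\<bar>hess \<phi> x v v\<bar> \<le> 30 * P ^ 3 * ((norm v)\<^sup>2 / t\<^sup>2)" .
  have "\<bar>hess \<phi> x v v * N x\<bar> \<le> (30 * P ^ 3 * ((norm v)\<^sup>2 / t\<^sup>2)) * (\<omega> * P\<^sup>2 * t\<^sup>2)"
    unfolding abs_mult by (intro mult_mono hphi_le) (use N_le N_le' P in auto)
  also have "\<dots> = 30 * P ^ 5 * \<omega> * (norm v)\<^sup>2"
    using t by (simp add: field_simps power_def)
  finally have e2: "\<bar>hess \<phi> x v v * N x\<bar> \<le> 30 * P ^ 5 * \<omega> * (norm v)\<^sup>2" .
  have "2 * \<phi> x * (norm (L v))\<^sup>2 - (24 * P ^ 4 * K + 30 * P ^ 5) * \<omega> * (norm v)\<^sup>2 \<le> hess T x v v"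
    unfolding hT using e1 e2 by (simp add: algebra_simps)
  with T_le show "T x \<le> P ^ 5 * \<omega> * t\<^sup>2 \<and>
      2 * \<phi> x * (norm (L v))\<^sup>2 - (24 * P ^ 4 * K + 30 * P ^ 5) * \<omega> * (norm v)\<^sup>2 \<le> hess T x v v" ..
qed

text \<open>The function is a sum, over the points \<open>q\<close> of a lattice of mesh \<open>t\<close>, of bumps at \<open>q\<close> times the squared
  norm of the first order Taylor polynomial of \<open>w\<close> at \<open>q\<close>. The number of bumps that overlap at a
  point is bounded independently of \<open>t\<close>, so the error terms tend to \<open>0\<close> with the modulus of
  continuity of \<open>w'\<close>.\<close>

lemma approx_square:
  fixes w :: "'a::euclidean_space \<Rightarrow> 'b::euclidean_space" and w' :: "'a \<Rightarrow> 'a \<Rightarrow>\<^sub>L 'b"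
  assumes R: "0 < R" "cball x0 R \<subseteq> W"
    and w: "\<And>x. x \<in> W \<Longrightarrow> (w has_derivative blinfun_apply (w' x)) (at x)" "continuous_on W w'"
    and \<epsilon>: "0 < \<epsilon>"
  obtains f where "C2_on f UNIV" "\<And>x. 0 \<le> f x"
    "\<And>x. x \<in> cball x0 (R / 2) \<Longrightarrow> w x = 0 \<Longrightarrow> f x \<le> \<epsilon>"
    "\<And>x v. x \<in> cball x0 (R / 2) \<Longrightarrow> w x = 0 \<Longrightarrow>
      (norm (w' x v))\<^sup>2 - \<epsilon> * (norm v)\<^sup>2 \<le> hess f x v v"
proof -
  let ?C = "cball x0 R"
  have cw': "continuous_on ?C w'" using w(2) R(2) by (rule continuous_on_subset)
  have "bounded (w' ` ?C)"
    by (intro compact_imp_bounded compact_continuous_image cw') simp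
  then obtain K where K: "\<And>q. q \<in> ?C \<Longrightarrow> norm (w' q) \<le> K"
    unfolding bounded_iff by blast
  have K0: "0 \<le> K" using order_trans[OF norm_ge_zero K[of x0]] R by simp
  \<comment> \<open>Some lattice point lies within \<open>DIM('a) * t\<close> of any given point,
    and a bump with \<open>P\<close> one larger than the squared dimension is at least 1 there. That
    \<open>P\<close> comes from a natural number is for counting lattice points.\<close>
  define m where "m = (DIM('a))\<^sup>2 + 1"
  define P where "P = real m"
  have P: "1 \<le> P" "P = (real DIM('a))\<^sup>2 + 1" unfolding P_def m_def by auto
  define M where "M = real ((2 * m + 2) ^ DIM('a))"
  have M: "0 \<le> M" unfolding M_def by simp
  define E where "E = 24 * P ^ 4 * K + 30 * P ^ 5"
  have E: "0 \<le> E" unfolding E_def using P K0 by simp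
  \<comment> \<open>The three summands of the denominator pay for the Hessian errors of at most
    \<open>M\<close> overlapping bumps, for the size of \<open>f\<close> along the zero set, and for
    replacing \<open>w' x\<close> by the derivative at a nearby lattice point.\<close>
  define \<omega> where "\<omega> = min 1 (\<epsilon> / (M * E + M * P ^ 5 + 2))"
  have den: "0 < M * E + M * P ^ 5 + 2" using M E P by (simp add: add_nonneg_pos)
  have \<omega>: "0 < \<omega>" "\<omega> \<le> 1" unfolding \<omega>_def using \<epsilon> den by auto
  have "\<omega> * (M * E + M * P ^ 5 + 2) \<le> \<epsilon>"
    using pos_le_divide_eq[OF den, of \<omega> \<epsilon>] unfolding \<omega>_def by simp
  then have \<omega>\<epsilon>: "M * E * \<omega> + M * P ^ 5 * \<omega> + 2 * \<omega> \<le> \<epsilon>" by (simp add: algebra_simps)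
  have "uniformly_continuous_on ?C w'" by (rule compact_uniformly_continuous[OF cw']) simp
  then obtain \<delta> where \<delta>: "0 < \<delta>" "\<And>x y. x \<in> ?C \<Longrightarrow> y \<in> ?C \<Longrightarrow> dist y x < \<delta> \<Longrightarrow> dist (w' y) (w' x) < \<omega>"
    unfolding uniformly_continuous_on_def using \<omega>(1) by metis
  \<comment> \<open>With this mesh the support of a bump has radius at most \<open>\<delta>\<close>,
    so \<open>w'\<close> oscillates by at most \<open>\<omega>\<close> between its centre and a
    point of it; and all bumps meeting the ball of radius \<open>R / 2\<close> are centred in the
    ball of radius \<open>R\<close>.\<close>
  define t where "t = min 1 (min (\<delta> / P) (R / (2 * P)))"
  have t: "0 < t" "t \<le> 1" unfolding t_def using \<delta>(1) R(1) P(1) by auto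
  have "t \<le> \<delta> / P" "t \<le> R / (2 * P)" unfolding t_def by auto
  then have Pt: "P * t \<le> \<delta>" "P * t \<le> R / 2"
    using P by (auto simp: field_simps)
  define Q where "Q = lattice_points t \<inter> ?C"
  define \<phi> where "\<phi> q x = cubeplus (P - (norm (x - q))\<^sup>2 / t\<^sup>2)" for q x :: 'a
  define T where "T q x = \<phi> q x * (norm (w q + w' q (x - q)))\<^sup>2" for q x
  define f where "f x = (\<Sum>q\<in>Q. T q x)" for x
  note bump = bump_times_square[OF t(1) P(1), where c="w q" and L="w' q" and q=q for q, folded \<phi>_def, folded T_def]
  have finQ: "finite Q"
  proof -
    obtain k :: nat where "R / t < real k" using reals_Archimedean2 by blast
    then have "R < real k * t" using t by (simp add: field_simps)
    then have "Q \<subseteq> {q \<in> lattice_points t. norm (x0 - q) < real k * t}"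
      unfolding Q_def by (auto simp: dist_norm)
    then show ?thesis using card_lattice_points_ball[OF t(1), of x0 k] finite_subset by blast
  qed
  have C2: "C2_on f UNIV" unfolding f_def by (intro C2_on_sum bump(1))
  have f0: "0 \<le> f x" for x
    unfolding f_def T_def \<phi>_def cubeplus_def by (intro sum_nonneg mult_nonneg_nonneg) auto
  have main: "f x \<le> \<epsilon> \<and> (norm (w' x v))\<^sup>2 - \<epsilon> * (norm v)\<^sup>2 \<le> hess f x v v"
    if x: "x \<in> cball x0 (R / 2)" and wx: "w x = 0" for x v
  proof -
    have xC: "x \<in> ?C" using x R(1) by auto
    define N where "N = {q \<in> lattice_points t. norm (x - q) < P * t}"
    have N: "finite N" "real (card N) \<le> M"
      using card_lattice_points_ball[OF t(1), of x m] unfolding N_def P_def M_def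
      by (auto simp del: of_nat_power)
    have NQ: "N \<subseteq> Q"
    proof
      fix q assume "q \<in> N"
      then have "q \<in> lattice_points t" "norm (x - q) < R / 2" using Pt unfolding N_def by auto
      moreover have "norm (x0 - q) \<le> norm (x0 - x) + norm (x - q)" by (rule norm_diff_triangle_ineq[of x0 x x q, simplified])
      ultimately show "q \<in> Q" using x unfolding Q_def by (simp add: dist_norm)
    qed
    have qN: "norm (w' q - w' x) \<le> \<omega> \<and> norm (w q + w' q (x - q)) \<le> \<omega> * (P * t) \<and> norm (w' q) \<le> K"
      if q: "q \<in> N" for q
    proof -
      have qC: "q \<in> ?C" using NQ q unfolding Q_def by blast
      have qx: "norm (x - q) < P * t" using q unfolding N_def by blast
      define S where "S = closed_segment q x"
      have S: "y \<in> ?C" "norm (w' y - w' q) \<le> \<omega>" if "y \<in> S" for y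
      proof -
        show yC: "y \<in> ?C" using closed_segment_subset[OF qC xC] that unfolding S_def by auto
        have "dist y q < \<delta>"
          using segment_bound(1)[OF that[unfolded S_def]] qx Pt by (simp add: dist_norm norm_minus_commute)
        from \<delta>(2)[OF qC yC this] show "norm (w' y - w' q) \<le> \<omega>" by (simp add: dist_norm)
      qed
      have "norm (w x - w q - w' q (x - q)) \<le> norm (x - q) * \<omega>"
      proof (rule differentiable_bound_linearization)
        show "q + s *\<^sub>R (x - q) \<in> S" if "s \<in> {0..1}" for s
          using that unfolding S_def closed_segment_def by (auto simp: algebra_simps intro!: exI[of _ s])
        show "(w has_derivative blinfun_apply (w' y)) (at y within S)" if "y \<in> S" for y
          using w(1) S(1)[OF that] R(2) has_derivative_at_withinI by blast
        show "onorm (blinfun_apply (w' y) - blinfun_apply (w' q)) \<le> \<omega>" if "y \<in> S" for y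
          using S(2)[OF that] by (simp add: norm_blinfun.rep_eq minus_blinfun.rep_eq fun_diff_def)
        show "q \<in> S" unfolding S_def by simp
      qed
      \<comment> \<open>As \<open>w x = 0\<close>, the value at \<open>x\<close> of the Taylor
        polynomial at \<open>q\<close> is minus the remainder. This is the smallness that the bump
        estimate requires, and it is available only along the zero set.\<close>
      moreover have "norm (w x - w q - w' q (x - q)) = norm (w q + w' q (x - q))"
        unfolding wx using norm_minus_cancel[of "w q + w' q (x - q)"] by (simp add: algebra_simps)
      moreover have "norm (x - q) * \<omega> \<le> \<omega> * (P * t)" using qx \<omega> by (simp add: mult.commute)
      moreover have "norm (w' q - w' x) \<le> \<omega>" using S(2)[of x] unfolding S_def by (simp add: norm_minus_commute)
      ultimately show ?thesis using K[OF qC] by linarith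
    qed
    have near: "norm (x - q) < P * t" if "q \<in> N" for q using that unfolding N_def by blast
    have b: "T q x \<le> P ^ 5 * \<omega> * t\<^sup>2 \<and>
        2 * \<phi> q x * (norm (w' q v))\<^sup>2 - E * \<omega> * (norm v)\<^sup>2 \<le> hess (T q) x v v" if "q \<in> N" for q
      unfolding E_def by (rule bump(3)[OF near[OF that]]) (use qN[OF that] \<omega> in auto)
    have far: "T q x = 0 \<and> hess (T q) x v v = 0" if "q \<in> Q - N" for q
      by (rule bump(2)) (use that in \<open>auto simp: N_def Q_def\<close>)
    have "f x = (\<Sum>q\<in>N. T q x)" unfolding f_def
      by (rule sum.mono_neutral_right[OF finQ NQ]) (use far in blast)
    also have "\<dots> \<le> (\<Sum>q\<in>N. P ^ 5 * \<omega> * t\<^sup>2)" by (rule sum_mono) (use b in blast)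
    also have "\<dots> = real (card N) * (P ^ 5 * \<omega> * t\<^sup>2)" by simp
    also have "\<dots> \<le> M * (P ^ 5 * \<omega> * 1)"
      by (intro mult_mono N mult_left_mono) (use M P \<omega> t in \<open>auto simp: power_le_one\<close>)
    also have "\<dots> \<le> \<epsilon>" using \<omega>\<epsilon> \<omega> mult_nonneg_nonneg[OF mult_nonneg_nonneg[OF M E], of \<omega>]
      by (simp add: algebra_simps)
    finally have fle: "f x \<le> \<epsilon>" .
    obtain q0 where q0: "q0 \<in> lattice_points t" "norm (x - q0) \<le> real DIM('a) * t"
      using lattice_points_near[OF t(1)] .
    have DP: "real DIM('a) < P"
    proof -
      have "real DIM('a) * 1 \<le> real DIM('a) * real DIM('a)" by (intro mult_left_mono) (auto simp: Suc_le_eq)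
      then show ?thesis unfolding P(2) power2_eq_square by linarith
    qed
    have q0N: "q0 \<in> N" unfolding N_def using q0 mult_strict_right_mono[OF DP t(1)] by auto
    have "(norm (x - q0))\<^sup>2 \<le> (real DIM('a))\<^sup>2 * t\<^sup>2"
      using power_mono[OF q0(2), of 2] by (simp add: power_mult_distrib)
    then have "(norm (x - q0))\<^sup>2 / t\<^sup>2 \<le> (real DIM('a))\<^sup>2" using t by (simp add: pos_divide_le_eq)
    then have "1 \<le> P - (norm (x - q0))\<^sup>2 / t\<^sup>2" using P(2) by linarith
    then have \<phi>1: "1 \<le> \<phi> q0 x" unfolding \<phi>_def cubeplus_def by (simp add: one_le_power)
    have hess: "hess f x v v = (\<Sum>q\<in>N. hess (T q) x v v)"
      unfolding f_def hess_sum[OF open_UNIV UNIV_I bump(1)]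
      by (rule sum.mono_neutral_right[OF finQ NQ]) (use far in blast)
    \<comment> \<open>All main terms are nonnegative, so the single bump at \<open>q0\<close>, of
      height at least 1, suffices for the lower bound.\<close>
    have "2 * 1 * (norm (w' q0 v))\<^sup>2 \<le> 2 * \<phi> q0 x * (norm (w' q0 v))\<^sup>2"
      by (intro mult_right_mono mult_left_mono \<phi>1) auto
    also have "\<dots> \<le> (\<Sum>q\<in>N. 2 * \<phi> q x * (norm (w' q v))\<^sup>2)"
      by (rule member_le_sum[OF q0N _ N(1)]) (auto simp: \<phi>_def cubeplus_def)
    also have "\<dots> - real (card N) * (E * \<omega> * (norm v)\<^sup>2) = (\<Sum>q\<in>N. 2 * \<phi> q x * (norm (w' q v))\<^sup>2 - E * \<omega> * (norm v)\<^sup>2)"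
      by (simp add: sum_subtractf)
    also have "\<dots> \<le> hess f x v v" unfolding hess by (rule sum_mono) (use b in blast)
    finally have h1: "2 * (norm (w' q0 v))\<^sup>2 - real (card N) * (E * \<omega> * (norm v)\<^sup>2) \<le> hess f x v v" by simp
    have "real (card N) * (E * \<omega> * (norm v)\<^sup>2) \<le> M * (E * \<omega> * (norm v)\<^sup>2)"
      by (intro mult_right_mono N) (use E \<omega> in auto)
    then have h2: "2 * (norm (w' q0 v))\<^sup>2 - M * E * \<omega> * (norm v)\<^sup>2 \<le> hess f x v v"
      using h1 by (simp add: mult.assoc)
    have "norm (w' x v) \<le> norm (w' q0 v) + norm ((w' q0 - w' x) v)"
      using norm_triangle_ineq4[of "w' q0 v" "(w' q0 - w' x) v"] by (simp add: blinfun.diff_left)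
    also have "norm ((w' q0 - w' x) v) \<le> \<omega> * norm v"
      using norm_blinfun[of "w' q0 - w' x" v] qN[OF q0N] mult_right_mono[of "norm (w' q0 - w' x)" \<omega> "norm v"] by auto
    finally have "(norm (w' x v))\<^sup>2 \<le> (norm (w' q0 v) + \<omega> * norm v)\<^sup>2" by (intro power_mono) auto
    \<comment> \<open>Passing from \<open>q0\<close> to \<open>x\<close> costs the factor 2 that the
      Hessian of a square provides; hence the Hessian of half the square appears in the
      conclusion.\<close>
    also have "\<dots> \<le> 2 * (norm (w' q0 v))\<^sup>2 + 2 * (\<omega> * norm v)\<^sup>2"
      using sum_squares_bound[of "norm (w' q0 v)" "\<omega> * norm v"] by (simp add: power2_sum)
    also have "(\<omega> * norm v)\<^sup>2 \<le> \<omega> * (norm v)\<^sup>2"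
    proof -
      have "\<omega>\<^sup>2 \<le> \<omega>" using \<omega> by (simp add: power2_eq_square mult_left_le)
      from mult_right_mono[OF this, of "(norm v)\<^sup>2"] show ?thesis by (simp add: power_mult_distrib)
    qed
    finally have h3: "(norm (w' x v))\<^sup>2 \<le> 2 * (norm (w' q0 v))\<^sup>2 + 2 * \<omega> * (norm v)\<^sup>2" by simp
    have "(M * E * \<omega> + 2 * \<omega>) * (norm v)\<^sup>2 \<le> \<epsilon> * (norm v)\<^sup>2"
    proof (rule mult_right_mono)
      have "0 \<le> M * P ^ 5 * \<omega>" using M P \<omega> by simp
      then show "M * E * \<omega> + 2 * \<omega> \<le> \<epsilon>" using \<omega>\<epsilon> by linarith
    qed simp
    with h2 h3 have "(norm (w' x v))\<^sup>2 - \<epsilon> * (norm v)\<^sup>2 \<le> hess f x v v" by (simp add: distrib_right)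
    with fle show ?thesis ..
  qed
  show thesis using that[OF C2 f0] main by blast
qed

section \<open>Compactness bounds and the local bump\<close>

lemma quadratic_form_lower_bound:
  fixes Q :: "'a::metric_space \<Rightarrow> 'b::euclidean_space \<Rightarrow> real"
  assumes K: "compact K" and Q: "continuous_on (K \<times> sphere 0 1) (\<lambda>(x, v). Q x v)"
    and pos: "\<And>x v. x \<in> K \<Longrightarrow> v \<noteq> 0 \<Longrightarrow> 0 < Q x v"
    and hom: "\<And>x s v. x \<in> K \<Longrightarrow> Q x (s *\<^sub>R v) = s\<^sup>2 * Q x v"
  obtains c where "0 < c" "\<And>x v. x \<in> K \<Longrightarrow> c * (norm v)\<^sup>2 \<le> Q x v"
proof -
  obtain c where c: "0 < c" "\<forall>x\<in>K. \<forall>v\<in>sphere 0 1. c \<le> Q x v"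
  proof (cases "K \<times> sphere (0::'b) 1 = {}")
    case True
    \<comment> \<open>The compact set may be empty, for instance when the zero set misses the
      annulus; any positive constant will do.\<close>
    then show ?thesis using that[of 1] by auto
  next
    case False
    have "compact (K \<times> sphere (0::'b) 1)" by (intro compact_Times K compact_sphere)
    from continuous_attains_inf[OF this False Q]
    obtain x0 v0 where 1: "x0 \<in> K" "v0 \<in> sphere 0 1"
      "\<forall>x\<in>K. \<forall>v\<in>sphere 0 1. Q x0 v0 \<le> Q x v" by fastforce
    then have "0 < Q x0 v0" by (intro pos) auto
    with 1 that show ?thesis by blast
  qed
  have "c * (norm v)\<^sup>2 \<le> Q x v" if x: "x \<in> K" for x v
  proof (cases "v = 0")
    case True
    then show ?thesis using hom[OF x, of 0 0] by simp
  next
    case False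
    have "v = norm v *\<^sub>R (v /\<^sub>R norm v)" using False by simp
    then have "Q x v = (norm v)\<^sup>2 * Q x (v /\<^sub>R norm v)" using hom[OF x] by metis
    moreover have "c \<le> Q x (v /\<^sub>R norm v)" using c(2) x False by simp
    ultimately show ?thesis using mult_left_mono[of c "Q x (v /\<^sub>R norm v)" "(norm v)\<^sup>2"]
      by (simp add: mult.commute)
  qed
  with c(1) that show thesis by blast
qed

lemma hess_bound:
  fixes g :: "'a::real_normed_vector \<Rightarrow> 'b::real_normed_vector"
  assumes "C2_on g W" "open W" "compact K" "K \<subseteq> W"
  obtains C where "0 \<le> C" "\<And>x v. x \<in> K \<Longrightarrow> norm (hess g x v v) \<le> C * (norm v)\<^sup>2"
proof -
  obtain g' g'' where g: "C2_derivs g g' g'' W" using assms C2_on_iff_derivs by blast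
  have "bounded (g'' ` K)"
    by (intro compact_imp_bounded compact_continuous_image continuous_on_subset[OF C2_derivsD(4)[OF g]] assms)
  then obtain C where C: "\<And>x. x \<in> K \<Longrightarrow> norm (g'' x) \<le> C" unfolding bounded_iff by blast
  show thesis
  proof (rule that[of "max 0 C"])
    fix x v assume x: "x \<in> K"
    have "norm (hess g x v v) = norm (g'' x v v)" using C2_derivsD(6)[OF g] x assms(4) by (metis subsetD)
    also have "\<dots> \<le> norm (g'' x v) * norm v" by (rule norm_blinfun)
    also have "\<dots> \<le> (norm (g'' x) * norm v) * norm v" by (intro mult_right_mono norm_blinfun) auto
    also have "\<dots> \<le> (max 0 C * norm v) * norm v" using C[OF x] by (intro mult_right_mono) auto
    finally show "norm (hess g x v v) \<le> max 0 C * (norm v)\<^sup>2" by (simp add: power2_eq_square mult.assoc)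
  qed simp
qed

text \<open>The bump is \<open>max 0 G ^ 3\<close> with \<open>G = A f + T\<close>, where \<open>f\<close> approximates the square of \<open>w\<close> and \<open>T\<close> is the
  function \<open>1 + |x - x0|^2\<close> bent down so as to be negative for \<open>|x - x0| \<ge> r\<close>. On the annulus where \<open>T\<close>
  is bent, nondegeneracy makes the Levi form of \<open>A f\<close> dominate for large \<open>A\<close>. Since \<open>A f\<close> is small on
  the zero set of \<open>w\<close>, the function \<open>G\<close> is still negative there for \<open>|x - x0| \<ge> r\<close>, so the
  cutoff \<open>ct\<close> does not disturb the Levi form along the zero set.\<close>

lemma local_bump:
  fixes w :: "complex ^ 'n::finite \<Rightarrow> 'b::euclidean_space"
  assumes W: "open W" "x0 \<in> W"
    and w: "\<And>x. x \<in> W \<Longrightarrow> (w has_derivative blinfun_apply (w' x)) (at x)" "continuous_on W w'"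
    and s: "0 < s" and nondeg: "\<And>x v. x \<in> ball x0 s \<Longrightarrow> x \<in> W \<Longrightarrow> w x = 0 \<Longrightarrow> x \<noteq> x0 \<Longrightarrow> v \<noteq> 0 \<Longrightarrow>
      w' x v \<noteq> 0 \<or> w' x (\<i> *s v) \<noteq> 0"
  obtains g \<rho> \<delta> where "C2_on g UNIV" "0 < \<delta>" "cball x0 \<rho> \<subseteq> W" "ball x0 \<delta> \<subseteq> W"
    "\<And>x. g x \<noteq> 0 \<Longrightarrow> x \<in> cball x0 \<rho>"
    "\<And>x v. x \<in> W \<Longrightarrow> w x = 0 \<Longrightarrow> 0 \<le> levi_form g x v"
    "\<And>x v. x \<in> ball x0 \<delta> \<Longrightarrow> w x = 0 \<Longrightarrow> v \<noteq> 0 \<Longrightarrow> 0 < levi_form g x v"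
proof -
  let ?H = "\<lambda>g x v. hess g x v v + hess g x (\<i> *s v) (\<i> *s v) :: real"
  obtain r0 where r0: "0 < r0" "cball x0 r0 \<subseteq> W" using W open_contains_cball by blast
  \<comment> \<open>The ball of radius \<open>4 * r\<close> lies in \<open>W\<close>, so
    \<open>approx_square\<close> controls the ball of radius \<open>2 * r\<close>; and
    \<open>2 * r < s\<close> makes the nondegeneracy assumption available there.\<close>
  define r where "r = min (r0 / 4) (s / 4)"
  have r: "0 < r" "2 * r < s" "cball x0 (4 * r) \<subseteq> W" unfolding r_def using r0 s by auto
  define n where "n x = (norm (0 + id_blinfun (x - x0)))\<^sup>2" for x :: "complex ^ 'n"
  note n = norm_square_affine[where c=0 and L="id_blinfun :: (complex ^ 'n) \<Rightarrow>\<^sub>L _" and q=x0, folded n_def]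
  have n_eq: "n x = (norm (x - x0))\<^sup>2" for x unfolding n_def by simp
  have hn: "hess n x v v = 2 * (norm v)\<^sup>2" for x v using n(3)[of x v] by simp
  have cn: "continuous_on UNIV n" unfolding n_eq[abs_def] by (intro continuous_intros)
  have n_dist: "n x \<le> a\<^sup>2 \<longleftrightarrow> x \<in> cball x0 a" "n x < a\<^sup>2 \<longleftrightarrow> x \<in> ball x0 a" if "0 \<le> a" for x a
    unfolding n_eq using that
    by (auto simp: dist_norm norm_minus_commute power2_le_iff_abs_le abs_le_square_iff[symmetric]
        power_mono_iff abs_square_less_1 intro: power_strict_mono dest: power_less_imp_less_base)
  \<comment> \<open>Normalised so that the subtracted term reaches \<open>2 + 4 * r\<^sup>2\<close>
    as soon as \<open>n x = r\<^sup>2\<close>; against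
    \<open>1 + n x \<le> 1 + 4 * r\<^sup>2\<close> this leaves at most -1.\<close>
  define B where "B = (2 + 4 * r\<^sup>2) / (r\<^sup>2 / 2) ^ 3"
  have B: "0 \<le> B" unfolding B_def by simp
  define T where "T x = (1 + n x) + (- B) * cubeplus (n x - r\<^sup>2 / 2)" for x
  have C1n: "C2_on (\<lambda>x. 1 + n x) UNIV" by (intro C2_on_add n(1)) simp
  have CT: "C2_on T UNIV" unfolding T_def[abs_def]
    by (intro C2_on_add[OF C1n] C2_on_mult C2_on_cubeplus_comp C2_on_diff n(1)) auto
  have T_inner: "T x = 1 + n x" if "n x \<le> r\<^sup>2 / 2" for x
    unfolding T_def cubeplus_def using that by simp
  have T_outer: "T x \<le> -1" if "r\<^sup>2 \<le> n x" "n x \<le> 4 * r\<^sup>2" for x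
  proof -
    have "2 + 4 * r\<^sup>2 = B * (r\<^sup>2 / 2) ^ 3" unfolding B_def using r by simp
    also have "\<dots> \<le> B * cubeplus (n x - r\<^sup>2 / 2)"
      unfolding cubeplus_def by (intro mult_left_mono power_mono B) (use that in auto)
    finally show ?thesis unfolding T_def using that by simp
  qed
  have HT_inner: "?H T x v = 4 * (norm v)\<^sup>2" if "n x < r\<^sup>2 / 2" for x v
  proof -
    have "open {x. n x < r\<^sup>2 / 2}" by (intro open_Collect_less cn continuous_intros)
    then have "hess T x v v = hess (\<lambda>x. 1 + n x) x v v" for v
      by (rule hess_cong[OF _ _ C2_on_subset[OF C1n]]) (use that T_inner in auto)
    then show ?thesis
      by (simp add: hess_add[OF C2_on_const n(1) open_UNIV UNIV_I] hess_const hn norm_i_smult)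
  qed
  obtain C where C: "0 \<le> C" "\<And>x v. x \<in> cball x0 (2 * r) \<Longrightarrow> norm (hess T x v v) \<le> C * (norm v)\<^sup>2"
    using hess_bound[OF CT open_UNIV compact_cball] by blast
  \<comment> \<open>Outside \<open>Z\<close> the Hessian of \<open>T\<close> helps by itself. The
    bound \<open>r\<^sup>2 / 2 \<le> n x\<close> excludes \<open>x0\<close>, where nondegeneracy may
    fail, so compactness gives a uniform \<open>c\<close>.\<close>
  define Z where "Z = {x \<in> cball x0 (2 * r). r\<^sup>2 / 2 \<le> n x \<and> w x = 0}"
  have Zsub: "Z \<subseteq> cball x0 (2 * r)" "Z \<subseteq> W" unfolding Z_def using r by auto
  have cw: "continuous_on W w"
    using w(1) by (meson continuous_at_imp_continuous_on has_derivative_continuous)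
  have Zball: "cball x0 (2 * r) \<subseteq> W"
    using subset_cball[of "2 * r" "4 * r" x0] r by auto
  have Z: "compact Z"
  proof -
    have "Z = {x \<in> cball x0 (2 * r). w x \<in> {0}} \<inter> {x. r\<^sup>2 / 2 \<le> n x}" unfolding Z_def by auto
    moreover have "closed {x \<in> cball x0 (2 * r). w x \<in> {0}}"
      by (rule continuous_closed_preimage[unfolded vimage_def Int_def mem_Collect_eq])
        (use continuous_on_subset[OF cw, of "cball x0 (2 * r)"] Zball in auto)
    moreover have "closed {x. r\<^sup>2 / 2 \<le> n x}" by (intro closed_Collect_le cn continuous_intros)
    moreover have "bounded Z" using Zsub(1) bounded_cball bounded_subset by blast
    ultimately show ?thesis by (simp add: compact_eq_bounded_closed closed_Int)
  qed
  define q where "q x v = (norm (w' x v))\<^sup>2 + (norm (w' x (\<i> *s v)))\<^sup>2" for x v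
  obtain c where c: "0 < c" "\<And>x v. x \<in> Z \<Longrightarrow> c * (norm v)\<^sup>2 \<le> q x v"
  proof (rule quadratic_form_lower_bound[OF Z])
    have cw': "continuous_on (Z \<times> sphere 0 1) (\<lambda>x. w' (fst x))"
      by (rule continuous_on_compose2[OF w(2)]) (use Zsub in \<open>auto intro: continuous_intros\<close>)
    have ci: "continuous_on (Z \<times> sphere 0 1) (\<lambda>x. \<i> *s snd x)"
      by (rule bounded_linear.continuous_on[OF bounded_linear_smult]) (intro continuous_intros)
    show "continuous_on (Z \<times> sphere 0 1) (\<lambda>(x, v). q x v)"
      unfolding q_def split_beta by (intro continuous_intros cw' ci)
    show "0 < q x v" if "x \<in> Z" "v \<noteq> 0" for x v
    proof -
      have "x \<noteq> x0" using that(1) r unfolding Z_def n_eq by auto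
      moreover have "x \<in> ball x0 s" using that(1) r unfolding Z_def by auto
      ultimately have "w' x v \<noteq> 0 \<or> w' x (\<i> *s v) \<noteq> 0"
        using nondeg that Zsub unfolding Z_def by blast
      then show ?thesis unfolding q_def by (auto intro: add_pos_nonneg add_nonneg_pos)
    qed
    have "\<i> *s (s *\<^sub>R v) = s *\<^sub>R (\<i> *s v)" for s and v :: "complex ^ 'n"
      by (simp add: vec_eq_iff)
    then show "q x (s *\<^sub>R v) = s\<^sup>2 * q x v" for x s v
      unfolding q_def by (simp add: blinfun.scaleR_right power_mult_distrib distrib_left)
  qed blast
  \<comment> \<open>Of \<open>2 * C + 3\<close>, the part \<open>2 * C\<close> offsets the Hessian
    of \<open>T\<close> in the two directions, 1 is used up by the error of \<open>f\<close>, and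
    the remaining 2 makes the sum positive.\<close>
  define A where "A = (2 * C + 3) / c"
  have A: "0 < A" "A * c = 2 * C + 3" unfolding A_def using c(1) C(1) by auto
  \<comment> \<open>The product \<open>A * \<epsilon> = 1 / 2\<close> has two uses: it bounds the
    error in the Hessian, and it keeps \<open>A * f\<close> below the amount 1 by which
    \<open>T\<close> is negative on the outer annulus.\<close>
  define \<epsilon> where "\<epsilon> = 1 / (2 * A)"
  have \<epsilon>: "0 < \<epsilon>" "A * \<epsilon> = 1 / 2" unfolding \<epsilon>_def using A by auto
  have r4: "0 < 4 * r" using r by simp
  obtain f where f: "C2_on f UNIV" "\<And>x. 0 \<le> f x"
    "\<And>x. x \<in> cball x0 (4 * r / 2) \<Longrightarrow> w x = 0 \<Longrightarrow> f x \<le> \<epsilon>"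
    "\<And>x v. x \<in> cball x0 (4 * r / 2) \<Longrightarrow> w x = 0 \<Longrightarrow> (norm (w' x v))\<^sup>2 - \<epsilon> * (norm v)\<^sup>2 \<le> hess f x v v"
    using approx_square[OF r4 r(3) w \<epsilon>(1)] by blast
  define G where "G x = A * f x + T x" for x
  have CAf: "C2_on (\<lambda>x. A * f x) UNIV" by (intro C2_on_mult f(1)) auto
  have CG: "C2_on G UNIV" unfolding G_def[abs_def] by (rule C2_on_add[OF CAf CT])
  have HG: "0 < ?H G x v" if x: "x \<in> cball x0 (2 * r)" "w x = 0" and v: "v \<noteq> 0" for x v
  proof -
    have eq: "?H G x v = A * ?H f x v + ?H T x v"
      unfolding G_def[abs_def] hess_add[OF CAf CT open_UNIV UNIV_I] hess_cmult[OF f(1) open_UNIV UNIV_I]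
      by (simp add: algebra_simps)
    have "q x v - 2 * \<epsilon> * (norm v)\<^sup>2 \<le> ?H f x v"
      using f(4)[of x v] f(4)[of x "\<i> *s v"] x unfolding q_def norm_i_smult by simp
    from mult_left_mono[OF this less_imp_le[OF A(1)]]
    have 1: "A * q x v - 2 * (A * \<epsilon>) * (norm v)\<^sup>2 \<le> A * ?H f x v" by (simp add: algebra_simps)
    have v2: "0 < (norm v)\<^sup>2" using v by simp
    show ?thesis
    proof (cases "n x < r\<^sup>2 / 2")
      case True
      have "0 \<le> A * q x v" unfolding q_def using A by simp
      then show ?thesis using 1 v2 unfolding eq HT_inner[OF True] \<epsilon>(2) by linarith
    next
      case False
      then have "x \<in> Z" using x unfolding Z_def by simp
      then have "A * (c * (norm v)\<^sup>2) \<le> A * q x v" using c(2) A by simp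
      then have "(2 * C + 3) * (norm v)\<^sup>2 \<le> A * q x v" unfolding A(2)[symmetric] by (simp add: mult.assoc)
      moreover have "- 2 * C * (norm v)\<^sup>2 \<le> ?H T x v"
        using C(2)[OF x(1), of v] C(2)[OF x(1), of "\<i> *s v"] unfolding norm_i_smult by simp
      ultimately show ?thesis using 1 v2 unfolding eq \<epsilon>(2) distrib_right by linarith
    qed
  qed
  have G_outer: "G x < 0" if "r\<^sup>2 \<le> n x" "n x \<le> 4 * r\<^sup>2" "w x = 0" for x
  proof -
    have "x \<in> cball x0 (2 * r)" using that(2) n_dist(1)[of "2 * r" x] r by (simp add: power_mult_distrib)
    then have "A * f x \<le> A * \<epsilon>" using f(3)[of x] that A by simp
    then show ?thesis unfolding G_def \<epsilon>(2) using T_outer[OF that(1,2)] by simp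
  qed
  \<comment> \<open>Off the zero set \<open>G\<close> may be positive arbitrarily far out, so
    compact support has to be forced. The cutoff is 1 for \<open>n x \<le> 2 * r\<^sup>2\<close> and
    0 for \<open>n x \<ge> 4 * r\<^sup>2\<close>.\<close>
  define ct :: "complex ^ 'n \<Rightarrow> real" where "ct x = cubeplus (1 - cubeplus (n x / (2 * r\<^sup>2) - 1))" for x
  have Cct: "C2_on ct UNIV" unfolding ct_def[abs_def]
  proof (intro C2_on_cubeplus_comp C2_on_diff C2_on_const open_UNIV)
    show "C2_on (\<lambda>x. n x / (2 * r\<^sup>2)) UNIV"
      using C2_on_mult[OF C2_on_const[of "1 / (2 * r\<^sup>2)"] n(1)] by simp
  qed
  have ct1: "ct x = 1" if "n x \<le> 2 * r\<^sup>2" for x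
    using that r unfolding ct_def cubeplus_def by (simp add: field_simps)
  have ct0: "ct x = 0" if "4 * r\<^sup>2 \<le> n x" for x
  proof -
    have "1 \<le> n x / (2 * r\<^sup>2) - 1" using that r by (simp add: field_simps)
    then have "1 \<le> cubeplus (n x / (2 * r\<^sup>2) - 1)" unfolding cubeplus_def by (simp add: one_le_power)
    then show ?thesis unfolding ct_def cubeplus_def[of "1 - _"] by simp
  qed
  define g where "g x = ct x * cubeplus (G x)" for x
  have CcG: "C2_on (\<lambda>x. cubeplus (G x)) UNIV" by (intro C2_on_cubeplus_comp CG open_UNIV)
  have Cg: "C2_on g UNIV" unfolding g_def[abs_def] by (intro C2_on_mult Cct CcG open_UNIV)
  have levi: "levi_form g x v = ?H g x v / 4" for x v by (rule levi_form_eq_hess[OF Cg open_UNIV UNIV_I])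
  have Hg_inner: "3 * (max 0 (G x))\<^sup>2 * ?H G x v \<le> ?H g x v" if "n x < 2 * r\<^sup>2" for x v
  proof -
    have "open {x. n x < 2 * r\<^sup>2}" by (intro open_Collect_less cn continuous_intros)
    then have "hess g x v v = hess (\<lambda>x. cubeplus (G x)) x v v" for v
      by (rule hess_cong[OF _ _ C2_on_subset[OF CcG]]) (use that ct1 g_def in auto)
    then have "3 * (max 0 (G x))\<^sup>2 * hess G x v v \<le> hess g x v v" for v
      unfolding hess_cubeplus[OF CG open_UNIV UNIV_I] by simp
    from add_mono[OF this[of v] this[of "\<i> *s v"]] show ?thesis by (simp add: distrib_left)
  qed
  show thesis
  proof (rule that[OF Cg, of "r / 2" "2 * r"])
    show "cball x0 (2 * r) \<subseteq> W" "ball x0 (r / 2) \<subseteq> W" using r by auto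
    show "x \<in> cball x0 (2 * r)" if "g x \<noteq> 0" for x
    proof -
      have "n x < 4 * r\<^sup>2" using that ct0[of x] unfolding g_def by force
      then show ?thesis using n_dist(1)[of "2 * r" x] r by (simp add: power_mult_distrib)
    qed
    show "0 \<le> levi_form g x v" if x: "x \<in> W" "w x = 0" for x v
    proof (cases "n x < 2 * r\<^sup>2")
      case True
      then have "n x \<le> 4 * r\<^sup>2" using zero_le_power2[of r] by linarith
      then have "n x \<le> (2 * r)\<^sup>2" by (simp add: power_mult_distrib)
      then have "x \<in> cball x0 (2 * r)" using n_dist(1)[of "2 * r" x] r by simp
      then have "0 \<le> ?H G x v"
      proof (cases "v = 0")
        case True
        obtain g' g'' where "C2_derivs G g' g'' UNIV" using CG C2_on_iff_derivs open_UNIV by blast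
        from C2_derivsD(6)[OF this UNIV_I] show ?thesis using True by (simp add: blinfun.zero_left)
      qed (use HG x in \<open>auto intro: less_imp_le\<close>)
      then have "0 \<le> 3 * (max 0 (G x))\<^sup>2 * ?H G x v" by (intro mult_nonneg_nonneg) auto
      from order_trans[OF this Hg_inner[OF True]] show ?thesis unfolding levi by simp
    next
      case False
      \<comment> \<open>Near a point of the zero set beyond the inner ball either \<open>G\<close>
        is negative or the cutoff is 0. In both cases \<open>g\<close> vanishes on a whole
        neighbourhood, not merely at the point, so its Hessian is 0.\<close>
      define V where "V = {x. G x < 0} \<union> {x. 4 * r\<^sup>2 < n x}"
      have "open V" unfolding V_def
        by (intro open_Un open_Collect_less cn continuous_intros C1_on_continuous[OF C2_on_imp_C1_on[OF CG]])
      moreover have "x \<in> V"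
        using G_outer[of x] x False r unfolding V_def by (cases "n x \<le> 4 * r\<^sup>2") auto
      moreover have "0 = g y" if "y \<in> V" for y
        using that ct0[of y] unfolding V_def g_def cubeplus_def by auto
      ultimately have "hess g x v v = hess (\<lambda>_. 0) x v v" for v by (intro hess_cong) auto
      then show ?thesis unfolding levi hess_const by simp
    qed
    show "0 < levi_form g x v" if x: "x \<in> ball x0 (r / 2)" "w x = 0" "v \<noteq> 0" for x v
    proof -
      have "n x < (r / 2)\<^sup>2" using x n_dist(2)[of "r / 2" x] r by simp
      then have nx: "n x < r\<^sup>2 / 4" by (simp add: power_divide)
      have "0 < r\<^sup>2" using r by simp
      with nx have n2: "n x < 2 * r\<^sup>2" "n x \<le> r\<^sup>2 / 2" by linarith+
      have "0 \<le> n x" unfolding n_eq by simp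
      then have "0 < T x" using T_inner[OF n2(2)] by simp
      then have "0 < G x" unfolding G_def using f(2)[of x] A by (simp add: add_nonneg_pos)
      moreover have "0 < ?H G x v" using x r by (intro HG) auto
      ultimately have "0 < 3 * (max 0 (G x))\<^sup>2 * ?H G x v" by simp
      from less_le_trans[OF this Hg_inner[OF n2(1)]] show ?thesis unfolding levi by simp
    qed
  qed (use r in auto)
qed

section \<open>Locally finite refinements\<close>

text \<open>Second countability reduces the relatively compact open sets to countably many; finite
  unions of these, thinned out so that each compact union lies inside the next open one, form the
  exhaustion.\<close>

lemma compact_exhaustion:
  assumes haus: "Hausdorff_space Y" and sc: "second_countable Y" and lc: "locally_compact_space Y"
  obtains V D :: "nat \<Rightarrow> 'a set" where "V 0 = {}" "\<And>k. openin Y (V k)" "\<And>k. compactin Y (D k)"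
    "\<And>k. V k \<subseteq> D k" "\<And>k. D k \<subseteq> V (Suc k)" "topspace Y = (\<Union>k. V k)"
proof -
  define \<U> where "\<U> = {U. openin Y U \<and> (\<exists>K. compactin Y K \<and> U \<subseteq> K)}"
  have "\<Union>\<U> = topspace Y"
  proof (rule subset_antisym)
    show "\<Union>\<U> \<subseteq> topspace Y" unfolding \<U>_def by (auto dest: openin_subset)
    show "topspace Y \<subseteq> \<Union>\<U>"
    proof
      fix y assume "y \<in> topspace Y"
      then obtain U K where "openin Y U" "compactin Y K" "y \<in> U" "U \<subseteq> K"
        using lc unfolding locally_compact_space_def by blast
      then show "y \<in> \<Union>\<U>" unfolding \<U>_def by blast
    qed
  qed
  moreover have "\<forall>U\<in>\<U>. openin Y U" unfolding \<U>_def by blast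
  ultimately have "\<exists>\<V>. countable \<V> \<and> \<V> \<subseteq> \<U> \<and> \<Union>\<V> = topspace Y"
    using second_countable_imp_Lindelof_space[OF sc] unfolding Lindelof_space_def by auto
  then obtain \<V> where \<V>: "countable \<V>" "\<V> \<subseteq> \<U>" "\<Union>\<V> = topspace Y" by (elim exE conjE)
  \<comment> \<open>Adjoining the empty set makes the family nonempty, hence enumerable by
    \<open>from_nat_into\<close> even when the space is empty.\<close>
  define U where "U = from_nat_into (insert {} \<V>)"
  have cU: "countable (insert {} \<V>)" using \<V>(1) by simp
  have U_in: "U i \<in> insert {} \<V>" for i unfolding U_def by (rule from_nat_into) simp
  have oK: "openin Y (U i) \<and> (\<exists>K. compactin Y K \<and> U i \<subseteq> K)" for i
  proof (cases "U i \<in> \<V>")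
    case True
    then show ?thesis using \<V>(2) unfolding \<U>_def by blast
  next
    case False
    then have "U i = {}" using U_in[of i] by blast
    then show ?thesis using compactin_empty[of Y] by auto
  qed
  then have oU: "openin Y (U i)" for i by blast
  from oK have "\<forall>i. \<exists>K. compactin Y K \<and> U i \<subseteq> K" by blast
  from choice[OF this] obtain K where K: "\<And>i. compactin Y (K i)" "\<And>i. U i \<subseteq> K i" by blast
  have UU: "(\<Union>i. U i) = topspace Y"
    using range_from_nat_into[OF _ cU] \<V>(3) unfolding U_def by auto
  define C where "C n = (\<Union>i<n. K i)" for n :: nat
  define P where "P n = (\<Union>i<n. U i)" for n :: nat
  have C: "compactin Y (C n)" for n unfolding C_def by (intro compactin_Union) (auto simp: K)
  have P: "openin Y (P n)" for n unfolding P_def by (intro openin_Union) (auto simp: oU)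
  have step: "\<exists>n'>n. C n \<subseteq> P n'" for n
  proof -
    have "C n \<subseteq> \<Union>(range P)"
      using compactin_subset_topspace[OF C] UU unfolding P_def by fastforce
    then obtain \<F> where \<F>: "finite \<F>" "\<F> \<subseteq> range P" "C n \<subseteq> \<Union>\<F>"
      using C[of n] P unfolding compactin_def by (elim conjE allE[of _ "range P"] impE) auto
    then obtain N where N: "finite N" "\<F> = P ` N" by (meson finite_subset_image)
    have "P i \<subseteq> P (Max (insert (Suc n) N))" if "i \<in> N" for i
    proof -
      have "i \<le> Max (insert (Suc n) N)" using that N by simp
      then show ?thesis unfolding P_def by (intro UN_mono) auto
    qed
    then have "C n \<subseteq> P (Max (insert (Suc n) N))" using \<F>(3) N(2) by blast
    moreover have "n < Max (insert (Suc n) N)"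
      by (rule Suc_le_lessD, rule Max_ge) (use N in auto)
    ultimately show ?thesis by blast
  qed
  \<comment> \<open>The start \<open>m 0 = 0\<close> makes the first open set an empty union, and
    strict growth ensures that the chosen subsequence still exhausts the space.\<close>
  have "\<exists>m :: nat \<Rightarrow> nat. \<forall>k. (k = 0 \<longrightarrow> m k = 0) \<and> m k < m (Suc k) \<and> C (m k) \<subseteq> P (m (Suc k))"
    by (rule dependent_nat_choice) (use step in auto)
  then obtain m :: "nat \<Rightarrow> nat" where m: "m 0 = 0" "\<And>k. m k < m (Suc k) \<and> C (m k) \<subseteq> P (m (Suc k))"
    by blast
  have km: "k \<le> m k" for k
    by (induction k) (use m(2) in \<open>auto intro: Suc_leI order.strict_trans1\<close>)
  have "topspace Y = (\<Union>k. P (m k))"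
  proof (rule subset_antisym)
    show "topspace Y \<subseteq> (\<Union>k. P (m k))"
    proof
      fix y assume "y \<in> topspace Y"
      then obtain i where "y \<in> U i" using UU by blast
      then have "y \<in> P (m (Suc i))" using km[of "Suc i"] unfolding P_def by auto
      then show "y \<in> (\<Union>k. P (m k))" by blast
    qed
  qed (use openin_subset[OF P] in blast)
  then show thesis
    using that[of "\<lambda>k. P (m k)" "\<lambda>k. C (m k)"] m P C K(2) unfolding P_def C_def by (simp add: UN_mono)
qed

text \<open>The sets \<open>N a\<close> have to cover while the sets \<open>T a\<close> have to be
  locally finite. Each compact layer of an exhaustion is covered by finitely many \<open>N a\<close>
  whose \<open>T a\<close> avoid the earlier part of the exhaustion.\<close>

lemma locally_finite_subfamily:
  fixes N T :: "'i \<Rightarrow> 'a set"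
  assumes haus: "Hausdorff_space Y" and sc: "second_countable Y" and lc: "locally_compact_space Y"
    and base: "\<And>y B. openin Y B \<Longrightarrow> y \<in> B \<Longrightarrow> \<exists>a\<in>I. openin Y (N a) \<and> y \<in> N a \<and> T a \<subseteq> B"
  shows "\<exists>J\<subseteq>I. topspace Y \<subseteq> (\<Union>a\<in>J. N a) \<and>
    (\<forall>y\<in>topspace Y. \<exists>V. openin Y V \<and> y \<in> V \<and> finite {a \<in> J. T a \<inter> V \<noteq> {}})"
proof -
  obtain V D :: "nat \<Rightarrow> 'a set" where VD: "V 0 = {}" "\<And>k. openin Y (V k)" "\<And>k. compactin Y (D k)"
    "\<And>k. V k \<subseteq> D k" "\<And>k. D k \<subseteq> V (Suc k)" "topspace Y = (\<Union>k. V k)"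
    using compact_exhaustion[OF haus sc lc] by blast
  \<comment> \<open>The set forbidden to layer \<open>k\<close> is \<open>D (k - 1)\<close>, with
    nothing forbidden at 0. It lies inside \<open>V k\<close>, hence is disjoint from the layer
    \<open>L k\<close>, as the covering argument requires.\<close>
  define X where "X k = (case k of 0 \<Rightarrow> {} | Suc j \<Rightarrow> D j)" for k
  define L where "L k = D (Suc k) - V k" for k
  have D: "closedin Y (D k)" for k using compactin_imp_closedin[OF haus VD(3)] .
  have X: "closedin Y (X k)" for k unfolding X_def by (auto split: nat.split simp: D)
  have L: "compactin Y (L k)" for k
    by (rule closed_compactin[OF VD(3)[of "Suc k"]]) (auto simp: L_def intro: closedin_diff D VD)
  have LX: "L k \<subseteq> topspace Y - X k" for k
    using VD(5) compactin_subset_topspace[OF L, of k] unfolding L_def X_def by (auto split: nat.split)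
  have "\<exists>F. finite F \<and> F \<subseteq> I \<and> (\<forall>a\<in>F. openin Y (N a) \<and> T a \<inter> X k = {}) \<and> L k \<subseteq> (\<Union>a\<in>F. N a)" for k
  proof -
    define G where "G = {a \<in> I. openin Y (N a) \<and> T a \<inter> X k = {}}"
    have "L k \<subseteq> \<Union>(N ` G)"
    proof
      fix y assume y: "y \<in> L k"
      have "openin Y (topspace Y - X k)" using X by blast
      from base[OF this, of y] LX y obtain a where
        "a \<in> I" "openin Y (N a)" "y \<in> N a" "T a \<subseteq> topspace Y - X k" by blast
      then show "y \<in> \<Union>(N ` G)" unfolding G_def by blast
    qed
    moreover have "\<forall>U\<in>N ` G. openin Y U" unfolding G_def by blast
    ultimately obtain \<F> where \<F>: "finite \<F>" "\<F> \<subseteq> N ` G" "L k \<subseteq> \<Union>\<F>"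
      using L[of k] unfolding compactin_def by meson
    then obtain F where "finite F" "F \<subseteq> G" "\<F> = N ` F" by (meson finite_subset_image)
    with \<F>(3) show ?thesis unfolding G_def by blast
  qed
  then obtain F where F: "\<And>k. finite (F k)" "\<And>k. F k \<subseteq> I" "\<And>k a. a \<in> F k \<Longrightarrow> T a \<inter> X k = {}"
    "\<And>k. L k \<subseteq> (\<Union>a\<in>F k. N a)" by metis
  show ?thesis
  proof (intro exI[of _ "\<Union>k. F k"] conjI ballI)
    show "(\<Union>k. F k) \<subseteq> I" using F(2) by blast
    show "topspace Y \<subseteq> (\<Union>a\<in>\<Union>k. F k. N a)"
    proof
      fix y assume "y \<in> topspace Y"
      then have ex: "\<exists>k. y \<in> V k" using VD(6) by blast
      define k where "k = (LEAST k. y \<in> V k)"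
      have yk: "y \<in> V k" unfolding k_def using ex by (rule LeastI_ex)
      then obtain j where j: "k = Suc j" using VD(1) by (cases k) auto
      have "y \<notin> V j" using not_less_Least[of j "\<lambda>k. y \<in> V k"] j unfolding k_def by simp
      then have "y \<in> L j" using yk VD(4)[of k] unfolding L_def j by blast
      then show "y \<in> (\<Union>a\<in>\<Union>k. F k. N a)" using F(4)[of j] by blast
    qed
  next
    fix y assume "y \<in> topspace Y"
    then obtain j where j: "y \<in> V j" using VD(6) by blast
    \<comment> \<open>All layers after \<open>j\<close> use only sets avoiding \<open>D j\<close>,
      so \<open>V j\<close> can be met only by the finitely many indices of the layers up to
      \<open>j\<close>.\<close>
    have DX: "D j \<subseteq> X k" if "j < k" for k
    proof -
      have k: "k = Suc (k - 1)" "j \<le> k - 1" using that by auto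
      define i where "i = k - 1"
      note k = k[folded i_def]
      have "D j \<subseteq> D i" by (rule lift_Suc_mono_le[OF _ k(2)]) (use VD in blast)
      then show ?thesis unfolding X_def k(1) by simp
    qed
    have "{a \<in> \<Union>k. F k. T a \<inter> V j \<noteq> {}} \<subseteq> (\<Union>k\<le>j. F k)"
    proof
      fix a assume "a \<in> {a \<in> \<Union>k. F k. T a \<inter> V j \<noteq> {}}"
      then obtain k where k: "a \<in> F k" "T a \<inter> V j \<noteq> {}" by blast
      have "\<not> j < k" using F(3)[OF k(1)] k(2) DX[of k] VD(4)[of j] by blast
      then show "a \<in> (\<Union>k\<le>j. F k)" using k(1) by auto
    qed
    then have "finite {a \<in> \<Union>k. F k. T a \<inter> V j \<noteq> {}}" by (rule finite_subset) (simp add: F(1))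
    with j VD(2) show "\<exists>V. openin Y V \<and> y \<in> V \<and> finite {a \<in> \<Union>k. F k. T a \<inter> V \<noteq> {}}" by blast
  qed
qed

section \<open>Locality, additivity and stability of the Levi form\<close>

lemma levi_form_cong:
  fixes f g :: "complex ^ 'n::finite \<Rightarrow> real"
  assumes "open W" "z \<in> W" "C2_on f W" "\<And>y. y \<in> W \<Longrightarrow> f y = g y"
  shows "levi_form g z v = levi_form f z v"
proof -
  have g: "C2_on g W" by (rule C2_on_cong[OF assms(1) _ assms(3)]) (rule assms(4))
  have h: "hess g z u w = hess f z u w" for u w
    by (rule hess_cong[OF assms(1-3)]) (rule assms(4))
  show ?thesis
    unfolding levi_form_eq_hess[OF assms(3,1,2)] levi_form_eq_hess[OF g assms(1,2)] h ..
qed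

lemma levi_form_zero: "levi_form (\<lambda>_. 0) z v = 0"
  using levi_form_eq_hess[of "\<lambda>_. 0" UNIV z v] by (simp add: hess_const)

lemma levi_form_sum:
  fixes f :: "'i \<Rightarrow> complex ^ 'n::finite \<Rightarrow> real"
  assumes W: "open W" "z \<in> W" and f: "\<And>i. i \<in> I \<Longrightarrow> C2_on (f i) W"
  shows "levi_form (\<lambda>x. \<Sum>i\<in>I. f i x) z v = (\<Sum>i\<in>I. levi_form (f i) z v)"
proof -
  have C2: "C2_on (\<lambda>x. \<Sum>i\<in>I. f i x) W" by (rule C2_on_sum) (rule f)
  have hess: "hess (\<lambda>x. \<Sum>i\<in>I. f i x) z u w = (\<Sum>i\<in>I. hess (f i) z u w)" for u w
    by (rule hess_sum[OF W]) (rule f)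
  have "levi_form (\<lambda>x. \<Sum>i\<in>I. f i x) z v
      = (\<Sum>i\<in>I. (hess (f i) z v v + hess (f i) z (\<i> *s v) (\<i> *s v)) / 4)"
    unfolding levi_form_eq_hess[OF C2 W] hess
    by (simp only: sum.distrib sum_divide_distrib[symmetric])
  also have "\<dots> = (\<Sum>i\<in>I. levi_form (f i) z v)"
    by (rule sum.cong) (simp_all add: levi_form_eq_hess[OF f W])
  finally show ?thesis .
qed

text \<open>A neighbourhood has to work for all \<open>v\<close> at once. By homogeneity and
  compactness of the sphere the form at \<open>z\<close> is at least \<open>c\<close> times the
  squared norm, and where \<open>f''\<close> moves by less than \<open>c\<close> the two Hessians,
  divided by 4, change the form by less than half of that.\<close>

lemma levi_form_positive_open:
  fixes f :: "complex ^ 'n::finite \<Rightarrow> real"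
  assumes f: "C2_on f W" "open W" and z: "z \<in> W" and pos: "\<And>v. v \<noteq> 0 \<Longrightarrow> 0 < levi_form f z v"
  obtains \<delta> where "0 < \<delta>" "ball z \<delta> \<subseteq> W" "\<And>y v. y \<in> ball z \<delta> \<Longrightarrow> v \<noteq> 0 \<Longrightarrow> 0 < levi_form f y v"
proof -
  obtain f' f'' where D: "C2_derivs f f' f'' W" using f C2_on_iff_derivs by blast
  have L: "levi_form f y v = (f'' y v v + f'' y (\<i> *s v) (\<i> *s v)) / 4" if "y \<in> W" for y v
    unfolding levi_form_eq_hess[OF f that] C2_derivsD(6)[OF D that] ..
  obtain c where c: "0 < c" "\<And>y v. y \<in> {z} \<Longrightarrow> c * (norm v)\<^sup>2 \<le> levi_form f y v"
  proof (rule quadratic_form_lower_bound)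
    have ci: "continuous_on S (\<lambda>v. \<i> *s v)" for S :: "(complex ^ 'n) set"
      by (rule bounded_linear.continuous_on[OF bounded_linear_smult]) (intro continuous_intros)
    have "continuous_on ({z} \<times> sphere 0 1) (\<lambda>x. (f'' z (snd x) (snd x) + f'' z (\<i> *s snd x) (\<i> *s snd x)) / 4)"
      by (intro continuous_intros continuous_on_compose2[OF ci]) auto
    then show "continuous_on ({z} \<times> sphere 0 1) (\<lambda>(x, v). levi_form f x v)"
      by (rule continuous_on_eq) (use L z in auto)
    have "levi_form f z (s *\<^sub>R v) = s\<^sup>2 * levi_form f z v" for s v
    proof -
      have "\<i> *s (s *\<^sub>R v) = s *\<^sub>R (\<i> *s v)" by (simp add: vec_eq_iff)
      then show ?thesis unfolding L[OF z]
        by (simp add: blinfun.scaleR_left blinfun.scaleR_right power2_eq_square algebra_simps)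
    qed
    then show "levi_form f x (s *\<^sub>R v) = s\<^sup>2 * levi_form f x v" if "x \<in> {z}" for x s v using that by simp
  qed (use pos in auto)
  have "continuous_on W f''" by (rule C2_derivsD(4)[OF D])
  then have "isCont f'' z" using f(2) z by (simp add: continuous_on_eq_continuous_at)
  then obtain d where d: "0 < d" "\<And>y. dist y z < d \<Longrightarrow> dist (f'' y) (f'' z) < c"
    using c(1) unfolding continuous_at_eps_delta by blast
  obtain d' where d': "0 < d'" "ball z d' \<subseteq> W" using f(2) z open_contains_ball by blast
  show thesis
  proof (rule that[of "min d d'"])
    fix y v assume y: "y \<in> ball z (min d d')" and v: "(v :: complex ^ 'n) \<noteq> 0"
    have yW: "y \<in> W" using y d' by auto
    have n: "norm (f'' y - f'' z) < c" using d(2)[of y] y by (simp add: dist_norm norm_minus_commute)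
    have diff: "\<bar>f'' y u u - f'' z u u\<bar> < c * (norm u)\<^sup>2" if "u \<noteq> 0" for u
    proof -
      have "\<bar>f'' y u u - f'' z u u\<bar> = norm ((f'' y - f'' z) u u)" by (simp add: blinfun.diff_left)
      also have "\<dots> \<le> norm ((f'' y - f'' z) u) * norm u" by (rule norm_blinfun)
      also have "\<dots> \<le> (norm (f'' y - f'' z) * norm u) * norm u" by (intro mult_right_mono norm_blinfun) auto
      also have "\<dots> < (c * norm u) * norm u" using n that by simp
      finally show ?thesis by (simp add: power2_eq_square mult.assoc)
    qed
    have iv: "\<i> *s v \<noteq> 0" using v norm_i_smult[of v] by auto
    have "c * (norm v)\<^sup>2 \<le> levi_form f z v" using c(2) by simp
    moreover have "0 < c * (norm v)\<^sup>2" using c(1) v by simp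
    ultimately show "0 < levi_form f y v"
      using diff[OF v] diff[OF iv] unfolding L[OF yW] L[OF z] norm_i_smult abs_less_iff
      by (simp add: field_simps)
  qed (use d d' in auto)
qed

text \<open>Totally real points form an open subset of the submanifold, here in terms of the
  defining map. A base point that is not complex thus needs no assumption on the complex points
  around it.\<close>

lemma nondegenerate_open:
  fixes w' :: "complex ^ 'n::finite \<Rightarrow> (complex ^ 'n) \<Rightarrow>\<^sub>L 'b::euclidean_space"
  assumes W: "open W" "x0 \<in> W" and w': "continuous_on W w'"
    and nd: "\<And>v. v \<noteq> 0 \<Longrightarrow> w' x0 v \<noteq> 0 \<or> w' x0 (\<i> *s v) \<noteq> 0"
  obtains s where "0 < s" "\<And>x v. x \<in> ball x0 s \<Longrightarrow> v \<noteq> 0 \<Longrightarrow> w' x v \<noteq> 0 \<or> w' x (\<i> *s v) \<noteq> 0"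
proof -
  define q where "q x v = (norm (w' x0 v))\<^sup>2 + (norm (w' x0 (\<i> *s v)))\<^sup>2" for x :: "complex ^ 'n" and v
  obtain c where c: "0 < c" "\<And>y v. y \<in> {x0} \<Longrightarrow> c * (norm v)\<^sup>2 \<le> q y v"
  proof (rule quadratic_form_lower_bound)
    have ci: "continuous_on S (\<lambda>v. \<i> *s v)" for S :: "(complex ^ 'n) set"
      by (rule bounded_linear.continuous_on[OF bounded_linear_smult]) (intro continuous_intros)
    show "continuous_on ({x0} \<times> sphere 0 1) (\<lambda>(x, v). q x v)"
      unfolding q_def split_beta by (intro continuous_intros continuous_on_compose2[OF ci]) auto
    show "0 < q x v" if "v \<noteq> 0" for x v
      using nd[OF that] unfolding q_def by (auto intro: add_pos_nonneg add_nonneg_pos)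
    have "\<i> *s (s *\<^sub>R v) = s *\<^sub>R (\<i> *s v)" for s and v :: "complex ^ 'n"
      by (simp add: vec_eq_iff)
    then show "q x (s *\<^sub>R v) = s\<^sup>2 * q x v" for x s v
      unfolding q_def by (simp add: blinfun.scaleR_right power_mult_distrib distrib_left)
  qed auto
  \<comment> \<open>If both derivatives vanished at \<open>x\<close>, each of the two terms of
    \<open>q\<close> would be below half of its lower bound
    \<open>c * (norm v)\<^sup>2\<close>.\<close>
  define e where "e = sqrt (c / 2)"
  have e: "0 < e" "e\<^sup>2 = c / 2" unfolding e_def using c(1) by auto
  have "isCont w' x0" using w' W by (simp add: continuous_on_eq_continuous_at)
  then obtain s where s: "0 < s" "\<And>y. dist y x0 < s \<Longrightarrow> dist (w' y) (w' x0) < e"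
    using e(1) unfolding continuous_at_eps_delta by blast
  show thesis
  proof (rule that[OF s(1)], rule ccontr)
    fix x v assume x: "x \<in> ball x0 s" and v: "(v :: complex ^ 'n) \<noteq> 0"
      and *: "\<not> (w' x v \<noteq> 0 \<or> w' x (\<i> *s v) \<noteq> 0)"
    have n: "norm (w' x - w' x0) < e" using s(2)[of x] x by (simp add: dist_norm norm_minus_commute)
    have b: "(norm (w' x0 u))\<^sup>2 < c / 2 * (norm u)\<^sup>2" if "u \<noteq> 0" "w' x u = 0" for u
    proof -
      have "norm (w' x0 u) = norm ((w' x - w' x0) u)" using that(2) by (simp add: blinfun.diff_left)
      also have "\<dots> \<le> norm (w' x - w' x0) * norm u" by (rule norm_blinfun)
      also have "\<dots> < e * norm u" using n that by simp
      finally have "(norm (w' x0 u))\<^sup>2 < (e * norm u)\<^sup>2" by (intro power_strict_mono) auto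
      then show ?thesis by (simp add: power_mult_distrib e)
    qed
    have iv: "\<i> *s v \<noteq> 0" using v norm_i_smult[of v] by auto
    have "q x0 v < c / 2 * (norm v)\<^sup>2 + c / 2 * (norm v)\<^sup>2"
      unfolding q_def using b[OF v] b[OF iv] * unfolding norm_i_smult by (intro add_strict_mono) auto
    then show False using c(2)[of x0 v] by simp
  qed
qed

section \<open>Charts and tangent vectors\<close>

locale complex_mfd =
  fixes X :: "'a topology" and A :: "('a, 'n::finite) chart set"
  assumes mfd: "complex_manifold X A"
begin

definition coord_inv :: "('a, 'n) chart \<Rightarrow> complex ^ 'n \<Rightarrow> 'a" where
  "coord_inv c = inv_into (fst c) (snd c)"

lemma chart_facts:
  assumes "c \<in> A"
  shows chart_openin: "openin X (fst c)" and chart_open: "open (snd c ` fst c)"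
    and chart_homeo: "homeomorphic_map (subtopology X (fst c)) (top_of_set (snd c ` fst c)) (snd c)"
    and chart_inj: "inj_on (snd c) (fst c)"
proof -
  have "topological_chart X c" using mfd assms unfolding complex_manifold_def by blast
  then show 1: "openin X (fst c)" and "open (snd c ` fst c)"
    and h: "homeomorphic_map (subtopology X (fst c)) (top_of_set (snd c ` fst c)) (snd c)"
    unfolding topological_chart_def by (auto simp: split_beta)
  have "inj_on (snd c) (topspace (subtopology X (fst c)))" using h by (rule homeomorphic_imp_injective_map)
  then show "inj_on (snd c) (fst c)" using openin_subset[OF 1] by (simp add: Int_absorb1)
qed

lemma topspace_chart: "c \<in> A \<Longrightarrow> fst c \<subseteq> topspace X"
  using chart_openin openin_subset by blast

lemma coord_inv_coord [simp]: "c \<in> A \<Longrightarrow> x \<in> fst c \<Longrightarrow> coord_inv c (snd c x) = x"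
  unfolding coord_inv_def using chart_inj by simp

lemma chart_open_image:
  assumes "c \<in> A" "openin X V" "V \<subseteq> fst c"
  shows "open (snd c ` V)"
proof -
  have "openin (subtopology X (fst c)) V"
    using openin_Int_open openin_subtopology assms by (metis Int_absorb2)
  then have "openin (top_of_set (snd c ` fst c)) (snd c ` V)"
    using homeomorphic_map_openness_eq[OF chart_homeo[OF assms(1)]] by blast
  then show ?thesis using chart_open[OF assms(1)] openin_open_trans by blast
qed

lemma chart_open_preimage:
  assumes "c \<in> A" "open G"
  shows "openin X {x \<in> fst c. snd c x \<in> G}"
proof -
  have "continuous_map (subtopology X (fst c)) (top_of_set (snd c ` fst c)) (snd c)"
    using chart_homeo[OF assms(1)] by (rule homeomorphic_imp_continuous_map)
  then have "continuous_map (subtopology X (fst c)) euclidean (snd c)"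
    using continuous_map_into_fulltopology by blast
  then have "openin (subtopology X (fst c)) {x \<in> topspace (subtopology X (fst c)). snd c x \<in> G}"
    using openin_continuous_map_preimage assms(2) open_openin by blast
  moreover have "{x \<in> topspace (subtopology X (fst c)). snd c x \<in> G} = {x \<in> fst c. snd c x \<in> G}"
    using topspace_chart[OF assms(1)] by auto
  ultimately show ?thesis using openin_trans_full[OF _ chart_openin[OF assms(1)]] by simp
qed

lemma chart_compact_preimage:
  assumes "c \<in> A" "compact K" "K \<subseteq> snd c ` fst c"
  shows "compactin X {x \<in> fst c. snd c x \<in> K}"
proof -
  have im: "snd c ` {x \<in> fst c. snd c x \<in> K} = K" using assms(3) by auto
  have "compactin (top_of_set (snd c ` fst c)) K"
    using assms(2,3) by (simp add: compactin_subtopology)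
  then have "compactin (subtopology X (fst c)) {x \<in> fst c. snd c x \<in> K}"
    using homeomorphic_map_compactness[OF chart_homeo[OF assms(1)], of "{x \<in> fst c. snd c x \<in> K}"]
      topspace_chart[OF assms(1)] im by auto
  then show ?thesis by (simp add: compactin_subtopology)
qed

lemma transition_eq: "transition c d = snd d \<circ> coord_inv c"
  unfolding transition_def coord_inv_def by (simp add: split_beta)

lemma transition_coord [simp]: "c \<in> A \<Longrightarrow> x \<in> fst c \<Longrightarrow> transition c d (snd c x) = snd d x"
  unfolding transition_eq by simp

lemma transition_domain_open:
  assumes "c \<in> A" "d \<in> A" shows "open (snd c ` (fst c \<inter> fst d))"
  using assms by (intro chart_open_image openin_Int chart_openin) auto

lemma transition_holomorphic:
  assumes "c \<in> A" "d \<in> A"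
  shows "holomorphic_map_on (transition c d) (snd c ` (fst c \<inter> fst d))"
  using mfd assms unfolding complex_manifold_def holomorphically_compatible_def by blast

abbreviation transition_deriv :: "('a, 'n) chart \<Rightarrow> ('a, 'n) chart \<Rightarrow> 'a \<Rightarrow> complex ^ 'n \<Rightarrow> complex ^ 'n" where
  "transition_deriv c d x \<equiv> frechet_derivative (transition c d) (at (snd c x))"

lemma transition_has_derivative:
  assumes "c \<in> A" "d \<in> A" "x \<in> fst c" "x \<in> fst d"
  shows "(transition c d has_derivative transition_deriv c d x) (at (snd c x))"
    and "transition_deriv c d x (k *s v) = k *s transition_deriv c d x v"
  using holomorphic_map_deriv[OF transition_holomorphic[OF assms(1,2)]] assms(3,4) by auto

lemma transition_deriv_comp:
  assumes "c \<in> A" "d \<in> A" "e \<in> A" "x \<in> fst c" "x \<in> fst d" "x \<in> fst e"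
  shows "transition_deriv d e x (transition_deriv c d x v) = transition_deriv c e x v"
proof -
  have "(transition d e has_derivative transition_deriv d e x) (at (transition c d (snd c x)))"
    using transition_has_derivative(1)[of d e x] assms by simp
  from has_derivative_compose[OF transition_has_derivative(1)[of c d x] this] assms
  have "((\<lambda>y. transition d e (transition c d y)) has_derivative
      (\<lambda>v. transition_deriv d e x (transition_deriv c d x v))) (at (snd c x))" by simp
  then have "(transition c e has_derivative
      (\<lambda>v. transition_deriv d e x (transition_deriv c d x v))) (at (snd c x))"
    by (rule has_derivative_transform_within_open[where s="snd c ` (fst c \<inter> fst d)"])
      (use assms transition_domain_open in auto)
  from frechet_derivative_at[OF this] show ?thesis by metis
qed

lemma transition_deriv_self:
  assumes "c \<in> A" "x \<in> fst c"
  shows "transition_deriv c c x v = v"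
proof -
  have "((\<lambda>y. y) has_derivative (\<lambda>v. v)) (at (snd c x))" by simp
  then have "(transition c c has_derivative (\<lambda>v. v)) (at (snd c x))"
    by (rule has_derivative_transform_within_open[where s="snd c ` (fst c \<inter> fst c)"])
      (use assms transition_domain_open[of c c] in auto)
  from frechet_derivative_at[OF this] show ?thesis by metis
qed

lemma transition_deriv_nonzero:
  assumes "c \<in> A" "d \<in> A" "x \<in> fst c" "x \<in> fst d" "v \<noteq> 0"
  shows "transition_deriv c d x v \<noteq> 0"
proof
  assume "transition_deriv c d x v = 0"
  then have "v = transition_deriv d c x 0"
    using transition_deriv_comp[of c d c x v] transition_deriv_self[of c x v] assms by simp
  moreover have "transition_deriv d c x 0 = 0"
    using transition_has_derivative(1)[of d c x] assms
    by (intro linear_0 bounded_linear.linear) (auto intro: has_derivative_bounded_linear)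
  ultimately show False using assms by simp
qed

text \<open>The tangent space of the submanifold asks for a velocity in every chart. It is obtained
  by transporting the curve, restricted to times at which it lies in both charts, by the transition
  map.\<close>

lemma velocities_transition:
  assumes c: "c \<in> A" and d: "d \<in> A" and x: "x \<in> fst c" "x \<in> fst d"
    and u: "u \<in> velocities (snd c ` (fst c \<inter> S)) (snd c x)"
  shows "transition_deriv c d x u \<in> velocities (snd d ` (fst d \<inter> S)) (snd d x)"
proof -
  obtain \<gamma> \<epsilon> where \<gamma>: "0 < \<epsilon>" "\<gamma> C1_differentiable_on {-\<epsilon><..<\<epsilon>}"
    "\<gamma> ` {-\<epsilon><..<\<epsilon>} \<subseteq> snd c ` (fst c \<inter> S)" "\<gamma> 0 = snd c x" "(\<gamma> has_vector_derivative u) (at 0)"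
    using u unfolding velocities_def by blast
  obtain \<gamma>' where \<gamma>': "\<And>s. s \<in> {-\<epsilon><..<\<epsilon>} \<Longrightarrow> (\<gamma> has_vector_derivative \<gamma>' s) (at s)"
    "continuous_on {-\<epsilon><..<\<epsilon>} \<gamma>'" using \<gamma>(2) unfolding C1_differentiable_on_def by blast
  define Dm where "Dm = snd c ` (fst c \<inter> fst d)"
  have Dm: "open Dm" unfolding Dm_def by (rule transition_domain_open[OF c d])
  have "isCont \<gamma> 0" using \<gamma>(5) has_vector_derivative_continuous by blast
  moreover have "\<gamma> 0 \<in> Dm" unfolding Dm_def \<gamma>(4) using x by blast
  ultimately obtain \<delta> where \<delta>: "0 < \<delta>" "\<And>s. dist s 0 < \<delta> \<Longrightarrow> \<gamma> s \<in> Dm"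
    using Dm unfolding continuous_at_open by (metis continuous_at_eps_delta open_contains_ball mem_ball dist_commute subsetD \<open>isCont \<gamma> 0\<close>)
  define e where "e = min \<epsilon> \<delta>"
  have e: "0 < e" "{-e<..<e} \<subseteq> {-\<epsilon><..<\<epsilon>}" "\<And>s. s \<in> {-e<..<e} \<Longrightarrow> \<gamma> s \<in> Dm"
    unfolding e_def using \<gamma>(1) \<delta> by (auto simp: dist_norm)
  have "C1_on (transition c d) Dm" unfolding Dm_def
    by (intro C2_on_imp_C1_on holomorphic_map_C2 transition_holomorphic transition_domain_open c d)
  then obtain F where F: "\<And>y. y \<in> Dm \<Longrightarrow> (transition c d has_derivative blinfun_apply (F y)) (at y)"
    "continuous_on Dm F" unfolding C1_on_def by blast
  have dd: "((\<lambda>s. transition c d (\<gamma> s)) has_vector_derivative F (\<gamma> s) (\<gamma>' s)) (at s)" if "s \<in> {-e<..<e}" for s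
  proof -
    have "(\<gamma> has_derivative (\<lambda>h. h *\<^sub>R \<gamma>' s)) (at s)"
      using \<gamma>'(1) that e(2) unfolding has_vector_derivative_def by blast
    from has_derivative_compose[OF this F(1)[OF e(3)[OF that]]]
    show ?thesis unfolding has_vector_derivative_def by (simp add: blinfun.scaleR_right)
  qed
  have cont: "continuous_on {-e<..<e} (\<lambda>s. F (\<gamma> s) (\<gamma>' s))"
  proof (intro continuous_intros)
    have "continuous_on {-e<..<e} \<gamma>"
      using \<gamma>'(1) e(2) by (meson continuous_at_imp_continuous_on has_vector_derivative_continuous subsetD)
    then show "continuous_on {-e<..<e} (\<lambda>s. F (\<gamma> s))"
      by (rule continuous_on_compose2[OF F(2)]) (use e(3) in blast)
    show "continuous_on {-e<..<e} \<gamma>'" using \<gamma>'(2) e(2) by (rule continuous_on_subset)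
  qed
  have 0: "(0::real) \<in> {-e<..<e}" using e(1) by simp
  have "blinfun_apply (F (snd c x)) = transition_deriv c d x"
    using frechet_derivative_at[OF F(1)] \<open>\<gamma> 0 \<in> Dm\<close> unfolding \<gamma>(4) by blast
  moreover have "\<gamma>' 0 = u" using vector_derivative_unique_at[OF \<gamma>'(1) \<gamma>(5)] \<gamma>(1) by simp
  ultimately have d0: "((\<lambda>s. transition c d (\<gamma> s)) has_vector_derivative transition_deriv c d x u) (at 0)"
    using dd[OF 0] \<gamma>(4) by simp
  have im: "(\<lambda>s. transition c d (\<gamma> s)) ` {-e<..<e} \<subseteq> snd d ` (fst d \<inter> S)"
  proof
    fix z assume "z \<in> (\<lambda>s. transition c d (\<gamma> s)) ` {-e<..<e}"
    then obtain s where s: "s \<in> {-e<..<e}" "z = transition c d (\<gamma> s)" by blast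
    obtain y where y: "y \<in> fst c \<inter> S" "\<gamma> s = snd c y" using \<gamma>(3) e(2) s(1) by blast
    obtain y' where y': "y' \<in> fst c \<inter> fst d" "\<gamma> s = snd c y'" using e(3)[OF s(1)] unfolding Dm_def by blast
    have "y = y'" using inj_onD[OF chart_inj[OF c], of y y'] y y' by auto
    then show "z \<in> snd d ` (fst d \<inter> S)" using y y' s(2) c by auto
  qed
  show ?thesis unfolding velocities_def mem_Collect_eq
  proof (intro exI[of _ "\<lambda>s. transition c d (\<gamma> s)"] exI[of _ e] conjI)
    show "(\<lambda>s. transition c d (\<gamma> s)) C1_differentiable_on {-e<..<e}"
      unfolding C1_differentiable_on_def
      by (intro exI[of _ "\<lambda>s. F (\<gamma> s) (\<gamma>' s)"] conjI ballI dd cont)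
    show "transition c d (\<gamma> 0) = snd d x" using \<gamma>(4) c x by simp
  qed (use e d0 im in auto)
qed

text \<open>Bridge from coordinates to the intrinsic notion. Its contrapositive yields
  nondegeneracy: at a point that is not complex, the derivative of the defining map cannot kill both
  \<open>v\<close> and \<open>\<i> *s v\<close> for \<open>v \<noteq> 0\<close>.\<close>

lemma complex_pointI:
  assumes c: "c \<in> A" and x: "x \<in> fst c" "x \<in> S" and v: "v \<noteq> 0"
    and vel: "v \<in> velocities (snd c ` (fst c \<inter> S)) (snd c x)"
      "\<i> *s v \<in> velocities (snd c ` (fst c \<inter> S)) (snd c x)"
  shows "x \<in> complex_points A S"
proof -
  \<comment> \<open>The coordinate vector \<open>u\<close> in the chart \<open>c\<close> is spread
    to all charts around \<open>x\<close>; the value 0 elsewhere follows the convention of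
    \<open>tangent_space\<close>.\<close>
  define \<tau> where "\<tau> u d = (if d \<in> A \<and> x \<in> fst d then transition_deriv c d x u else 0)" for u d
  have tan: "\<tau> u \<in> tangent_space A x" for u
    unfolding tangent_space_def \<tau>_def using transition_deriv_comp c x by auto
  have sub: "\<tau> u \<in> submanifold_tangent_space A S x"
    if "u \<in> velocities (snd c ` (fst c \<inter> S)) (snd c x)" for u
    unfolding submanifold_tangent_space_def
    using tan velocities_transition[OF c _ x(1) _ that] by (auto simp: \<tau>_def)
  have "\<tau> (\<i> *s v) = J_op (\<tau> v)"
    unfolding J_op_def \<tau>_def using transition_has_derivative(2)[OF c _ x(1)] by auto
  then have "\<tau> (\<i> *s v) \<in> submanifold_tangent_space A S x \<inter> J_op ` submanifold_tangent_space A S x"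
    using sub[OF vel(1)] sub[OF vel(2)] by blast
  moreover have "\<tau> (\<i> *s v) \<noteq> (\<lambda>_. 0)"
  proof
    assume "\<tau> (\<i> *s v) = (\<lambda>_. 0)"
    then have "\<tau> (\<i> *s v) c = 0" by metis
    then have "\<i> *s v = 0" unfolding \<tau>_def using c x transition_deriv_self by simp
    then show False using v norm_i_smult[of v] by simp
  qed
  ultimately show ?thesis unfolding complex_points_def totally_real_at_def using x(2) by blast
qed

end

section \<open>Local equations of a C1 submanifold\<close>

lemma subspace_is_kernel:
  fixes L :: "'e::euclidean_space set"
  assumes "subspace L"
  obtains P :: "'e \<Rightarrow> 'e" where "bounded_linear P" "\<And>y. P y = 0 \<longleftrightarrow> y \<in> L"
proof -
  obtain B where B: "B \<subseteq> L" "pairwise orthogonal B" "\<And>x. x \<in> B \<Longrightarrow> norm x = 1" "independent B" "span B = L"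
    using orthonormal_basis_subspace[OF assms] by metis
  have fin: "finite B" using B(4) by (rule independent_imp_finite)
  \<comment> \<open>The component of \<open>y\<close> orthogonal to \<open>L\<close>.\<close>
  define P where "P y = y - (\<Sum>b\<in>B. (y \<bullet> b) *\<^sub>R b)" for y
  have bl: "bounded_linear P" unfolding P_def
    by (intro bounded_linear_sub bounded_linear_ident bounded_linear_sum bounded_linear_scaleR_left
        bounded_linear_compose[OF bounded_linear_scaleR_left] bounded_linear_inner_left)
  have P0: "P b = 0" if b: "b \<in> B" for b
  proof -
    have "(\<Sum>a\<in>B. (b \<bullet> a) *\<^sub>R a) = (\<Sum>a\<in>B. if a = b then b else 0)"
    proof (rule sum.cong)
      fix a assume a: "a \<in> B"
      show "(b \<bullet> a) *\<^sub>R a = (if a = b then b else 0)"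
      proof (cases "a = b")
        case True
        then have "b \<bullet> a = 1" using B(3)[OF b] by (metis norm_eq_1)
        then show ?thesis using True by simp
      next
        case False
        then have "orthogonal b a" by (intro pairwiseD[OF B(2) b a]) simp
        then show ?thesis using False by (simp add: orthogonal_def)
      qed
    qed simp
    then show ?thesis unfolding P_def using b fin by simp
  qed
  have "P y = 0 \<longleftrightarrow> y \<in> L" for y
  proof
    assume "P y = 0"
    then have "y = (\<Sum>b\<in>B. (y \<bullet> b) *\<^sub>R b)" unfolding P_def by simp
    moreover have "(\<Sum>b\<in>B. (y \<bullet> b) *\<^sub>R b) \<in> span B" by (intro span_sum span_scale span_base)
    ultimately show "y \<in> L" using B(5) by simp
  next
    assume "y \<in> L"
    then show "P y = 0"
      using linear_eq_0_on_span[OF bounded_linear.linear[OF bl], of B y] P0 B(5) by blast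
  qed
  with bl that show thesis by blast
qed

text \<open>The equation is the straightening map followed by a linear map with kernel
  \<open>L\<close>; its target is all of the ambient space, so the dimension of \<open>L\<close>
  never has to be named. A kernel vector is the velocity of the preimage of a straight segment in
  \<open>L\<close>.\<close>

lemma C1_submanifold_flat_equation:
  fixes M :: "'e::euclidean_space set"
  assumes flat: "C1_submanifold_flat M" and x: "x \<in> M"
  obtains W and w :: "'e \<Rightarrow> 'e" and w' where "open W" "x \<in> W"
    "\<And>y. y \<in> W \<Longrightarrow> (w has_derivative blinfun_apply (w' y)) (at y)" "continuous_on W w'"
    "\<And>y. y \<in> W \<Longrightarrow> w y = 0 \<longleftrightarrow> y \<in> M"
    "\<And>y v. y \<in> W \<Longrightarrow> y \<in> M \<Longrightarrow> w' y v = 0 \<Longrightarrow> v \<in> velocities M y"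
proof -
  obtain W and \<Phi> :: "'e \<Rightarrow> 'e" and L where W: "x \<in> W" "C1_diffeomorphism_on \<Phi> W" "subspace L"
    "\<Phi> ` (W \<inter> M) = \<Phi> ` W \<inter> L"
    using flat x unfolding C1_submanifold_flat_def by blast
  have \<Phi>: "open W" "inj_on \<Phi> W" "C1_on \<Phi> W" "open (\<Phi> ` W)" "C1_on (inv_into W \<Phi>) (\<Phi> ` W)"
    using W(2) unfolding C1_diffeomorphism_on_def by auto
  define \<Psi> where "\<Psi> = inv_into W \<Phi>"
  have \<Psi>\<Phi>: "\<Psi> (\<Phi> y) = y" if "y \<in> W" for y unfolding \<Psi>_def using \<Phi>(2) that by simp
  obtain \<Phi>' where \<Phi>': "\<And>y. y \<in> W \<Longrightarrow> (\<Phi> has_derivative blinfun_apply (\<Phi>' y)) (at y)" "continuous_on W \<Phi>'"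
    using \<Phi>(3) unfolding C1_on_def by blast
  obtain \<Psi>' where \<Psi>': "\<And>y. y \<in> \<Phi> ` W \<Longrightarrow> (\<Psi> has_derivative blinfun_apply (\<Psi>' y)) (at y)"
    "continuous_on (\<Phi> ` W) \<Psi>'"
    using \<Phi>(5) unfolding C1_on_def \<Psi>_def by blast
  obtain P :: "'e \<Rightarrow> 'e" where P: "bounded_linear P" "\<And>y. P y = 0 \<longleftrightarrow> y \<in> L"
    using subspace_is_kernel[OF W(3)] by blast
  define w where "w y = P (\<Phi> y)" for y
  define w' where "w' y = Blinfun P o\<^sub>L \<Phi>' y" for y
  have w'_apply: "blinfun_apply (w' y) = (\<lambda>v. P (\<Phi>' y v))" for y
    unfolding w'_def by (simp add: fun_eq_iff bounded_linear_Blinfun_apply P)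
  have M_iff: "y \<in> M \<longleftrightarrow> \<Phi> y \<in> L" if y: "y \<in> W" for y
  proof
    show "\<Phi> y \<in> L" if "y \<in> M" using W(4) y that by blast
    assume "\<Phi> y \<in> L"
    then obtain z where "z \<in> W \<inter> M" "\<Phi> y = \<Phi> z" using W(4) y by blast
    then show "y \<in> M" using \<Phi>(2) y by (metis IntD1 IntD2 inj_onD)
  qed
  show thesis
  proof (rule that[of W w w'])
    show "(w has_derivative blinfun_apply (w' y)) (at y)" if "y \<in> W" for y
      unfolding w_def w'_apply by (rule bounded_linear.has_derivative[OF P(1) \<Phi>'(1)[OF that]])
    show "continuous_on W w'" unfolding w'_def by (intro continuous_intros \<Phi>'(2))
    show "w y = 0 \<longleftrightarrow> y \<in> M" if "y \<in> W" for y unfolding w_def P(2) M_iff[OF that] ..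
    show "v \<in> velocities M y" if y: "y \<in> W" "y \<in> M" and v: "w' y v = 0" for y v
    proof -
      define u where "u = \<Phi>' y v"
      have uL: "u \<in> L" using v unfolding w'_apply P(2) u_def .
      have yL: "\<Phi> y \<in> L" using M_iff y by blast
      obtain r where r: "0 < r" "ball (\<Phi> y) r \<subseteq> \<Phi> ` W"
        using \<Phi>(4) y(1) open_contains_ball by blast
      define \<epsilon> where "\<epsilon> = r / (norm u + 1)"
      have n1: "0 < norm u + 1" by (simp add: add_nonneg_pos)
      have \<epsilon>: "0 < \<epsilon>" unfolding \<epsilon>_def using r n1 by simp
      have in_im: "\<Phi> y + s *\<^sub>R u \<in> \<Phi> ` W" if "s \<in> {-\<epsilon><..<\<epsilon>}" for s
      proof -
        have "\<bar>s\<bar> * norm u \<le> \<bar>s\<bar> * (norm u + 1)" by (intro mult_left_mono) auto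
        also have "\<dots> < \<epsilon> * (norm u + 1)" using that n1 by (intro mult_strict_right_mono) auto
        also have "\<dots> = r" unfolding \<epsilon>_def using n1 by simp
        finally show ?thesis using r(2) by (auto simp: dist_norm)
      qed
      have d: "((\<lambda>s. \<Psi> (\<Phi> y + s *\<^sub>R u)) has_vector_derivative \<Psi>' (\<Phi> y + s *\<^sub>R u) u) (at s)"
        if "s \<in> {-\<epsilon><..<\<epsilon>}" for s
      proof -
        have "((\<lambda>s. \<Phi> y + s *\<^sub>R u) has_derivative (\<lambda>h. h *\<^sub>R u)) (at s)"
          by (auto intro!: derivative_eq_intros)
        from has_derivative_compose[OF this \<Psi>'(1)[OF in_im[OF that]]]
        show ?thesis unfolding has_vector_derivative_def by (simp add: blinfun.scaleR_right)
      qed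
      have c: "continuous_on {-\<epsilon><..<\<epsilon>} (\<lambda>s. \<Psi>' (\<Phi> y + s *\<^sub>R u) u)"
        by (intro continuous_intros continuous_on_compose2[OF \<Psi>'(2)]) (use in_im in auto)
      \<comment> \<open>Differentiating the identity \<open>\<Psi> (\<Phi> z) = z\<close> shows that
        the pulled back segment has velocity \<open>v\<close> at time 0.\<close>
      have "((\<lambda>z. z) has_derivative (\<lambda>h. \<Psi>' (\<Phi> y) (\<Phi>' y h))) (at y)"
      proof (rule has_derivative_transform_within_open[OF _ \<Phi>(1) y(1)])
        show "((\<lambda>z. \<Psi> (\<Phi> z)) has_derivative (\<lambda>h. \<Psi>' (\<Phi> y) (\<Phi>' y h))) (at y)"
          by (rule has_derivative_compose[OF \<Phi>'(1)[OF y(1)] \<Psi>'(1)]) (use y in blast)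
      qed (rule \<Psi>\<Phi>)
      from has_derivative_unique[OF this has_derivative_ident]
      have "\<Psi>' (\<Phi> y) u = v" unfolding u_def by metis
      then have d0: "((\<lambda>s. \<Psi> (\<Phi> y + s *\<^sub>R u)) has_vector_derivative v) (at 0)"
        using d[of 0] \<epsilon> by simp
      have im: "(\<lambda>s. \<Psi> (\<Phi> y + s *\<^sub>R u)) ` {-\<epsilon><..<\<epsilon>} \<subseteq> M"
      proof
        fix z assume "z \<in> (\<lambda>s. \<Psi> (\<Phi> y + s *\<^sub>R u)) ` {-\<epsilon><..<\<epsilon>}"
        then obtain s where s: "s \<in> {-\<epsilon><..<\<epsilon>}" "z = \<Psi> (\<Phi> y + s *\<^sub>R u)" by blast
        have "\<Phi> y + s *\<^sub>R u \<in> L" using W(3) yL uL by (simp add: subspace_add subspace_scale)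
        then have "\<Phi> y + s *\<^sub>R u \<in> \<Phi> ` (W \<inter> M)" using in_im[OF s(1)] W(4) by blast
        then show "z \<in> M" unfolding s(2) using \<Psi>\<Phi> by auto
      qed
      show ?thesis unfolding velocities_def mem_Collect_eq
      proof (intro exI[of _ "\<lambda>s. \<Psi> (\<Phi> y + s *\<^sub>R u)"] exI[of _ \<epsilon>] conjI)
        show "(\<lambda>s. \<Psi> (\<Phi> y + s *\<^sub>R u)) C1_differentiable_on {-\<epsilon><..<\<epsilon>}"
          unfolding C1_differentiable_on_def
          by (intro exI[of _ "\<lambda>s. \<Psi>' (\<Phi> y + s *\<^sub>R u) u"] conjI ballI d c)
        show "\<Psi> (\<Phi> y + 0 *\<^sub>R u) = y" using \<Psi>\<Phi> y by simp
      qed (use \<epsilon> im d0 in auto)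
    qed
  qed (use \<Phi> W in auto)
qed

context complex_mfd
begin

section \<open>C2 functions on the manifold\<close>

definition C2_near :: "('a, 'n) chart \<Rightarrow> ('a \<Rightarrow> real) \<Rightarrow> 'a \<Rightarrow> bool" where
  "C2_near c f x \<longleftrightarrow> (\<exists>V. openin X V \<and> x \<in> V \<and> V \<subseteq> fst c \<and> C2_on (f \<circ> coord_inv c) (snd c ` V))"

definition chart_levi :: "('a, 'n) chart \<Rightarrow> ('a \<Rightarrow> real) \<Rightarrow> 'a \<Rightarrow> complex ^ 'n \<Rightarrow> real" where
  "chart_levi c f x v = levi_form (f \<circ> coord_inv c) (snd c x) v"

text \<open>The definition of strong plurisubharmonicity quantifies over all charts of the maximal
  atlas; thanks to this lemma one chart around each point is enough.\<close>

lemma C2_near_transfer: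
  assumes c: "c \<in> A" and d: "d \<in> A" and x: "x \<in> fst d" and f: "C2_near c f x"
  shows "C2_near d f x" and "chart_levi d f x v = chart_levi c f x (transition_deriv d c x v)"
proof -
  obtain V where V: "openin X V" "x \<in> V" "V \<subseteq> fst c" "C2_on (f \<circ> coord_inv c) (snd c ` V)"
    using f unfolding C2_near_def by blast
  define W where "W = snd d ` (V \<inter> fst d)"
  have oV: "openin X (V \<inter> fst d)" by (intro openin_Int V chart_openin d)
  have oW: "open W" unfolding W_def using d oV by (rule chart_open_image) simp
  have ocV: "open (snd c ` V)" by (rule chart_open_image[OF c V(1,3)])
  have xW: "snd d x \<in> W" unfolding W_def using V x by blast
  have hol: "holomorphic_map_on (transition d c) W"
    using transition_holomorphic[OF d c] V(3) unfolding W_def holomorphic_map_on_def by blast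
  have sub: "transition d c ` W \<subseteq> snd c ` V" unfolding W_def using d by auto
  have eq: "(f \<circ> coord_inv c) (transition d c y) = (f \<circ> coord_inv d) y" if "y \<in> W" for y
    using that V(3) c d unfolding W_def by auto
  have C2: "C2_on (\<lambda>y. (f \<circ> coord_inv c) (transition d c y)) W"
    by (rule C2_on_compose[OF V(4) holomorphic_map_C2[OF hol oW] sub oW])
  have "C2_on (f \<circ> coord_inv d) W" by (rule C2_on_cong[OF oW _ C2]) (rule eq)
  then show "C2_near d f x" unfolding C2_near_def W_def using oV V x by blast
  have "levi_form (f \<circ> coord_inv d) (snd d x) v
      = levi_form (\<lambda>y. (f \<circ> coord_inv c) (transition d c y)) (snd d x) v"
    by (rule levi_form_cong[OF oW xW C2]) (rule eq)
  also have "\<dots> = levi_form (f \<circ> coord_inv c) (transition d c (snd d x)) (transition_deriv d c x v)"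
    by (rule levi_form_compose[OF hol oW V(4) ocV sub xW])
  finally show "chart_levi d f x v = chart_levi c f x (transition_deriv d c x v)"
    unfolding chart_levi_def using d x by simp
qed

lemma C2_near_cong:
  assumes c: "c \<in> A" and x: "x \<in> fst c" and N: "openin X N" "x \<in> N"
    and eq: "\<And>y. y \<in> N \<Longrightarrow> f y = g y" and f: "C2_near c f x"
  shows "C2_near c g x" and "chart_levi c g x v = chart_levi c f x v"
proof -
  obtain V where V: "openin X V" "x \<in> V" "V \<subseteq> fst c" "C2_on (f \<circ> coord_inv c) (snd c ` V)"
    using f unfolding C2_near_def by blast
  have oV: "openin X (V \<inter> N)" by (intro openin_Int V N)
  have oW: "open (snd c ` (V \<inter> N))" by (rule chart_open_image[OF c oV]) (use V in blast)
  have e: "(f \<circ> coord_inv c) y = (g \<circ> coord_inv c) y" if "y \<in> snd c ` (V \<inter> N)" for y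
    using that V(3) c eq by auto
  have C2: "C2_on (f \<circ> coord_inv c) (snd c ` (V \<inter> N))" by (rule C2_on_subset[OF V(4)]) blast
  have "C2_on (g \<circ> coord_inv c) (snd c ` (V \<inter> N))" by (rule C2_on_cong[OF oW _ C2]) (rule e)
  then show "C2_near c g x" unfolding C2_near_def using oV V N by blast
  show "chart_levi c g x v = chart_levi c f x v" unfolding chart_levi_def
    by (rule levi_form_cong[OF oW _ C2]) (use e V N in auto)
qed

lemma C2_near_zero:
  assumes "c \<in> A" "x \<in> fst c"
  shows "C2_near c (\<lambda>_. 0) x" and "chart_levi c (\<lambda>_. 0) x v = 0"
proof -
  have "(\<lambda>_. 0) \<circ> coord_inv c = (\<lambda>_. 0::real)" by (simp add: fun_eq_iff)
  then show "C2_near c (\<lambda>_. 0) x" "chart_levi c (\<lambda>_. 0) x v = 0"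
    using chart_openin[OF assms(1)] assms(2) unfolding C2_near_def chart_levi_def
    by (auto simp: levi_form_zero)
qed

lemma C2_near_sum:
  assumes c: "c \<in> A" and x: "x \<in> fst c" and I: "finite I" and f: "\<And>i. i \<in> I \<Longrightarrow> C2_near c (f i) x"
  shows "C2_near c (\<lambda>y. \<Sum>i\<in>I. f i y) x"
    and "chart_levi c (\<lambda>y. \<Sum>i\<in>I. f i y) x v = (\<Sum>i\<in>I. chart_levi c (f i) x v)"
proof -
  have "\<forall>i\<in>I. \<exists>V. openin X V \<and> x \<in> V \<and> V \<subseteq> fst c \<and> C2_on (f i \<circ> coord_inv c) (snd c ` V)"
    using f unfolding C2_near_def by blast
  from bchoice[OF this] obtain V where
    V: "\<forall>i\<in>I. openin X (V i) \<and> x \<in> V i \<and> V i \<subseteq> fst c \<and> C2_on (f i \<circ> coord_inv c) (snd c ` V i)"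
    by blast
  define N where "N = \<Inter>(insert (fst c) (V ` I))"
  have N: "openin X N" unfolding N_def by (rule openin_Inter) (use I V chart_openin[OF c] in auto)
  have Nx: "x \<in> N" "N \<subseteq> fst c" unfolding N_def using V x by auto
  have oW: "open (snd c ` N)" by (rule chart_open_image[OF c N Nx(2)])
  have C2: "C2_on (f i \<circ> coord_inv c) (snd c ` N)" if "i \<in> I" for i
    by (rule C2_on_subset[of _ "snd c ` V i"]) (use V that N_def in auto)
  have eq: "(\<lambda>y. \<Sum>i\<in>I. f i y) \<circ> coord_inv c = (\<lambda>z. \<Sum>i\<in>I. (f i \<circ> coord_inv c) z)"
    by (simp add: fun_eq_iff)
  have "C2_on ((\<lambda>y. \<Sum>i\<in>I. f i y) \<circ> coord_inv c) (snd c ` N)"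
    unfolding eq by (rule C2_on_sum) (rule C2)
  then show "C2_near c (\<lambda>y. \<Sum>i\<in>I. f i y) x" unfolding C2_near_def using N Nx by blast
  show "chart_levi c (\<lambda>y. \<Sum>i\<in>I. f i y) x v = (\<Sum>i\<in>I. chart_levi c (f i) x v)"
    unfolding chart_levi_def eq by (rule levi_form_sum[OF oW _ C2]) (use Nx in blast)
qed

lemma chart_levi_positive_open:
  assumes c: "c \<in> A" and x: "x \<in> fst c" and f: "C2_near c f x"
    and pos: "\<And>v. v \<noteq> 0 \<Longrightarrow> 0 < chart_levi c f x v"
  obtains N where "openin X N" "x \<in> N"
    "\<And>d y v. d \<in> A \<Longrightarrow> y \<in> fst d \<Longrightarrow> y \<in> N \<Longrightarrow> v \<noteq> 0 \<Longrightarrow> 0 < chart_levi d f y v"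
proof -
  obtain V where V: "openin X V" "x \<in> V" "V \<subseteq> fst c" "C2_on (f \<circ> coord_inv c) (snd c ` V)"
    using f unfolding C2_near_def by blast
  have oW: "open (snd c ` V)" by (rule chart_open_image[OF c V(1,3)])
  have xV: "snd c x \<in> snd c ` V" using V by blast
  obtain \<delta> where \<delta>: "0 < \<delta>" "ball (snd c x) \<delta> \<subseteq> snd c ` V"
    "\<And>y v. y \<in> ball (snd c x) \<delta> \<Longrightarrow> v \<noteq> 0 \<Longrightarrow> 0 < levi_form (f \<circ> coord_inv c) y v"
    using levi_form_positive_open[OF V(4) oW xV] pos unfolding chart_levi_def by blast
  define N where "N = V \<inter> {y \<in> fst c. snd c y \<in> ball (snd c x) \<delta>}"
  show thesis
  proof (rule that[of N])
    show "openin X N" unfolding N_def by (intro openin_Int V chart_open_preimage c open_ball)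
    show "x \<in> N" unfolding N_def using V x \<delta> by simp
    fix d y v assume d: "d \<in> A" and y: "y \<in> fst d" "y \<in> N" and v: "(v :: complex ^ 'n) \<noteq> 0"
    have yc: "y \<in> fst c" "y \<in> V" "snd c y \<in> ball (snd c x) \<delta>" using y(2) unfolding N_def by auto
    have "C2_near c f y" unfolding C2_near_def using V yc by blast
    then have "chart_levi d f y v = chart_levi c f y (transition_deriv d c y v)"
      by (rule C2_near_transfer(2)[OF c d y(1)])
    also have "0 < \<dots>" unfolding chart_levi_def
      by (rule \<delta>(3)[OF yc(3)]) (rule transition_deriv_nonzero[OF d c y(1) yc(1) v])
    finally show "0 < chart_levi d f y v" .
  qed
qed

lemma strongly_plurisubharmonicI:
  assumes U: "openin X U"
    and C2: "\<And>c x. c \<in> A \<Longrightarrow> x \<in> fst c \<Longrightarrow> x \<in> U \<Longrightarrow> C2_near c f x"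
    and pos: "\<And>c x v. c \<in> A \<Longrightarrow> x \<in> fst c \<Longrightarrow> x \<in> U \<Longrightarrow> v \<noteq> 0 \<Longrightarrow> 0 < chart_levi c f x v"
  shows "strongly_plurisubharmonic_on A U f"
  unfolding strongly_plurisubharmonic_on_def
proof (intro ballI)
  fix c assume c: "c \<in> A"
  have "C2_on (f \<circ> coord_inv c) (snd c ` (fst c \<inter> U))"
  proof (rule C2_on_local)
    show "open (snd c ` (fst c \<inter> U))"
      using c by (rule chart_open_image) (auto intro: openin_Int chart_openin c U)
    fix z assume "z \<in> snd c ` (fst c \<inter> U)"
    then obtain x where x: "x \<in> fst c" "x \<in> U" "z = snd c x" by blast
    obtain V where V: "openin X V" "x \<in> V" "V \<subseteq> fst c" "C2_on (f \<circ> coord_inv c) (snd c ` V)"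
      using C2[OF c x(1,2)] unfolding C2_near_def by blast
    then show "\<exists>W. open W \<and> z \<in> W \<and> C2_on (f \<circ> coord_inv c) W"
      using chart_open_image[OF c V(1,3)] x(3) by blast
  qed
  moreover have "0 < levi_form (f \<circ> coord_inv c) z v" if "z \<in> snd c ` (fst c \<inter> U)" "v \<noteq> 0" for z v
    using that pos[OF c] unfolding chart_levi_def by blast
  ultimately show "case c of (V, \<phi>) \<Rightarrow> C2_on (f \<circ> inv_into V \<phi>) (\<phi> ` (V \<inter> U)) \<and>
      (\<forall>z\<in>\<phi> ` (V \<inter> U). \<forall>v. v \<noteq> 0 \<longrightarrow> 0 < levi_form (f \<circ> inv_into V \<phi>) z v)"
    unfolding coord_inv_def by (simp add: split_beta)
qed

section \<open>Bumps adapted to the submanifold\<close>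

text \<open>Regularity is required everywhere but the sign only on \<open>S\<close>: positivity
  along \<open>S\<close> is an open condition, so the neighbourhood can be found after
  summation.\<close>

definition psh_along :: "'a set \<Rightarrow> ('a \<Rightarrow> real) \<Rightarrow> bool" where
  "psh_along S f \<longleftrightarrow> (\<forall>c\<in>A. \<forall>x\<in>fst c. C2_near c f x \<and> (x \<in> S \<longrightarrow> (\<forall>v. 0 \<le> chart_levi c f x v)))"

definition strict_along :: "'a set \<Rightarrow> ('a \<Rightarrow> real) \<Rightarrow> bool" where
  "strict_along S f \<longleftrightarrow> (\<forall>c\<in>A. \<forall>x\<in>fst c. x \<in> S \<longrightarrow> (\<forall>v. v \<noteq> 0 \<longrightarrow> 0 < chart_levi c f x v))"

text \<open>The support lies over a compact ball inside the chart, and its preimage \<open>K\<close>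
  is closed because \<open>X\<close> is Hausdorff. So every point has a neighbourhood lying in the
  chart domain or one on which the extension is 0.\<close>

lemma extend_bump:
  assumes c: "c \<in> A" and W: "W \<subseteq> snd c ` fst c" and wS: "\<And>y. y \<in> fst c \<Longrightarrow> snd c y \<in> W \<Longrightarrow> y \<in> S \<Longrightarrow> w (snd c y) = 0"
    and g: "C2_on g UNIV" "cball x0 \<rho> \<subseteq> W" "ball x0 \<delta> \<subseteq> W" "\<And>x. g x \<noteq> 0 \<Longrightarrow> x \<in> cball x0 \<rho>"
    and psh: "\<And>x v. x \<in> W \<Longrightarrow> w x = 0 \<Longrightarrow> 0 \<le> levi_form g x v"
    and spsh: "\<And>x v. x \<in> ball x0 \<delta> \<Longrightarrow> w x = 0 \<Longrightarrow> v \<noteq> 0 \<Longrightarrow> 0 < levi_form g x v"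
  defines "f \<equiv> \<lambda>x. if x \<in> fst c then g (snd c x) else 0"
  shows "psh_along S f" and "strict_along (S \<inter> {x \<in> fst c. snd c x \<in> ball x0 \<delta>}) f"
    and "f x \<noteq> 0 \<Longrightarrow> x \<in> fst c \<and> snd c x \<in> W"
proof -
  define K where "K = {x \<in> fst c. snd c x \<in> cball x0 \<rho>}"
  have Haus: "Hausdorff_space X" using mfd unfolding complex_manifold_def by blast
  have "compactin X K" unfolding K_def
    by (rule chart_compact_preimage[OF c compact_cball]) (use g(2) W in blast)
  then have oK: "openin X (topspace X - K)" using compactin_imp_closedin[OF Haus] by blast
  have f0: "0 = f x" if "x \<in> topspace X - K" for x
    using that g(4)[of "snd c x"] unfolding f_def K_def by auto
  have far: "C2_near d f x" "chart_levi d f x v = 0" if "d \<in> A" "x \<in> fst d" "x \<notin> K" for d x v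
  proof -
    have x: "x \<in> topspace X - K" using that topspace_chart by blast
    show "C2_near d f x"
      by (rule C2_near_cong(1)[OF that(1,2) oK x f0 C2_near_zero(1)[OF that(1,2)]])
    show "chart_levi d f x v = 0"
      using C2_near_cong(2)[OF that(1,2) oK x f0 C2_near_zero(1)[OF that(1,2)]] C2_near_zero(2)[OF that(1,2)]
      by simp
  qed
  have eq: "g y = (f \<circ> coord_inv c) y" if "y \<in> snd c ` fst c" for y
    using that c unfolding f_def by auto
  have oc: "open (snd c ` fst c)" by (rule chart_open[OF c])
  have C2g: "C2_on g (snd c ` fst c)" using C2_on_subset[OF g(1)] by blast
  have C2c: "C2_on (f \<circ> coord_inv c) (snd c ` fst c)"
    by (rule C2_on_cong[OF oc _ C2g]) (rule eq)
  have near: "C2_near c f x" "chart_levi c f x v = levi_form g (snd c x) v" if "x \<in> fst c" for x v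
  proof -
    show "C2_near c f x" unfolding C2_near_def using C2c chart_openin[OF c] that by blast
    show "chart_levi c f x v = levi_form g (snd c x) v" unfolding chart_levi_def
      by (rule levi_form_cong[OF oc _ C2g]) (use that eq in auto)
  qed
  have C2: "C2_near d f x" if "d \<in> A" "x \<in> fst d" for d x
  proof (cases "x \<in> K")
    case True
    then show ?thesis using C2_near_transfer(1)[OF c that near(1)] unfolding K_def by blast
  qed (use far that in auto)
  have levi: "chart_levi d f x v = levi_form g (snd c x) (transition_deriv d c x v)"
    if "d \<in> A" "x \<in> fst d" "x \<in> fst c" for d x v
    using C2_near_transfer(2)[OF c that(1,2) near(1)[OF that(3)]] near(2)[OF that(3)] by simp
  show "psh_along S f" unfolding psh_along_def
  proof (intro ballI conjI impI allI)
    fix d x v assume d: "d \<in> A" "x \<in> fst d" and xS: "x \<in> S"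
    show "0 \<le> chart_levi d f x v"
    proof (cases "x \<in> K")
      case True
      then have x: "x \<in> fst c" "snd c x \<in> W" using g(2) unfolding K_def by auto
      then show ?thesis unfolding levi[OF d x(1)] using psh wS xS by blast
    qed (use far d in auto)
  qed (rule C2)
  show "strict_along (S \<inter> {x \<in> fst c. snd c x \<in> ball x0 \<delta>}) f" unfolding strict_along_def
  proof (intro ballI allI impI)
    fix d x v assume d: "d \<in> A" "x \<in> fst d" and x: "x \<in> S \<inter> {x \<in> fst c. snd c x \<in> ball x0 \<delta>}"
      and v: "(v :: complex ^ 'n) \<noteq> 0"
    have xc: "x \<in> fst c" using x by blast
    have "w (snd c x) = 0" using wS x g(3) by blast
    then show "0 < chart_levi d f x v" unfolding levi[OF d xc]
      using spsh x transition_deriv_nonzero[OF d(1) c d(2) xc v] by blast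
  qed
  show "x \<in> fst c \<and> snd c x \<in> W" if "f x \<noteq> 0"
  proof -
    have "x \<in> fst c \<and> g (snd c x) \<noteq> 0" using that unfolding f_def by (auto split: if_splits)
    then show ?thesis using g(2,4) by blast
  qed
qed

text \<open>Openness of \<open>V - S\<close> says that \<open>S\<close> is closed near
  \<open>p\<close>. The set \<open>V\<close> is fixed before \<open>B\<close>, while
  \<open>B\<close> prescribes how small the support must be, as the locally finite selection
  demands.\<close>

lemma adapted_bump:
  assumes S: "C1_submanifold X A S" and iso: "only_isolated_complex_points X A S" and p: "p \<in> S"
  obtains V where "openin X V" "p \<in> V" "openin X (V - S)"
    "\<And>B. openin X B \<Longrightarrow> p \<in> B \<Longrightarrow>
      \<exists>f N. openin X N \<and> p \<in> N \<and> {x. f x \<noteq> 0} \<subseteq> B \<and> psh_along S f \<and> strict_along (S \<inter> N) f"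
proof -
  obtain c where c: "c \<in> A" "p \<in> fst c" "C1_submanifold_flat (snd c ` (fst c \<inter> S))"
    using S p unfolding C1_submanifold_def by (fastforce simp: split_beta)
  define M where "M = snd c ` (fst c \<inter> S)"
  define x0 where "x0 = snd c p"
  have x0: "x0 \<in> M" unfolding M_def x0_def using c p by blast
  obtain W0 and w :: "complex ^ 'n \<Rightarrow> complex ^ 'n" and w' where W0: "open W0" "x0 \<in> W0"
    "\<And>y. y \<in> W0 \<Longrightarrow> (w has_derivative blinfun_apply (w' y)) (at y)" "continuous_on W0 w'"
    "\<And>y. y \<in> W0 \<Longrightarrow> w y = 0 \<longleftrightarrow> y \<in> M"
    "\<And>y v. y \<in> W0 \<Longrightarrow> y \<in> M \<Longrightarrow> w' y v = 0 \<Longrightarrow> v \<in> velocities M y"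
    using C1_submanifold_flat_equation[OF c(3)[folded M_def] x0] by blast
  have MS: "y \<in> S" if y: "y \<in> fst c" "snd c y \<in> M" for y
  proof -
    obtain z where z: "z \<in> fst c" "z \<in> S" "snd c y = snd c z" using y(2) unfolding M_def by blast
    then show ?thesis using inj_onD[OF chart_inj[OF c(1)] z(3)] y(1) by simp
  qed
  have SM: "snd c y \<in> M" if "y \<in> fst c" "y \<in> S" for y using that unfolding M_def by blast
  have nd: "w' (snd c y) v \<noteq> 0 \<or> w' (snd c y) (\<i> *s v) \<noteq> 0"
    if y: "y \<in> fst c" "y \<in> S" "snd c y \<in> W0" "y \<notin> complex_points A S" and v: "v \<noteq> 0" for y v
    using complex_pointI[OF c(1) y(1,2) v] W0(6)[OF y(3) SM[OF y(1,2)]] y(4) unfolding M_def by blast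
  define V where "V = {x \<in> fst c. snd c x \<in> W0}"
  have cw: "continuous_on W0 w"
    using W0(3) by (meson continuous_at_imp_continuous_on has_derivative_continuous)
  have "\<exists>f N. openin X N \<and> p \<in> N \<and> {x. f x \<noteq> 0} \<subseteq> B \<and> psh_along S f \<and> strict_along (S \<inter> N) f"
    if B: "openin X B" "p \<in> B" for B
  proof -
    \<comment> \<open>At a complex point, isolation supplies the neighbourhood \<open>I\<close> and
      excludes only \<open>p\<close>; at any other point, stability of nondegeneracy supplies the
      radius \<open>s\<close>.\<close>
    obtain I s where I: "openin X I" "p \<in> I" "0 < s"
      "\<And>y v. y \<in> fst c \<Longrightarrow> y \<in> S \<Longrightarrow> snd c y \<in> W0 \<Longrightarrow> y \<in> I \<Longrightarrow> snd c y \<in> ball x0 s \<Longrightarrow> y \<noteq> p \<Longrightarrow> v \<noteq> 0 \<Longrightarrow>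
        w' (snd c y) v \<noteq> 0 \<or> w' (snd c y) (\<i> *s v) \<noteq> 0"
    proof (cases "p \<in> complex_points A S")
      case True
      then obtain I where I: "openin X I" "I \<inter> complex_points A S = {p}"
        using iso unfolding only_isolated_complex_points_def by blast
      then have "p \<in> I" "\<And>y. y \<in> I \<Longrightarrow> y \<noteq> p \<Longrightarrow> y \<notin> complex_points A S" by auto
      then show ?thesis using that[of I 1] I(1) nd by simp
    next
      case False
      have "w' x0 v \<noteq> 0 \<or> w' x0 (\<i> *s v) \<noteq> 0" if "v \<noteq> 0" for v
        using nd[OF c(2) p _ False that] W0(2) unfolding x0_def by blast
      then obtain s where "0 < s" "\<And>x v. x \<in> ball x0 s \<Longrightarrow> v \<noteq> 0 \<Longrightarrow> w' x v \<noteq> 0 \<or> w' x (\<i> *s v) \<noteq> 0"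
        using nondegenerate_open[OF W0(1,2,4)] by blast
      then show ?thesis using that[of "topspace X" s] topspace_chart[OF c(1)] c(2) by blast
    qed
    \<comment> \<open>Since the bump will be supported over \<open>W\<close>, intersecting with the
      image of \<open>B\<close> places its support in \<open>B\<close>.\<close>
    define W where "W = W0 \<inter> snd c ` (fst c \<inter> B \<inter> I)"
    have W: "open W" "x0 \<in> W" "W \<subseteq> W0" "W \<subseteq> snd c ` fst c"
    proof -
      have "open (snd c ` (fst c \<inter> B \<inter> I))"
        using c(1) by (rule chart_open_image) (auto intro: openin_Int chart_openin c B I)
      then show "open W" unfolding W_def using W0(1) by blast
      show "x0 \<in> W" unfolding W_def x0_def using W0(2) c(2) B I x0_def by blast
    qed (auto simp: W_def)
    have wder: "(w has_derivative blinfun_apply (w' y)) (at y)" if "y \<in> W" for y using W0(3) W(3) that by blast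
    have cw': "continuous_on W w'" using W0(4) W(3) by (rule continuous_on_subset)
    have nondeg: "w' x v \<noteq> 0 \<or> w' x (\<i> *s v) \<noteq> 0"
      if x: "x \<in> ball x0 s" "x \<in> W" "w x = 0" "x \<noteq> x0" and v: "v \<noteq> 0" for x v
    proof -
      obtain y where y: "y \<in> fst c" "y \<in> B" "y \<in> I" "x = snd c y" using x(2) unfolding W_def by blast
      have xW0: "x \<in> W0" using x(2) W(3) by blast
      have "y \<in> S" using MS[OF y(1)] W0(5)[OF xW0] x(3) y(4) by blast
      moreover have "y \<noteq> p" using x(4) y(4) unfolding x0_def by blast
      ultimately show ?thesis using I(4)[OF y(1) _ _ y(3)] x(1) v xW0 y(4) by blast
    qed
    have wS: "w (snd c y) = 0" if "y \<in> fst c" "snd c y \<in> W" "y \<in> S" for y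
      using W0(5)[of "snd c y"] W(3) that SM by blast
    show ?thesis
    proof (rule local_bump[where w=w and w'=w' and W=W and ?x0.0=x0 and s=s])
      fix g \<rho> \<delta>
      assume g: "C2_on g UNIV" "0 < \<delta>" "cball x0 \<rho> \<subseteq> W" "ball x0 \<delta> \<subseteq> W"
        "\<And>x. g x \<noteq> 0 \<Longrightarrow> x \<in> cball x0 \<rho>"
        "\<And>x v. x \<in> W \<Longrightarrow> w x = 0 \<Longrightarrow> 0 \<le> levi_form g x v"
        "\<And>x v. x \<in> ball x0 \<delta> \<Longrightarrow> w x = 0 \<Longrightarrow> v \<noteq> 0 \<Longrightarrow> 0 < levi_form g x v"
      define f where "f x = (if x \<in> fst c then g (snd c x) else 0)" for x
      define N where "N = {x \<in> fst c. snd c x \<in> ball x0 \<delta>}"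
      have f_eq: "f = (\<lambda>x. if x \<in> fst c then g (snd c x) else 0)" unfolding f_def ..
      have ext1: "psh_along S f" unfolding f_eq
        by (rule extend_bump(1)[where w=w and W=W and ?x0.0=x0 and \<rho>=\<rho> and \<delta>=\<delta>])
          (fact c(1) W(4) wS g)+
      have ext2: "strict_along (S \<inter> N) f" unfolding f_eq N_def
        by (rule extend_bump(2)[where w=w and W=W and ?x0.0=x0 and \<rho>=\<rho> and \<delta>=\<delta>])
          (fact c(1) W(4) wS g)+
      have ext3: "x \<in> fst c \<and> snd c x \<in> W" if fx: "f x \<noteq> 0" for x
        by (rule extend_bump(3)[where w=w and W=W and ?x0.0=x0 and \<rho>=\<rho> and \<delta>=\<delta>])
          (fact c(1) W(4) wS g fx[unfolded f_eq])+
      have fB: "{x. f x \<noteq> 0} \<subseteq> B"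
      proof
        fix x assume "x \<in> {x. f x \<noteq> 0}"
        then have x: "x \<in> fst c" "snd c x \<in> W" using ext3[of x] by auto
        then obtain y where "y \<in> fst c" "y \<in> B" "snd c x = snd c y" unfolding W_def by blast
        then show "x \<in> B" using inj_onD[OF chart_inj[OF c(1)], of x y] x(1) by simp
      qed
      show ?thesis
      proof (intro exI[of _ f] exI[of _ N] conjI fB ext1 ext2)
        show "openin X N" unfolding N_def by (rule chart_open_preimage[OF c(1) open_ball])
        show "p \<in> N" unfolding N_def using c(2) g(2) x0_def by simp
      qed
    qed (fact W(1,2) wder cw' I(3) nondeg)+
  qed
  moreover have "openin X (V - S)"
  proof -
    \<comment> \<open>Inside \<open>V\<close> the submanifold is the zero set of the continuous map
      \<open>w\<close>, hence relatively closed.\<close>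
    have "V - S = {x \<in> fst c. snd c x \<in> W0 \<inter> w -` (- {0})}"
      unfolding V_def using W0(5) MS SM by auto
    moreover have "open (W0 \<inter> w -` (- {0}))"
      by (rule continuous_open_preimage[OF cw W0(1)]) auto
    ultimately show ?thesis using chart_open_preimage[OF c(1), of "W0 \<inter> w -` (- {0})"] by metis
  qed
  moreover have "openin X V" unfolding V_def by (rule chart_open_preimage[OF c(1) W0(1)])
  moreover have "p \<in> V" unfolding V_def using c(2) W0(2) x0_def by simp
  ultimately show thesis using that[of V] by blast
qed

end

section \<open>Gluing the bumps along the submanifold\<close>

theorem proposition1p3:
  fixes X :: "'a topology"
    and A :: "('a, 'n::finite) chart set"
    and S :: "'a set"
  assumes "complex_manifold X A"
    and "C1_submanifold X A S"
    and "only_isolated_complex_points X A S"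
  shows "\<exists>U \<rho>. openin X U \<and> S \<subseteq> U \<and> strongly_plurisubharmonic_on A U \<rho>"
proof -
  interpret complex_mfd X A by unfold_locales (rule assms(1))
  have "\<forall>p\<in>S. \<exists>V. openin X V \<and> p \<in> V \<and> openin X (V - S) \<and> (\<forall>B. openin X B \<longrightarrow> p \<in> B \<longrightarrow>
      (\<exists>f N. openin X N \<and> p \<in> N \<and> {x. f x \<noteq> 0} \<subseteq> B \<and> psh_along S f \<and> strict_along (S \<inter> N) f))"
    using adapted_bump[OF assms(2,3)] by metis
  from bchoice[OF this] obtain V where V: "\<forall>p\<in>S. openin X (V p) \<and> p \<in> V p \<and> openin X (V p - S) \<and>
      (\<forall>B. openin X B \<longrightarrow> p \<in> B \<longrightarrow>
      (\<exists>f N. openin X N \<and> p \<in> N \<and> {x. f x \<noteq> 0} \<subseteq> B \<and> psh_along S f \<and> strict_along (S \<inter> N) f))"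
    by blast
  \<comment> \<open>An open set containing \<open>S\<close> in which \<open>S\<close> is closed; the
    locally finite selection takes place on it instead of \<open>X\<close>.\<close>
  define X' where "X' = (\<Union>p\<in>S. V p)"
  have oX': "openin X X'" unfolding X'_def using V by blast
  have "X' - S = (\<Union>p\<in>S. V p - S)" unfolding X'_def by blast
  moreover have "openin X (\<Union>p\<in>S. V p - S)" using V by blast
  ultimately have oXS: "openin X (X' - S)" by simp
  have SX': "S \<subseteq> X'" unfolding X'_def using V by blast
  define Y where "Y = subtopology X X'"
  have oY: "openin Y B \<longleftrightarrow> openin X B \<and> B \<subseteq> X'" for B
    unfolding Y_def using oX' by (simp add: openin_open_subtopology)
  have tY: "topspace Y = X'" unfolding Y_def using openin_subset[OF oX'] by auto
  have HY: "Hausdorff_space Y" and SY: "second_countable Y"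
    using assms(1) unfolding Y_def complex_manifold_def
    by (auto intro: Hausdorff_space_subtopology second_countable_subtopology)
  have cover: "\<exists>c\<in>A. x \<in> fst c" if "x \<in> topspace X" for x
    using assms(1) that unfolding complex_manifold_def by blast
  have LY: "locally_compact_space Y" unfolding locally_compact_space_def tY
  proof
    fix x assume x: "x \<in> X'"
    then obtain c where c: "c \<in> A" "x \<in> fst c" using cover openin_subset[OF oX'] by blast
    have "open (snd c ` (fst c \<inter> X'))"
      using c(1) by (rule chart_open_image) (auto intro: openin_Int chart_openin c oX')
    then obtain r where r: "0 < r" "cball (snd c x) r \<subseteq> snd c ` (fst c \<inter> X')"
      using open_contains_cball x c(2) by blast
    define U where "U = {y \<in> fst c. snd c y \<in> ball (snd c x) r}"
    define K where "K = {y \<in> fst c. snd c y \<in> cball (snd c x) r}"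
    have UK: "U \<subseteq> K" unfolding U_def K_def using ball_subset_cball by blast
    have KX: "K \<subseteq> X'"
    proof
      fix y assume "y \<in> K"
      then obtain z where "y \<in> fst c" "z \<in> fst c" "z \<in> X'" "snd c y = snd c z" using r(2) unfolding K_def by blast
      then show "y \<in> X'" using inj_onD[OF chart_inj[OF c(1)], of y z] by simp
    qed
    have "compactin X K" unfolding K_def
      by (rule chart_compact_preimage[OF c(1) compact_cball]) (use r(2) in blast)
    then have "compactin Y K" unfolding Y_def using KX by (simp add: compactin_subtopology)
    moreover have "openin Y U" unfolding oY
      using chart_open_preimage[OF c(1) open_ball] UK KX unfolding U_def by blast
    moreover have "x \<in> U" unfolding U_def using c r by simp
    ultimately show "\<exists>U K. openin Y U \<and> compactin Y K \<and> x \<in> U \<and> U \<subseteq> K" using UK by blast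
  qed
  \<comment> \<open>An index carries its region of strict positivity along with the bump: the
    regions have to cover, the supports have to be locally finite.\<close>
  define I where "I = {(f, N). openin X N \<and> psh_along S f \<and> strict_along (S \<inter> N) f}"
  have base: "\<exists>a\<in>I. openin Y (snd a \<inter> X') \<and> y \<in> snd a \<inter> X' \<and> {x. fst a x \<noteq> 0} \<subseteq> B"
    if B: "openin Y B" "y \<in> B" for y B
  proof (cases "y \<in> S")
    case True
    have "openin X B" using B oY by blast
    with bspec[OF V True] B(2) have "\<exists>f N. openin X N \<and> y \<in> N \<and> {x. f x \<noteq> 0} \<subseteq> B \<and>
        psh_along S f \<and> strict_along (S \<inter> N) f" by simp
    then obtain f N where "openin X N" "y \<in> N" "{x. f x \<noteq> 0} \<subseteq> B" "psh_along S f" "strict_along (S \<inter> N) f"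
      by (elim exE conjE)
    then show ?thesis unfolding I_def oY using True SX' oX'
      by (intro bexI[of _ "(f, N)"]) (auto intro: openin_Int)
  next
    case False
    \<comment> \<open>Nothing is demanded off \<open>S\<close>, so the zero function with its empty
      support completes the cover by the region \<open>X' - S\<close>.\<close>
    have "y \<in> X'" using B oY by blast
    moreover have "psh_along S (\<lambda>_. 0)" unfolding psh_along_def using C2_near_zero by simp
    moreover have "strict_along (S \<inter> (X' - S)) (\<lambda>_. 0)" unfolding strict_along_def by simp
    ultimately show ?thesis unfolding I_def oY using False oXS oX'
      by (intro bexI[of _ "(\<lambda>_. 0, X' - S)"]) (auto intro: openin_Int)
  qed
  have "\<exists>J\<subseteq>I. topspace Y \<subseteq> (\<Union>a\<in>J. snd a \<inter> X') \<and>
      (\<forall>y\<in>topspace Y. \<exists>V. openin Y V \<and> y \<in> V \<and> finite {a \<in> J. {x. fst a x \<noteq> 0} \<inter> V \<noteq> {}})"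
    by (rule locally_finite_subfamily[OF HY SY LY, where N="\<lambda>a. snd a \<inter> X'"]) (rule base)
  then obtain J where J: "J \<subseteq> I" "topspace Y \<subseteq> (\<Union>a\<in>J. snd a \<inter> X')"
    "\<forall>y\<in>topspace Y. \<exists>V. openin Y V \<and> y \<in> V \<and> finite {a \<in> J. {x. fst a x \<noteq> 0} \<inter> V \<noteq> {}}"
    by (elim exE conjE)
  \<comment> \<open>The index set is finite at every point of \<open>X'\<close>. Elsewhere an
    infinite index set gives the default value 0, which is harmless as \<open>U\<close> lies in
    \<open>X'\<close>.\<close>
  define \<rho> where "\<rho> x = (\<Sum>a\<in>{a \<in> J. fst a x \<noteq> 0}. fst a x)" for x
  have loc: "\<exists>F B. finite F \<and> F \<subseteq> J \<and> a \<in> F \<and> openin X B \<and> y \<in> B \<and> (\<forall>x\<in>B. (\<Sum>a\<in>F. fst a x) = \<rho> x)"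
    if y: "y \<in> X'" and a: "a \<in> J" for y a
  proof -
    have "y \<in> topspace Y" using y tY by simp
    from bspec[OF J(3) this]
    obtain B where B: "openin Y B" "y \<in> B" "finite {a \<in> J. {x. fst a x \<noteq> 0} \<inter> B \<noteq> {}}"
      by (elim exE conjE)
    \<comment> \<open>Inserting \<open>a\<close> guarantees that a chosen summand, later the one
      strictly positive at the point, occurs in the finite sum.\<close>
    define F where "F = insert a {a \<in> J. {x. fst a x \<noteq> 0} \<inter> B \<noteq> {}}"
    have F: "finite F" "F \<subseteq> J" "a \<in> F" unfolding F_def using B a by auto
    have "(\<Sum>a\<in>F. fst a x) = \<rho> x" if "x \<in> B" for x
      unfolding \<rho>_def by (rule sum.mono_neutral_right[OF F(1)]) (use that F(2) F_def in auto)
    then show ?thesis using F B oY by blast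
  qed
  have JI: "psh_along S (fst a)" "strict_along (S \<inter> snd a) (fst a)" if "a \<in> J" for a
    using J(1) that unfolding I_def by auto
  have C2: "C2_near c \<rho> y" if c: "c \<in> A" and y: "y \<in> fst c" "y \<in> X'" for c y
  proof -
    obtain a where a: "a \<in> J" using J(2) tY y(2) by blast
    obtain F B where F: "finite F" "F \<subseteq> J" "openin X B" "y \<in> B" "\<And>x. x \<in> B \<Longrightarrow> (\<Sum>a\<in>F. fst a x) = \<rho> x"
      using loc[OF y(2) a] by blast
    have s: "C2_near c (\<lambda>x. \<Sum>a\<in>F. fst a x) y"
      by (rule C2_near_sum(1)[OF c y(1) F(1)]) (use JI(1) F(2) c y in \<open>auto simp: psh_along_def\<close>)
    show ?thesis
      by (rule C2_near_cong(1)[OF c y(1) F(3,4), of "\<lambda>x. \<Sum>a\<in>F. fst a x"]) (rule F(5) s, assumption?)+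
  qed
  have pos: "0 < chart_levi c \<rho> p v" if p: "p \<in> S" and c: "c \<in> A" "p \<in> fst c" and v: "v \<noteq> 0" for p c v
  proof -
    have pX: "p \<in> X'" using p SX' by blast
    then obtain a where a: "a \<in> J" "p \<in> snd a" using J(2) tY by blast
    obtain F B where F: "finite F" "F \<subseteq> J" "a \<in> F" "openin X B" "p \<in> B" "\<And>x. x \<in> B \<Longrightarrow> (\<Sum>a\<in>F. fst a x) = \<rho> x"
      using loc[OF pX a(1)] by blast
    have C2F: "C2_near c (fst b) p" if "b \<in> F" for b
      using JI(1)[of b] that F(2) c unfolding psh_along_def by blast
    have s: "C2_near c (\<lambda>x. \<Sum>a\<in>F. fst a x) p" by (rule C2_near_sum(1)[OF c F(1) C2F])
    have "chart_levi c \<rho> p v = chart_levi c (\<lambda>x. \<Sum>a\<in>F. fst a x) p v"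
      by (rule C2_near_cong(2)[OF c F(4,5)]) (rule F(6) s, assumption?)+
    also have "\<dots> = (\<Sum>b\<in>F. chart_levi c (fst b) p v)" by (rule C2_near_sum(2)[OF c F(1) C2F])
    also have "0 < \<dots>"
    proof (rule sum_pos2[OF F(1,3)])
      show "0 < chart_levi c (fst a) p v"
        using JI(2)[OF a(1)] a(2) p c v unfolding strict_along_def by blast
      show "0 \<le> chart_levi c (fst b) p v" if "b \<in> F" for b
        using JI(1)[of b] that F(2) p c unfolding psh_along_def by blast
    qed
    finally show ?thesis .
  qed
  have "\<forall>p\<in>S. \<exists>N. openin X N \<and> p \<in> N \<and>
      (\<forall>d\<in>A. \<forall>y\<in>fst d. y \<in> N \<longrightarrow> (\<forall>v. v \<noteq> 0 \<longrightarrow> 0 < chart_levi d \<rho> y v))"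
  proof
    fix p assume p: "p \<in> S"
    then have pX: "p \<in> X'" using SX' by blast
    then obtain c where c: "c \<in> A" "p \<in> fst c" using cover openin_subset[OF oX'] by blast
    obtain N where "openin X N" "p \<in> N"
      "\<And>d y v. d \<in> A \<Longrightarrow> y \<in> fst d \<Longrightarrow> y \<in> N \<Longrightarrow> v \<noteq> 0 \<Longrightarrow> 0 < chart_levi d \<rho> y v"
      using chart_levi_positive_open[OF c C2[OF c pX] pos[OF p c]] by blast
    then show "\<exists>N. openin X N \<and> p \<in> N \<and>
      (\<forall>d\<in>A. \<forall>y\<in>fst d. y \<in> N \<longrightarrow> (\<forall>v. v \<noteq> 0 \<longrightarrow> 0 < chart_levi d \<rho> y v))" by blast
  qed
  from bchoice[OF this] obtain N where N: "\<forall>p\<in>S. openin X (N p) \<and> p \<in> N p \<and>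
      (\<forall>d\<in>A. \<forall>y\<in>fst d. y \<in> N p \<longrightarrow> (\<forall>v. v \<noteq> 0 \<longrightarrow> 0 < chart_levi d \<rho> y v))" by blast
  \<comment> \<open>The factor \<open>X'\<close> ensures that \<open>\<rho>\<close> is C2 on
    \<open>U\<close>, the union that its Levi form is positive there.\<close>
  define U where "U = X' \<inter> (\<Union>p\<in>S. N p)"
  have U: "openin X U" unfolding U_def using oX' N by (intro openin_Int) auto
  moreover have "S \<subseteq> U" unfolding U_def using SX' N by blast
  moreover have "strongly_plurisubharmonic_on A U \<rho>"
    by (rule strongly_plurisubharmonicI[OF U]) (use C2 N U_def in auto)
  ultimately show ?thesis by blast
qed

end
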